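(* Let $A$ be a finite dimensional $S$-graded-simple $F$-algebra, $S=\mathcal{M}(\{e\}^0,n,m;P)$. Let $f_1,\ldots,f_m$ be orthogonal idempotents and $f_1',\ldots,f_n'$ be orthogonal idempotents of $A$ (some may be zero) such that $B=\bigoplus_{i,j} f_i' A f_j =\bigoplus_{i,j} (B\cap A_{ij})$ is an $S$-graded maximal semisimple subalgebra of $A$, $f_i' \in B \cap R_i$, $f_j \in B \cap L_j$, $\sum_{i=1}^n f'_i=\sum_{j=1}^m f_j=1_B$, and $A=B\oplus J(A)$ (direct sum of subspaces). For $1\leqslant i\leqslant n$, $1\leqslant j\leqslant m$ put $$J^{10}_{ij}:=f'_i L_j (1-1_B),\quad J^{01}_{ij}:=(1-1_B)R_i f_j,\quad J^{10}_{*j} :=\sum_{i=1}^n J^{10}_{ij} = 1_B L_j (1-1_B),\quad J^{01}_{i*} := \sum_{j=1}^m J^{01}_{ij} = (1-1_B) R_i 1_B.$$ Then: (a) Each $J^{10}_{*j}$ is a left $B$-submodule of $J(A)$ and $J^{10}_{*j} =\bigoplus_{i=1}^n J^{10}_{ij}$. Each $J^{01}_{i*}$ is a right $B$-submodule of $J(A)$ and $J^{01}_{i*}=\bigoplus_{j=1}^m J^{01}_{ij}$. Moreover, $$J(A)=\bigoplus_{i=1}^n J^{01}_{i*} \oplus \bigoplus_{j=1}^m J^{10}_{*j}\oplus J(A)^2 \quad\text{and}\quad J(A)^2=\bigoplus_{i=1}^n \bigoplus_{j=1}^m J^{01}_{i*}J^{10}_{*j}$$ (direct sums of subspaces). (b)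 There exists an $F$-linear map $\varphi \colon \bigoplus_{i=1}^n J^{01}_{i*} \oplus \bigoplus_{j=1}^m J^{10}_{*j} \rightarrow B$ defined by $$\varphi(a-1_B a 1_B) = 1_B a 1_B-f_i' a f_j\quad\text{for } a\in f_i'A_{ij}+A_{ij}f_j,\ 1\leqslant i\leqslant n,\ 1\leqslant j\leqslant m,$$ and such that: $\varphi|_{\bigoplus_{j} J^{10}_{*j}}$ is a homomorphism of left $B$-modules with $$J^{10}_{*j}\cap \ker \varphi = 0,\qquad \varphi (J^{10}_{*j}) \cap B f_j =\varphi (J^{10}_{*j}) f_j= 0\quad\text{for every } 1\leqslant j \leqslant m;$$ $\varphi|_{\bigoplus_{i} J^{01}_{i*}}$ is a homomorphism of right $B$-modules with $$J^{01}_{i*} \cap \ker \varphi = 0,\qquad \varphi (J^{01}_{i*}) \cap f_i' B = f_i'\varphi (J^{01}_{i*}) = 0\quad\text{for every }1\leqslant i \leqslant n.$$ (c) For all $1\leqslant i \leqslant n$, $1\leqslant j \leqslant m$, $$A_{ij}=f_i' B f_j\oplus \left\{ \varphi(v)+v \mid v \in J^{10}_{ij}\oplus J^{01}_{ij} \right\}\oplus \left\langle \varphi(v)\varphi(w)+v\varphi(w) + \varphi(v) w + vw\mid v \in J^{01}_{i*},\ w\in J^{10}_{*j} \right\rangle_F$$ (direct sum of subspaces). (d) If $s\in\mathbb N$, $v_\ell \in J^{01}_{i*}$ and $w_\ell \in J^{10}_{*j}$ for $1\leqslant \ell \leqslant s$, then $\sum_{\ell=1}^s v_\ell w_\ell =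 0$ if and only if $\sum_{\ell=1}^s \varphi(v_\ell) \varphi(w_\ell) = 0$. (e) $B \cong M_k(D)$ for some $k \in \mathbb N$ and a division algebra $D$, and $$\dim_{F} \bigoplus_{i=1}^n J^{01}_{i*} \leqslant (n - 1) \dim_{F} B = (n-1)k^2\dim_F D,$$ $$\dim_{F} \bigoplus_{j=1}^m J^{10}_{*j} \leqslant (m - 1) \dim_{F} B = (m-1)k^2\dim_F D,$$ $$\dim_{F} J(A) \leqslant (nm - 1) \dim_{F} B =(nm-1)k^2\dim_F D.$$
   Context: Algebras are associative, not necessarily unital; $F$ is a field; $J(A)$ is the Jacobson radical; products of subspaces denote the additive span of products of elements; $\langle W\rangle_F$ is the $F$-linear span of $W$. $n,m$ are positive integers, $P=(p_{jk})$ is an $m\times n$ matrix with entries in $\{e,\theta\}$, and $S=\mathcal{M}(\{e\}^0,n,m;P)=\{(e,i,j)\mid 1\leqslant i\leqslant n,\ 1\leqslant j\leqslant m\}\cup\{\theta\}$ is the Rees matrix semigroup with zero $\theta$ and product $(e,i,j)(e,k,\ell)=(e,i,\ell)$ if $p_{jk}=e$ and $=\theta$ if $p_{jk}=\theta$. It is assumed that $S$ is completely $0$-simple (every row and every column of $P$ contains an entry $e$), that $S=\langle\operatorname{supp}(A)\rangle\cup\{\theta\}$ where $\operatorname{supp}(A)=\{s\in S\mid A^{(s)}\ne 0\}$ and $\langle\cdot\rangle$ is the generated subsemigroup, and that the homogeneous component of degree $\theta$ is zero. $A_{ij}$ denotes the homogeneous component of degree $(e,i,j)$; thus $A=\bigoplus_{i,j}A_{ij}$,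 $A_{ij}A_{k\ell}\subseteq A_{i\ell}$, and $A_{ij}A_{k\ell}=0$ if $p_{jk}=\theta$. Put $L_j=\bigoplus_{k=1}^n A_{kj}$ and $R_i=\bigoplus_{k=1}^m A_{ik}$. A subspace $V\subseteq A$ is homogeneous ($S$-graded) if $V=\bigoplus_{i,j}(V\cap A_{ij})$. $A$ is $S$-graded-simple if $A^2\ne0$ and $0$ and $A$ are its only homogeneous two-sided ideals. $1_B$ is the identity element of $B$; for $x,r\in A$ one writes $x(1-r):=x-xr$ and $(1-r)x:=x-rx$ even if $A$ has no unit. *)

theory Defs
  imports "HOL-Library.Set_Algebras" "Jordan_Normal_Form.Matrix"
begin

text \<open>
  The algebra is the whole type \<open>'a::ring\<close> (class \<^class>\<open>ring\<close> requires no unit), with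
  scalar multiplication \<open>scale\<close>; its subspaces, subalgebras and ideals are sets.
  The sum of two subspaces, or of a family of them, is the elementwise sum of sets from
  \<^theory>\<open>HOL-Library.Set_Algebras\<close>.
\<close>

locale assoc_algebra = vector_space scale
  for scale :: "'f::field \<Rightarrow> 'a::ring \<Rightarrow> 'a" +
  assumes scale_mult_left: "scale c x * y = scale c (x * y)"
    and scale_mult_right: "x * scale c y = scale c (x * y)"

section \<open>Subspaces, direct sums and products\<close>

definition subspace_prod :: "('f::field \<Rightarrow> 'a::ring \<Rightarrow> 'a) \<Rightarrow> 'a set \<Rightarrow> 'a set \<Rightarrow> 'a set" where
  "subspace_prod scale U V = module.span scale {u * v | u v. u \<in> U \<and> v \<in> V}"

definition is_direct_sum ::
  "('f::field \<Rightarrow> 'a::ab_group_add \<Rightarrow> 'a) \<Rightarrow> 'i set \<Rightarrow> ('i \<Rightarrow> 'a set) \<Rightarrow> 'a set \<Rightarrow> bool" where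
  "is_direct_sum scale I V W \<longleftrightarrow>
     finite I \<and> (\<forall>i\<in>I. module.subspace scale (V i)) \<and> W = (\<Sum>i\<in>I. V i) \<and>
     (\<forall>x. (\<forall>i\<in>I. x i \<in> V i) \<and> (\<Sum>i\<in>I. x i) = 0 \<longrightarrow> (\<forall>i\<in>I. x i = 0))"

definition is_direct_sum_list ::
  "('f::field \<Rightarrow> 'a::ab_group_add \<Rightarrow> 'a) \<Rightarrow> 'a set list \<Rightarrow> 'a set \<Rightarrow> bool" where
  "is_direct_sum_list scale Vs W \<longleftrightarrow> is_direct_sum scale {..<length Vs} (\<lambda>k. Vs ! k) W"

definition linear_map_on ::
  "('f::field \<Rightarrow> 'a::ab_group_add \<Rightarrow> 'a) \<Rightarrow> 'a set \<Rightarrow> 'a set \<Rightarrow> ('a \<Rightarrow> 'a) \<Rightarrow> bool" where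
  "linear_map_on scale V W h \<longleftrightarrow>
     (\<forall>x\<in>V. h x \<in> W) \<and>
     (\<forall>x\<in>V. \<forall>y\<in>V. h (x + y) = h x + h y) \<and>
     (\<forall>c. \<forall>x\<in>V. h (scale c x) = scale c (h x))"

section \<open>Subalgebras, ideals and the Jacobson radical\<close>

definition subalg :: "('f::field \<Rightarrow> 'a::ring \<Rightarrow> 'a) \<Rightarrow> 'a set \<Rightarrow> bool" where
  "subalg scale B \<longleftrightarrow> module.subspace scale B \<and> (\<forall>x\<in>B. \<forall>y\<in>B. x * y \<in> B)"

definition is_identity_of :: "'a::ring set \<Rightarrow> 'a \<Rightarrow> bool" where
  "is_identity_of B u \<longleftrightarrow> u \<in> B \<and> (\<forall>x\<in>B. u * x = x \<and> x * u = x)"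

definition left_submodule ::
  "('f::field \<Rightarrow> 'a::ring \<Rightarrow> 'a) \<Rightarrow> 'a set \<Rightarrow> 'a set \<Rightarrow> 'a set \<Rightarrow> bool" where
  "left_submodule scale B N M \<longleftrightarrow>
     module.subspace scale N \<and> N \<subseteq> M \<and> (\<forall>b\<in>B. \<forall>x\<in>N. b * x \<in> N)"

definition right_submodule ::
  "('f::field \<Rightarrow> 'a::ring \<Rightarrow> 'a) \<Rightarrow> 'a set \<Rightarrow> 'a set \<Rightarrow> 'a set \<Rightarrow> bool" where
  "right_submodule scale B N M \<longleftrightarrow>
     module.subspace scale N \<and> N \<subseteq> M \<and> (\<forall>b\<in>B. \<forall>x\<in>N. x * b \<in> N)"

definition two_sided_ideal :: "('f::field \<Rightarrow> 'a::ring \<Rightarrow> 'a) \<Rightarrow> 'a set \<Rightarrow> bool" where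
  "two_sided_ideal scale I \<longleftrightarrow>
     module.subspace scale I \<and> (\<forall>a. \<forall>x\<in>I. a * x \<in> I \<and> x * a \<in> I)"

text \<open>
  A left ideal \<open>L\<close> of \<open>B\<close> is modular (regular) if some \<open>e \<in> B\<close> is a right identity modulo \<open>L\<close>.
  For algebras without unit the Jacobson radical is the intersection of the modular maximal
  left ideals; it is the whole algebra if there are none.
\<close>

definition modular_maximal_left_ideal ::
  "('f::field \<Rightarrow> 'a::ring \<Rightarrow> 'a) \<Rightarrow> 'a set \<Rightarrow> 'a set \<Rightarrow> bool" where
  "modular_maximal_left_ideal scale B L \<longleftrightarrow>
     left_submodule scale B L B \<and> L \<noteq> B \<and>
     (\<exists>e\<in>B. \<forall>b\<in>B. b - b * e \<in> L) \<and>
     (\<forall>L'. left_submodule scale B L' B \<and> L \<subseteq> L' \<and> L' \<noteq> B \<longrightarrow> L' = L)"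

definition jacobson_rad :: "('f::field \<Rightarrow> 'a::ring \<Rightarrow> 'a) \<Rightarrow> 'a set \<Rightarrow> 'a set" where
  "jacobson_rad scale B = {x \<in> B. \<forall>L. modular_maximal_left_ideal scale B L \<longrightarrow> x \<in> L}"

text \<open>Used only for finite dimensional algebras, where semisimplicity means zero radical.\<close>

definition semisimple_subalg :: "('f::field \<Rightarrow> 'a::ring \<Rightarrow> 'a) \<Rightarrow> 'a set \<Rightarrow> bool" where
  "semisimple_subalg scale B \<longleftrightarrow> subalg scale B \<and> jacobson_rad scale B = {0}"

definition maximal_semisimple_subalg :: "('f::field \<Rightarrow> 'a::ring \<Rightarrow> 'a) \<Rightarrow> 'a set \<Rightarrow> bool" where
  "maximal_semisimple_subalg scale B \<longleftrightarrow>
     semisimple_subalg scale B \<and> (\<forall>C. semisimple_subalg scale C \<and> B \<subseteq> C \<longrightarrow> C = B)"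

definition orthogonal_idempotents :: "'i set \<Rightarrow> ('i \<Rightarrow> 'a::ring) \<Rightarrow> bool" where
  "orthogonal_idempotents I f \<longleftrightarrow>
     (\<forall>i\<in>I. \<forall>j\<in>I. f i * f j = (if i = j then f i else 0))"

text \<open>
  A division algebra inside the ambient algebra; its unit need not be a unit of the latter. Every
  division algebra \<open>D\<close> with \<open>B \<cong> M\<^sub>k(D)\<close> occurs in this form up to isomorphism, as the image in \<open>B\<close> of
  the corner of matrices supported in position \<open>(1,1)\<close>.
\<close>

definition division_subalg :: "('f::field \<Rightarrow> 'a::ring \<Rightarrow> 'a) \<Rightarrow> 'a set \<Rightarrow> bool" where
  "division_subalg scale D \<longleftrightarrow> subalg scale D \<and>
     (\<exists>u. u \<noteq> 0 \<and> is_identity_of D u \<and>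
          (\<forall>x\<in>D. x \<noteq> 0 \<longrightarrow> (\<exists>y\<in>D. x * y = u \<and> y * x = u)))"

definition matrices_over :: "nat \<Rightarrow> 'a set \<Rightarrow> 'a mat set" where
  "matrices_over k D = {M \<in> carrier_mat k k. elements_mat M \<subseteq> D}"

definition iso_to_matrices ::
  "('f::field \<Rightarrow> 'a::ring \<Rightarrow> 'a) \<Rightarrow> 'a set \<Rightarrow> nat \<Rightarrow> 'a set \<Rightarrow> bool" where
  "iso_to_matrices scale B k D \<longleftrightarrow>
     (\<exists>\<psi>. bij_betw \<psi> B (matrices_over k D) \<and>
          (\<forall>x\<in>B. \<forall>y\<in>B. \<psi> (x + y) = \<psi> x + \<psi> y \<and> \<psi> (x * y) = \<psi> x * \<psi> y) \<and>
          (\<forall>c. \<forall>x\<in>B. \<psi> (scale c x) = map_mat (scale c) (\<psi> x)))"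

section \<open>Semigroups\<close>

text \<open>A semigroup is given by a carrier \<open>S\<close> and a multiplication \<open>mul\<close>.\<close>

inductive_set generated_subsemigroup :: "('s \<Rightarrow> 's \<Rightarrow> 's) \<Rightarrow> 's set \<Rightarrow> 's set"
  for mul :: "'s \<Rightarrow> 's \<Rightarrow> 's" and X :: "'s set" where
  gen: "s \<in> X \<Longrightarrow> s \<in> generated_subsemigroup mul X"
| mult: "s \<in> generated_subsemigroup mul X \<Longrightarrow> t \<in> generated_subsemigroup mul X \<Longrightarrow>
    mul s t \<in> generated_subsemigroup mul X"

definition semigroup_ideal :: "'s set \<Rightarrow> ('s \<Rightarrow> 's \<Rightarrow> 's) \<Rightarrow> 's set \<Rightarrow> bool" where
  "semigroup_ideal S mul I \<longleftrightarrow>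
     I \<noteq> {} \<and> I \<subseteq> S \<and> (\<forall>s\<in>S. \<forall>x\<in>I. mul s x \<in> I \<and> mul x s \<in> I)"

definition zero_simple :: "'s set \<Rightarrow> ('s \<Rightarrow> 's \<Rightarrow> 's) \<Rightarrow> 's \<Rightarrow> bool" where
  "zero_simple S mul z \<longleftrightarrow>
     z \<in> S \<and> (\<forall>s\<in>S. mul s z = z \<and> mul z s = z) \<and>
     (\<exists>s\<in>S. \<exists>t\<in>S. mul s t \<noteq> z) \<and>
     (\<forall>I. semigroup_ideal S mul I \<longrightarrow> I = {z} \<or> I = S)"

definition primitive_idempotent :: "'s set \<Rightarrow> ('s \<Rightarrow> 's \<Rightarrow> 's) \<Rightarrow> 's \<Rightarrow> 's \<Rightarrow> bool" where
  "primitive_idempotent S mul z p \<longleftrightarrow>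
     p \<in> S \<and> p \<noteq> z \<and> mul p p = p \<and>
     (\<forall>q\<in>S. q \<noteq> z \<and> mul q q = q \<and> mul p q = q \<and> mul q p = q \<longrightarrow> q = p)"

definition completely_zero_simple :: "'s set \<Rightarrow> ('s \<Rightarrow> 's \<Rightarrow> 's) \<Rightarrow> 's \<Rightarrow> bool" where
  "completely_zero_simple S mul z \<longleftrightarrow>
     zero_simple S mul z \<and> (\<exists>p. primitive_idempotent S mul z p)"

text \<open>
  \<open>Elt i j\<close> stands for \<open>(e,i,j)\<close> and \<open>Theta\<close> for the zero. The sandwich matrix, whose entries
  are \<open>e\<close> or \<open>\<theta>\<close>, is a predicate: \<open>P j k\<close> means that the entry in row \<open>j\<close> and column \<open>k\<close>
  is \<open>e\<close>. Rows are indexed by \<open>{1..m}\<close> and columns by \<open>{1..n}\<close>.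
\<close>

datatype rees = Theta | Elt nat nat

definition rees_carrier :: "nat \<Rightarrow> nat \<Rightarrow> rees set" where
  "rees_carrier n m = {Elt i j | i j. i \<in> {1..n} \<and> j \<in> {1..m}} \<union> {Theta}"

fun rees_mult :: "(nat \<Rightarrow> nat \<Rightarrow> bool) \<Rightarrow> rees \<Rightarrow> rees \<Rightarrow> rees" where
  "rees_mult P (Elt i j) (Elt k l) = (if P j k then Elt i l else Theta)"
| "rees_mult P Theta t = Theta"
| "rees_mult P s Theta = Theta"

lemma rees_completely_zero_simple_iff:
  assumes "0 < n" "0 < m"
  shows "completely_zero_simple (rees_carrier n m) (rees_mult P) Theta \<longleftrightarrow>
    (\<forall>j\<in>{1..m}. \<exists>i\<in>{1..n}. P j i) \<and> (\<forall>i\<in>{1..n}. \<exists>j\<in>{1..m}. P j i)"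
    (is "?L \<longleftrightarrow> ?R")
proof -
  have Z: "rees_mult P s Theta = Theta" for s by (cases s) auto
  show ?thesis
  proof
    assume ?L
    then have zs: "zero_simple (rees_carrier n m) (rees_mult P) Theta"
      by (simp add: completely_zero_simple_def)
    obtain s t where st: "s \<in> rees_carrier n m" "t \<in> rees_carrier n m" "rees_mult P s t \<noteq> Theta"
      using zs unfolding zero_simple_def by blast
    have ideals: "I = {Theta} \<or> I = rees_carrier n m"
      if "semigroup_ideal (rees_carrier n m) (rees_mult P) I" for I
      using zs that unfolding zero_simple_def by blast
    have "\<exists>i\<in>{1..n}. P j i" if j: "j \<in> {1..m}" for j
    proof (rule ccontr)
      assume no: "\<not> (\<exists>i\<in>{1..n}. P j i)"
      let ?I = "{Elt i j | i. i \<in> {1..n}} \<union> {Theta}"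
      have "semigroup_ideal (rees_carrier n m) (rees_mult P) ?I"
        using no j by (auto simp: semigroup_ideal_def rees_carrier_def Z)
      then have "?I = {Theta} \<or> ?I = rees_carrier n m" by (rule ideals)
      moreover have "Elt 1 j \<in> ?I" using assms by auto
      then have "?I \<noteq> {Theta}" by (metis rees.distinct(1) singletonD)
      ultimately have I: "rees_carrier n m = ?I" by metis
      with st have "s \<in> ?I" "t \<in> ?I" by simp_all
      with st(3) no show False by (cases s; cases t) auto
    qed
    moreover have "\<exists>j\<in>{1..m}. P j i" if i: "i \<in> {1..n}" for i
    proof (rule ccontr)
      assume no: "\<not> (\<exists>j\<in>{1..m}. P j i)"
      let ?I = "{Elt i j | j. j \<in> {1..m}} \<union> {Theta}"
      have "semigroup_ideal (rees_carrier n m) (rees_mult P) ?I"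
        using no i by (auto simp: semigroup_ideal_def rees_carrier_def Z)
      then have "?I = {Theta} \<or> ?I = rees_carrier n m" by (rule ideals)
      moreover have "Elt i 1 \<in> ?I" using assms by auto
      then have "?I \<noteq> {Theta}" by (metis rees.distinct(1) singletonD)
      ultimately have I: "rees_carrier n m = ?I" by metis
      with st have "s \<in> ?I" "t \<in> ?I" by simp_all
      with st(3) no show False by (cases s; cases t) auto
    qed
    ultimately show ?R by blast
  next
    assume R: ?R
    have "I = {Theta} \<or> I = rees_carrier n m"
      if I: "semigroup_ideal (rees_carrier n m) (rees_mult P) I" for I
    proof -
      have sub: "I \<subseteq> rees_carrier n m"
        and mulI: "\<And>s x. s \<in> rees_carrier n m \<Longrightarrow> x \<in> I \<Longrightarrow>
          rees_mult P s x \<in> I \<and> rees_mult P x s \<in> I"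
        using I unfolding semigroup_ideal_def by blast+
      obtain x where "x \<in> I" using I unfolding semigroup_ideal_def by blast
      then have th: "Theta \<in> I" using mulI[of Theta x] by (auto simp: rees_carrier_def)
      have "rees_carrier n m \<subseteq> I" if ne: "I \<noteq> {Theta}"
      proof
        fix s assume s: "s \<in> rees_carrier n m"
        obtain y where "y \<in> I" "y \<noteq> Theta" using ne th by blast
        moreover from \<open>y \<in> I\<close> have "y \<in> rees_carrier n m" using sub by blast
        ultimately obtain i j where y: "Elt i j \<in> I" "i \<in> {1..n}" "j \<in> {1..m}"
          by (cases y) (auto simp: rees_carrier_def)
        obtain k l where kl: "k \<in> {1..n}" "P j k" "l \<in> {1..m}" "P l i" using R y by blast
        show "s \<in> I"
        proof (cases s)
          case (Elt a b)
          with s have ab: "a \<in> {1..n}" "b \<in> {1..m}" by (auto simp: rees_carrier_def)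
          have "Elt a j \<in> I"
            using mulI[of "Elt a l" "Elt i j"] y kl ab by (auto simp: rees_carrier_def)
          then have "Elt a b \<in> I"
            using mulI[of "Elt k b" "Elt a j"] kl ab by (auto simp: rees_carrier_def)
          with Elt show ?thesis by simp
        qed (use th in simp)
      qed
      with sub show ?thesis by blast
    qed
    note ideals = this
    have "1 \<in> {1..m}" using assms by simp
    then obtain k where k: "k \<in> {1..n}" "P 1 k" using R by blast
    have mem: "Elt k 1 \<in> rees_carrier n m" using assms k by (auto simp: rees_carrier_def)
    have sq: "rees_mult P (Elt k 1) (Elt k 1) = Elt k 1" using k by simp
    have "q = Elt k 1"
      if "q \<noteq> Theta" "rees_mult P (Elt k 1) q = q" "rees_mult P q (Elt k 1) = q" for q
      using that by (cases q) (auto split: if_splits)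
    with mem sq have "primitive_idempotent (rees_carrier n m) (rees_mult P) Theta (Elt k 1)"
      unfolding primitive_idempotent_def by blast
    moreover have "zero_simple (rees_carrier n m) (rees_mult P) Theta"
      unfolding zero_simple_def
    proof (intro conjI)
      show "\<exists>s\<in>rees_carrier n m. \<exists>t\<in>rees_carrier n m. rees_mult P s t \<noteq> Theta"
        using mem sq by (metis rees.distinct(1))
    qed (use ideals in \<open>simp_all add: Z rees_carrier_def\<close>)
    ultimately show ?L unfolding completely_zero_simple_def by blast
  qed
qed

section \<open>Gradings\<close>

definition semigroup_grading ::
  "('f::field \<Rightarrow> 'a::ring \<Rightarrow> 'a) \<Rightarrow> 's set \<Rightarrow> ('s \<Rightarrow> 's \<Rightarrow> 's) \<Rightarrow> ('s \<Rightarrow> 'a set) \<Rightarrow> bool" where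
  "semigroup_grading scale S mul A \<longleftrightarrow>
     is_direct_sum scale S A UNIV \<and>
     (\<forall>s\<in>S. \<forall>t\<in>S. \<forall>x\<in>A s. \<forall>y\<in>A t. x * y \<in> A (mul s t))"

definition grading_support :: "'s set \<Rightarrow> ('s \<Rightarrow> 'a::zero set) \<Rightarrow> 's set" where
  "grading_support S A = {s \<in> S. A s \<noteq> {0}}"

definition homogeneous_subspace ::
  "('f::field \<Rightarrow> 'a::ring \<Rightarrow> 'a) \<Rightarrow> 's set \<Rightarrow> ('s \<Rightarrow> 'a set) \<Rightarrow> 'a set \<Rightarrow> bool" where
  "homogeneous_subspace scale S A V \<longleftrightarrow>
     module.subspace scale V \<and> is_direct_sum scale S (\<lambda>s. V \<inter> A s) V"

definition graded_simple ::
  "('f::field \<Rightarrow> 'a::ring \<Rightarrow> 'a) \<Rightarrow> 's set \<Rightarrow> ('s \<Rightarrow> 'a set) \<Rightarrow> bool" where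
  "graded_simple scale S A \<longleftrightarrow>
     subspace_prod scale UNIV UNIV \<noteq> {0} \<and>
     (\<forall>I. two_sided_ideal scale I \<and> homogeneous_subspace scale S A I \<longrightarrow> I = {0} \<or> I = UNIV)"

end

theory Submission
  imports Defs
begin

text \<open>
  Write \<open>u = 1\<^sub>B\<close>. A proper two-sided ideal of a graded-simple algebra contains no nonzero homogeneous element, and
  \<open>A J A\<close> is spanned by homogeneous elements of \<open>J\<close>; hence \<open>A J A = 0\<close>. As \<open>A = A\<^sup>2\<close> and
  \<open>A (1 - u) \<subseteq> J\<close>, it follows that \<open>x y = x u y\<close> for all \<open>x, y\<close>, that \<open>u A u = B\<close>, and that
  \<open>J\<^sup>2 = (1 - u) A (1 - u)\<close>.

  The map \<open>\<phi>\<close> is explicit: if \<open>\<pi>\<^sub>j\<close> denotes the projection to \<open>L\<^sub>j\<close>, then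
  \<open>\<phi> v = - (\<Sum>j. \<pi>\<^sub>j v * f\<^sub>j)\<close> on \<open>u A (1 - u)\<close>, and symmetrically on \<open>(1 - u) A u\<close>. It turns \<open>v\<close> in
  \<open>J\<^sup>1\<^sup>0\<^sub>*\<^sub>j\<close> into the element \<open>\<phi> v + v\<close> of \<open>L\<^sub>j\<close>. An element \<open>z\<close> of \<open>A\<^sub>i\<^sub>j\<close> with
  \<open>f'\<^sub>i z = z f\<^sub>j = 0\<close> is determined by \<open>(1 - u) z (1 - u)\<close>, as one sees by comparing components in
  \<open>z = u z + z u - u z u\<close>, and also by \<open>u z u\<close>, because \<open>J\<close> contains no nonzero homogeneous elements. Parts (c)
  and (d) and the directness of \<open>J\<^sup>2 = \<Oplus> J\<^sup>0\<^sup>1\<^sub>i\<^sub>* J\<^sup>1\<^sup>0\<^sub>*\<^sub>j\<close> follow. The bounds in (e) come from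
  the injections \<open>x \<mapsto> u x u\<close> of \<open>A\<^sub>i\<^sub>j\<close> and \<open>x \<mapsto> x u\<close> of \<open>u L\<^sub>j\<close> into \<open>B\<close>.
\<close>

text \<open>Without a unit, and with a radical defined through modular maximal left ideals, neither
  the two-sidedness of \<open>J\<close> nor \<open>J \<noteq> UNIV\<close> is free. The latter rests
  on \<open>A\<^sup>2 = A\<close>, which also provides a substitute for the unit: linear induction
  over products.

  The correction term in \<open>\<phi>\<close> has a simple origin. The outer part
  \<open>v = y - y u\<close> determines \<open>y \<in> u L\<^sub>j\<close> only up to elements of
  \<open>L\<^sub>j\<close> fixed by \<open>u\<close> on both sides, and by comparing coordinates
  these form \<open>B f\<^sub>j\<close>. Passing from \<open>y\<close> to
  \<open>y - y f\<^sub>j\<close> removes this freedom and leaves \<open>y u - y f\<^sub>j\<close> as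
  the inner part belonging to \<open>v\<close>.

  The \<open>- 1\<close> in each bound of (e) is the copy of \<open>B\<close> contained in the space
  that is decomposed: \<open>u A\<close> contains \<open>u A u = B\<close> besides
  \<open>u A (1 - u)\<close>, and \<open>A = B \<oplus> J\<close>.

  \<open>B\<close> is a matrix algebra because a nonzero \<open>f'\<^sub>i x f\<^sub>j\<close> with
  \<open>x \<in> B\<close> is homogeneous, hence generates \<open>A\<close> as an ideal; multiplying
  by \<open>u\<close> on both sides brings this back into \<open>B\<close>, so \<open>B\<close> is
  simple. Matrix units are then built from a minimal left ideal.\<close>

section \<open>Direct sums\<close>

text \<open>Unspecified unless the spaces \<open>V i\<close> with \<open>i \<in> I\<close> span the whole space and \<open>i \<in> I\<close>.\<close>

definition component :: "'i set \<Rightarrow> ('i \<Rightarrow> 'a::comm_monoid_add set) \<Rightarrow> 'i \<Rightarrow> 'a \<Rightarrow> 'a" where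
  "component I V i x = (SOME c. (\<forall>i\<in>I. c i \<in> V i) \<and> x = sum c I) i"

context vector_space
begin

lemma subspace_set_plus: "subspace S \<Longrightarrow> subspace T \<Longrightarrow> subspace (S + T)"
proof -
  assume "subspace S" "subspace T"
  moreover have "{x + y |x y. x \<in> S \<and> y \<in> T} = S + T" by (auto simp: set_plus_def)
  ultimately show "subspace (S + T)" using subspace_sums[of S T] by simp
qed

lemma set_plus_subset: "subspace U \<Longrightarrow> S \<subseteq> U \<Longrightarrow> T \<subseteq> U \<Longrightarrow> S + T \<subseteq> U"
  by (auto simp: set_plus_def intro: subspace_add)

lemma subspace_set_sum:
  assumes "finite I" "\<And>i. i \<in> I \<Longrightarrow> subspace (V i)"
  shows "subspace (\<Sum>i\<in>I. V i)"
  using assms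
proof (induction I rule: finite_induct)
  case empty
  then show ?case by (simp add: set_zero)
next
  case (insert i I)
  then have "subspace (V i + (\<Sum>i\<in>I. V i))" by (intro subspace_set_plus) auto
  with insert show ?case by simp
qed

lemma is_direct_sumI:
  assumes "finite I" and "\<And>i. i \<in> I \<Longrightarrow> subspace (V i)"
    and "\<And>x. x \<in> W \<Longrightarrow> \<exists>c. (\<forall>i\<in>I. c i \<in> V i) \<and> x = sum c I"
    and "\<And>c. \<forall>i\<in>I. c i \<in> V i \<Longrightarrow> sum c I \<in> W"
    and "\<And>c i. \<forall>i\<in>I. c i \<in> V i \<Longrightarrow> sum c I = 0 \<Longrightarrow> i \<in> I \<Longrightarrow> c i = 0"
  shows "is_direct_sum scale I V W"
  unfolding is_direct_sum_def set_sum_alt[OF assms(1)] using assms by blast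

text \<open>On \<open>V i\<close> all projections but \<open>p i\<close> vanish, and together they
  add up to the identity, so \<open>p i\<close> fixes \<open>V i\<close>. Applying
  \<open>p i\<close> to a relation therefore isolates its \<open>i\<close>-th term. This is how the
  Peirce decompositions below are obtained.\<close>

lemma is_direct_sum_projections:
  assumes fin: "finite I" and V: "\<And>i. i \<in> I \<Longrightarrow> subspace (V i)" "\<And>i. i \<in> I \<Longrightarrow> V i \<subseteq> W"
    and W: "subspace W"
    and add: "\<And>i x y. i \<in> I \<Longrightarrow> p i (x + y) = p i x + p i y"
    and mem: "\<And>i x. i \<in> I \<Longrightarrow> x \<in> W \<Longrightarrow> p i x \<in> V i"
    and sum: "\<And>x. x \<in> W \<Longrightarrow> x = (\<Sum>i\<in>I. p i x)"
    and orth: "\<And>i j x. i \<in> I \<Longrightarrow> j \<in> I \<Longrightarrow> i \<noteq> j \<Longrightarrow> x \<in> V j \<Longrightarrow> p i x = 0"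
  shows "is_direct_sum scale I V W"
proof (rule is_direct_sumI)
  show "\<exists>c. (\<forall>i\<in>I. c i \<in> V i) \<and> x = sum c I" if "x \<in> W" for x
    using sum[OF that] mem that by (intro exI[of _ "\<lambda>i. p i x"]) auto
  show "sum c I \<in> W" if "\<forall>i\<in>I. c i \<in> V i" for c
    using that V by (intro subspace_sum[OF W]) auto
  show "c i = 0" if c: "\<forall>i\<in>I. c i \<in> V i" and 0: "sum c I = 0" and i: "i \<in> I" for c i
  proof -
    have p0: "p i 0 = 0" using add[OF i, of 0 0] by simp
    have psum: "p i (sum c T) = (\<Sum>j\<in>T. p i (c j))" if "finite T" for T
      using that by (induction T rule: finite_induct) (auto simp: p0 add[OF i])
    have "c i \<in> W" using c V(2) i by blast
    then have "c i = (\<Sum>k\<in>I. p k (c i))" by (rule sum)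
    also have "\<dots> = p i (c i)"
      using sum.remove[OF fin i, of "\<lambda>k. p k (c i)"] i c orth by (auto intro!: sum.neutral)
    also have "\<dots> = (\<Sum>j\<in>I. p i (c j))"
      using sum.remove[OF fin i, of "\<lambda>j. p i (c j)"] i c orth[OF i] by (auto intro!: sum.neutral)
    also have "\<dots> = 0" using psum[OF fin] 0 p0 by simp
    finally show ?thesis .
  qed
qed (use fin V in auto)

lemma is_direct_sum_finite: "is_direct_sum scale I V W \<Longrightarrow> finite I"
  by (simp add: is_direct_sum_def)

lemma is_direct_sum_subspace: "is_direct_sum scale I V W \<Longrightarrow> i \<in> I \<Longrightarrow> subspace (V i)"
  by (simp add: is_direct_sum_def)

lemma is_direct_sum_mem_iff:
  "is_direct_sum scale I V W \<Longrightarrow> x \<in> W \<longleftrightarrow> (\<exists>c. (\<forall>i\<in>I. c i \<in> V i) \<and> x = sum c I)"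
  by (auto simp: is_direct_sum_def set_sum_alt)

lemma is_direct_sum_eq_0:
  "is_direct_sum scale I V W \<Longrightarrow> \<forall>i\<in>I. c i \<in> V i \<Longrightarrow> sum c I = 0 \<Longrightarrow> i \<in> I \<Longrightarrow> c i = 0"
  by (simp add: is_direct_sum_def)

lemma set_sum_mem:
  assumes "finite I" "i \<in> I" "x \<in> V i" "\<And>i. i \<in> I \<Longrightarrow> subspace (V i)"
  shows "x \<in> (\<Sum>i\<in>I. V i)"
  unfolding set_sum_alt[OF assms(1)]
  using assms by (intro CollectI exI[of _ "\<lambda>l. if l = i then x else 0"]) (auto simp: subspace_0)

lemma set_sum_subset:
  assumes "finite I" "subspace U" "\<And>i. i \<in> I \<Longrightarrow> V i \<subseteq> U"
  shows "(\<Sum>i\<in>I. V i) \<subseteq> U"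
  unfolding set_sum_alt[OF assms(1)] using assms(3) by (blast intro: subspace_sum[OF assms(2)])

lemma is_direct_sum_cong:
  assumes "\<And>i. i \<in> I \<Longrightarrow> V i = V' i"
  shows "is_direct_sum scale I V W \<longleftrightarrow> is_direct_sum scale I V' W"
  unfolding is_direct_sum_def using assms by (simp cong: ball_cong sum.cong)

text \<open>The fibres of \<open>g\<close> are disjoint, so decompositions chosen separately in each
  fibre glue to one family on \<open>T\<close>. A relation between the grouped spaces thus becomes a
  relation between the original ones.\<close>

lemma is_direct_sum_group:
  assumes direct: "is_direct_sum scale T V W" and K: "finite K" "g ` T \<subseteq> K"
  shows "is_direct_sum scale K (\<lambda>k. \<Sum>t\<in>{t \<in> T. g t = k}. V t) W"
proof -
  let ?T = "\<lambda>k. {t \<in> T. g t = k}"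
  have T: "finite T" "\<And>k. finite (?T k)" using is_direct_sum_finite[OF direct] by auto
  have split: "\<exists>d. (\<forall>t\<in>T. d t \<in> V t) \<and> (\<forall>k\<in>K. c k = sum d (?T k)) \<and> sum c K = sum d T"
    if c: "\<forall>k\<in>K. c k \<in> (\<Sum>t\<in>?T k. V t)" for c
  proof -
    have "\<forall>k\<in>K. \<exists>d. (\<forall>t\<in>?T k. d t \<in> V t) \<and> c k = sum d (?T k)"
      using c unfolding set_sum_alt[OF T(2)] by blast
    then obtain d where d: "\<forall>k\<in>K. (\<forall>t\<in>?T k. d k t \<in> V t) \<and> c k = sum (d k) (?T k)"
      by (rule bchoice[THEN exE])
    let ?d = "\<lambda>t. d (g t) t"
    have c_eq: "c k = sum ?d (?T k)" if "k \<in> K" for k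
      using d that by simp
    then have "sum c K = (\<Sum>k\<in>K. sum ?d (?T k))" by simp
    then have "sum c K = sum ?d T" using sum.group[OF T(1) K, of ?d] by simp
    moreover have "\<forall>t\<in>T. ?d t \<in> V t" using d K by blast
    ultimately show ?thesis using c_eq by (intro exI[of _ ?d]) simp
  qed
  show ?thesis
  proof (rule is_direct_sumI)
    show "subspace (\<Sum>t\<in>?T k. V t)" for k
      using T is_direct_sum_subspace[OF direct] by (intro subspace_set_sum) auto
    show "\<exists>c. (\<forall>k\<in>K. c k \<in> (\<Sum>t\<in>?T k. V t)) \<and> x = sum c K" if x: "x \<in> W" for x
    proof -
      obtain d where d: "\<forall>t\<in>T. d t \<in> V t" "x = sum d T"
        using is_direct_sum_mem_iff[OF direct, THEN iffD1, OF x] by blast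
      have "\<forall>k\<in>K. sum d (?T k) \<in> (\<Sum>t\<in>?T k. V t)"
        unfolding set_sum_alt[OF T(2)] using d(1) by blast
      moreover have "x = (\<Sum>k\<in>K. sum d (?T k))" using sum.group[OF T(1) K, of d] d by simp
      ultimately show ?thesis by (intro exI[of _ "\<lambda>k. sum d (?T k)"] conjI)
    qed
    show "sum c K \<in> W" if c: "\<forall>k\<in>K. c k \<in> (\<Sum>t\<in>?T k. V t)" for c
    proof -
      obtain d where "\<forall>t\<in>T. d t \<in> V t" "sum c K = sum d T" using split[OF c] by blast
      then show ?thesis by (intro is_direct_sum_mem_iff[OF direct, THEN iffD2]) (rule exI, rule conjI)
    qed
    show "c k = 0" if c: "\<forall>k\<in>K. c k \<in> (\<Sum>t\<in>?T k. V t)" "sum c K = 0" "k \<in> K" for c k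
    proof -
      obtain d where d: "\<forall>t\<in>T. d t \<in> V t" "\<forall>k\<in>K. c k = sum d (?T k)" "sum d T = 0"
        using split[OF c(1)] c(2) by auto
      then have "\<forall>t\<in>T. d t = 0" using is_direct_sum_eq_0[OF direct] by blast
      then show ?thesis using d(2) c(3) by simp
    qed
  qed (rule K)
qed

text \<open>Grouping by column and by row; this yields the decompositions of the algebra into the
  \<open>L j\<close> and into the \<open>R i\<close>.\<close>

lemma is_direct_sum_Times:
  assumes "is_direct_sum scale (I \<times> K) (\<lambda>(i, j). V i j) W" "finite I" "finite K"
  shows "is_direct_sum scale K (\<lambda>j. \<Sum>i\<in>I. V i j) W" "is_direct_sum scale I (\<lambda>i. \<Sum>j\<in>K. V i j) W"
proof -
  have "(\<Sum>t\<in>{t \<in> I \<times> K. snd t = j}. case t of (i, j) \<Rightarrow> V i j) = (\<Sum>i\<in>I. V i j)" if "j \<in> K" for j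
  proof -
    have "{t \<in> I \<times> K. snd t = j} = (\<lambda>i. (i, j)) ` I" using that by auto
    then show ?thesis by (simp add: sum.reindex inj_on_def)
  qed
  from is_direct_sum_cong[where I = K and W = W, OF this] is_direct_sum_group[OF assms(1,3), of snd]
  show "is_direct_sum scale K (\<lambda>j. \<Sum>i\<in>I. V i j) W" by force
  have "(\<Sum>t\<in>{t \<in> I \<times> K. fst t = i}. case t of (i, j) \<Rightarrow> V i j) = (\<Sum>j\<in>K. V i j)" if "i \<in> I" for i
  proof -
    have "{t \<in> I \<times> K. fst t = i} = (\<lambda>j. (i, j)) ` K" using that by auto
    then show ?thesis by (simp add: sum.reindex inj_on_def)
  qed
  from is_direct_sum_cong[where I = I and W = W, OF this] is_direct_sum_group[OF assms(1,2), of fst]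
  show "is_direct_sum scale I (\<lambda>i. \<Sum>j\<in>K. V i j) W" by force
qed

lemma is_direct_sum_list2_iff:
  "is_direct_sum_list scale [U, V] W \<longleftrightarrow>
     subspace U \<and> subspace V \<and> W = U + V \<and>
     (\<forall>x y. x \<in> U \<and> y \<in> V \<and> x + y = 0 \<longrightarrow> x = 0 \<and> y = 0)" (is "?L \<longleftrightarrow> ?R")
proof -
  have I: "{..<length [U, V]} = {0, 1}" by auto
  have *: "(\<forall>x. (\<forall>i\<in>{0,1}. x i \<in> [U, V] ! i) \<and> sum x {0,1} = 0 \<longrightarrow> (\<forall>i\<in>{0,1}. x i = 0)) \<longleftrightarrow>
     (\<forall>x y. x \<in> U \<and> y \<in> V \<and> x + y = 0 \<longrightarrow> x = 0 \<and> y = 0)" (is "?A \<longleftrightarrow> ?B")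
  proof
    assume ?A
    show ?B
    proof (intro allI impI)
      fix x y assume "x \<in> U \<and> y \<in> V \<and> x + y = 0"
      then show "x = 0 \<and> y = 0"
        using \<open>?A\<close>[THEN spec, of "\<lambda>i. if i = 0 then x else y"] by simp
    qed
  next
    assume ?B
    show ?A
    proof (intro allI impI)
      fix x :: "nat \<Rightarrow> 'b"
      assume "(\<forall>i\<in>{0,1}. x i \<in> [U, V] ! i) \<and> sum x {0,1} = 0"
      then show "\<forall>i\<in>{0,1}. x i = 0"
        using \<open>?B\<close>[rule_format, of "x 0" "x 1"] by simp
    qed
  qed
  show ?thesis
    unfolding is_direct_sum_list_def is_direct_sum_def I * by simp
qed

lemma is_direct_sum_list3_iff:
  "is_direct_sum_list scale [U, V, X] W \<longleftrightarrow>
     subspace U \<and> subspace V \<and> subspace X \<and> W = U + V + X \<and>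
     (\<forall>x y z. x \<in> U \<and> y \<in> V \<and> z \<in> X \<and> x + y + z = 0 \<longrightarrow> x = 0 \<and> y = 0 \<and> z = 0)"
proof -
  have I: "{..<length [U, V, X]} = {0, 1, 2}" by (auto simp: lessThan_Suc)
  have sums: "(\<Sum>i\<in>{0,1,2}. [U, V, X] ! i) = U + V + X" by (simp add: add.assoc)
  have *: "(\<forall>x. (\<forall>i\<in>{0,1,2}. x i \<in> [U, V, X] ! i) \<and> sum x {0,1,2} = 0 \<longrightarrow> (\<forall>i\<in>{0,1,2}. x i = 0)) \<longleftrightarrow>
     (\<forall>x y z. x \<in> U \<and> y \<in> V \<and> z \<in> X \<and> x + y + z = 0 \<longrightarrow> x = 0 \<and> y = 0 \<and> z = 0)" (is "?A \<longleftrightarrow> ?B")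
  proof
    assume ?A
    show ?B
    proof (intro allI impI)
      fix x y z assume "x \<in> U \<and> y \<in> V \<and> z \<in> X \<and> x + y + z = 0"
      then show "x = 0 \<and> y = 0 \<and> z = 0"
        using \<open>?A\<close>[THEN spec, of "\<lambda>i. if i = 0 then x else if i = 1 then y else z"]
        by (simp add: add.assoc)
    qed
  next
    assume ?B
    show ?A
    proof (intro allI impI)
      fix x :: "nat \<Rightarrow> 'b"
      assume "(\<forall>i\<in>{0,1,2}. x i \<in> [U, V, X] ! i) \<and> sum x {0,1,2} = 0"
      then show "\<forall>i\<in>{0,1,2}. x i = 0"
        using \<open>?B\<close>[rule_format, of "x 0" "x 1" "x 2"] by (simp add: add.assoc)
    qed
  qed
  show ?thesis
    unfolding is_direct_sum_list_def is_direct_sum_def I * sums by simp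
qed

section \<open>Coordinates with respect to a direct sum decomposition of the whole space\<close>

context
  fixes I :: "'i set" and V :: "'i \<Rightarrow> 'b set"
  assumes direct: "is_direct_sum scale I V UNIV"
begin

lemma component_spec:
  "(\<forall>i\<in>I. component I V i x \<in> V i) \<and> x = (\<Sum>i\<in>I. component I V i x)"
proof -
  have "\<exists>c. (\<forall>i\<in>I. c i \<in> V i) \<and> x = sum c I"
    using is_direct_sum_mem_iff[OF direct, of x] by simp
  from someI_ex[OF this] show ?thesis by (simp add: component_def)
qed

lemma component_mem: "i \<in> I \<Longrightarrow> component I V i x \<in> V i"
  using component_spec by blast

lemma sum_component: "(\<Sum>i\<in>I. component I V i x) = x"
  using component_spec by metis

lemma component_unique:
  assumes "\<And>i. i \<in> I \<Longrightarrow> c i \<in> V i" "x = sum c I" "i \<in> I"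
  shows "component I V i x = c i"
proof -
  have "\<forall>i\<in>I. component I V i x - c i \<in> V i"
    using assms component_mem is_direct_sum_subspace[OF direct] by (auto intro: subspace_diff)
  moreover have "(\<Sum>i\<in>I. component I V i x - c i) = 0"
    using assms(2) sum_component[of x] by (simp add: sum_subtractf)
  ultimately have "component I V i x - c i = 0"
    using is_direct_sum_eq_0[OF direct, of "\<lambda>i. component I V i x - c i"] assms(3) by blast
  then show ?thesis by simp
qed

lemma component_add: "i \<in> I \<Longrightarrow> component I V i (x + y) = component I V i x + component I V i y"
  by (rule component_unique)
    (auto simp: sum.distrib sum_component intro: subspace_add[OF is_direct_sum_subspace[OF direct]]
      component_mem)

lemma component_scale: "i \<in> I \<Longrightarrow> component I V i (scale c x) = scale c (component I V i x)"
  by (rule component_unique)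
    (auto simp: scale_sum_right[symmetric] sum_component
      intro: subspace_scale[OF is_direct_sum_subspace[OF direct]] component_mem)

lemma component_of:
  assumes "i \<in> I" "j \<in> I" "x \<in> V j"
  shows "component I V i x = (if i = j then x else 0)"
  by (rule component_unique[of "\<lambda>i. if i = j then x else 0"])
    (use assms is_direct_sum_subspace[OF direct] is_direct_sum_finite[OF direct] in
      \<open>auto intro: subspace_0\<close>)

lemma component_0: "i \<in> I \<Longrightarrow> component I V i 0 = 0"
  using component_add[of i 0 0] by simp

lemma component_diff: "i \<in> I \<Longrightarrow> component I V i (x - y) = component I V i x - component I V i y"
  using component_add[of i "x - y" y] by (simp add: algebra_simps)

lemma component_sum: "i \<in> I \<Longrightarrow> component I V i (sum g T) = (\<Sum>t\<in>T. component I V i (g t))"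
  by (induction T rule: infinite_finite_induct) (auto simp: component_0 component_add)

end

end

section \<open>Dimensions of direct sums and of injective images\<close>

context finite_dimensional_vector_space
begin

lemma dim_set_plus:
  assumes "subspace S" "subspace T" "S \<inter> T \<subseteq> {0}"
  shows "dim (S + T) = dim S + dim T"
proof -
  have "{x + y |x y. x \<in> S \<and> y \<in> T} = S + T" by (auto simp: set_plus_def)
  with dim_sums_Int[OF assms(1,2)] assms(3) show ?thesis by (metis add.right_neutral dim_eq_0)
qed

lemma dim_direct_sum:
  assumes "is_direct_sum scale I V W"
  shows "dim W = (\<Sum>i\<in>I. dim (V i))"
proof -
  have "finite I" using assms by (rule is_direct_sum_finite)
  moreover have "\<forall>i\<in>I. subspace (V i)"
    "\<forall>c. (\<forall>i\<in>I. c i \<in> V i) \<and> sum c I = 0 \<longrightarrow> (\<forall>i\<in>I. c i = 0)"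
    using assms by (auto simp: is_direct_sum_def)
  \<comment> \<open>The induction keeps only the independence of the family, since the spaces over a
    smaller index set no longer sum to \<open>W\<close>.\<close>
  ultimately have "dim (\<Sum>i\<in>I. V i) = (\<Sum>i\<in>I. dim (V i))"
  proof (induction I rule: finite_induct)
    case empty
    then show ?case by (simp add: set_zero)
  next
    case (insert j I)
    have indep: "\<forall>c. (\<forall>i\<in>I. c i \<in> V i) \<and> sum c I = 0 \<longrightarrow> (\<forall>i\<in>I. c i = 0)"
    proof (intro allI impI)
      fix c assume c: "(\<forall>i\<in>I. c i \<in> V i) \<and> sum c I = 0"
      let ?d = "\<lambda>i. if i = j then 0 else c i"
      have "sum ?d I = sum c I" using insert.hyps by (intro sum.cong) auto
      then have "sum ?d (insert j I) = 0" using c insert.hyps by simp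
      moreover have "\<forall>i\<in>insert j I. ?d i \<in> V i" using c insert.prems(1) by (auto intro: subspace_0)
      ultimately have "\<forall>i\<in>insert j I. ?d i = 0" using insert.prems(2)[THEN spec, of ?d] by blast
      then show "\<forall>i\<in>I. c i = 0" using insert.hyps by (metis insertCI)
    qed
    have "V j \<inter> (\<Sum>i\<in>I. V i) \<subseteq> {0}"
    proof
      fix x assume x: "x \<in> V j \<inter> (\<Sum>i\<in>I. V i)"
      then obtain c where c: "\<forall>i\<in>I. c i \<in> V i" "x = sum c I"
        using insert.hyps by (auto simp: set_sum_alt)
      \<comment> \<open>The coefficient \<open>- x\<close> at \<open>j\<close> turns
        \<open>x = sum c I\<close> into a relation over \<open>insert j I\<close>.\<close>
      let ?d = "\<lambda>i. if i = j then - x else c i"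
      have "sum ?d I = sum c I" using insert.hyps by (intro sum.cong) auto
      then have "sum ?d (insert j I) = 0" using c insert.hyps by simp
      moreover have "\<forall>i\<in>insert j I. ?d i \<in> V i"
        using c x insert.prems(1) by (auto intro: subspace_neg)
      ultimately have "\<forall>i\<in>insert j I. ?d i = 0" using insert.prems(2)[THEN spec, of ?d] by blast
      then show "x \<in> {0}" by auto
    qed
    moreover have "subspace (V j)" "subspace (\<Sum>i\<in>I. V i)"
      using insert.prems(1) insert.hyps by (auto intro: subspace_set_sum)
    ultimately have "dim (V j + (\<Sum>i\<in>I. V i)) = dim (V j) + dim (\<Sum>i\<in>I. V i)"
      by (intro dim_set_plus)
    moreover have "dim (\<Sum>i\<in>I. V i) = (\<Sum>i\<in>I. dim (V i))"
      using insert.IH[OF _ indep] insert.prems(1) by blast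
    ultimately show ?case using insert.hyps by simp
  qed
  then show ?thesis using assms by (simp add: is_direct_sum_def)
qed

lemma dim_inj_image:
  assumes "subspace V"
    and "\<And>x y. g (x + y) = g x + g y" and "\<And>c x. g (scale c x) = scale c (g x)"
    and "\<And>x. x \<in> V \<Longrightarrow> g x = 0 \<Longrightarrow> x = 0"
  shows "dim (g ` V) = dim V"
proof -
  interpret pair: finite_dimensional_vector_space_pair_1 scale Basis scale
    by unfold_locales
  have lin: "Vector_Spaces.linear scale scale g"
    using assms(2,3) vector_space_axioms by (simp add: Vector_Spaces.linear_iff)
  interpret g: Vector_Spaces.linear scale scale g by (rule lin)
  have "inj_on g (span V)"
    unfolding g.inj_on_iff_eq_0[OF subspace_span] using assms(1,4) span_eq_iff[of V] by blast
  from pair.dim_image_eq[OF lin this] show ?thesis .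
qed

lemma dim_le_inj:
  assumes "subspace V"
    and "\<And>x y. g (x + y) = g x + g y" and "\<And>c x. g (scale c x) = scale c (g x)"
    and "\<And>x. x \<in> V \<Longrightarrow> g x \<in> W" and "\<And>x. x \<in> V \<Longrightarrow> g x = 0 \<Longrightarrow> x = 0"
  shows "dim V \<le> dim W"
proof -
  have "dim V = dim (g ` V)" using assms by (intro dim_inj_image[symmetric])
  also have "\<dots> \<le> dim W" using assms(4) by (intro dim_subset) auto
  finally show ?thesis .
qed

end

section \<open>The radical of a finite dimensional algebra\<close>

context assoc_algebra
begin

lemma subspace_mult_left: "subspace V \<Longrightarrow> subspace {x. a * x \<in> V}"
  by (rule subspaceI) (auto simp: subspace_0 subspace_add subspace_scale distrib_left scale_mult_right)

lemma subspace_mult_right: "subspace V \<Longrightarrow> subspace {x. x * a \<in> V}"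
  by (rule subspaceI) (auto simp: subspace_0 subspace_add subspace_scale distrib_right scale_mult_left)

lemma span_mult_closed_left:
  assumes "\<And>g. g \<in> G \<Longrightarrow> a * g \<in> span H" "x \<in> span G"
  shows "a * x \<in> span H"
proof (rule span_induct[OF assms(2), where P = "\<lambda>x. a * x \<in> span H"])
qed (use assms(1) subspace_mult_left[OF subspace_span] in auto)

lemma span_mult_closed_right:
  assumes "\<And>g. g \<in> G \<Longrightarrow> g * a \<in> span H" "x \<in> span G"
  shows "x * a \<in> span H"
proof (rule span_induct[OF assms(2), where P = "\<lambda>x. x * a \<in> span H"])
qed (use assms(1) subspace_mult_right[OF subspace_span] in auto)

lemma span_mult_eq_0_left: "(\<And>g. g \<in> G \<Longrightarrow> a * g = 0) \<Longrightarrow> x \<in> span G \<Longrightarrow> a * x = 0"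
  using span_mult_closed_left[of G a "{}" x] by simp

lemma span_mult_eq_0_right: "(\<And>g. g \<in> G \<Longrightarrow> g * a = 0) \<Longrightarrow> x \<in> span G \<Longrightarrow> x * a = 0"
  using span_mult_closed_right[of G a "{}" x] by simp

lemma subspace_translate:
  assumes "subspace N" "subspace L"
  shows "subspace {y * a + l | y l. y \<in> N \<and> l \<in> L}"
proof (rule subspaceI)
  show "0 \<in> {y * a + l | y l. y \<in> N \<and> l \<in> L}"
    using subspace_0[OF assms(1)] subspace_0[OF assms(2)]
    by (metis (mono_tags, lifting) add_0 mem_Collect_eq mult_zero_left)
next
  fix x x' assume "x \<in> {y * a + l | y l. y \<in> N \<and> l \<in> L}" "x' \<in> {y * a + l | y l. y \<in> N \<and> l \<in> L}"
  then obtain y l y' l' where "x + x' = (y + y') * a + (l + l')" "y + y' \<in> N" "l + l' \<in> L"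
    using assms subspace_add by (fastforce simp: algebra_simps)
  then show "x + x' \<in> {y * a + l | y l. y \<in> N \<and> l \<in> L}" by blast
next
  fix c x assume "x \<in> {y * a + l | y l. y \<in> N \<and> l \<in> L}"
  then obtain y l where "scale c x = scale c y * a + scale c l" "scale c y \<in> N" "scale c l \<in> L"
    using assms subspace_scale by (fastforce simp: scale_mult_left scale_right_distrib)
  then show "scale c x \<in> {y * a + l | y l. y \<in> N \<and> l \<in> L}" by blast
qed

lemma left_submodule_translate:
  assumes N: "left_submodule scale UNIV N UNIV" and L: "left_submodule scale UNIV L UNIV"
  shows "left_submodule scale UNIV {y * a + l | y l. y \<in> N \<and> l \<in> L} UNIV"
proof -
  have "b * x \<in> {y * a + l | y l. y \<in> N \<and> l \<in> L}"
    if x: "x \<in> {y * a + l | y l. y \<in> N \<and> l \<in> L}" for b x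
  proof -
    obtain y l where yl: "x = y * a + l" "y \<in> N" "l \<in> L" using x by blast
    then have "b * x = b * y * a + b * l" by (simp add: distrib_left mult.assoc)
    moreover have "b * y \<in> N" "b * l \<in> L" using yl N L by (auto simp: left_submodule_def)
    ultimately show ?thesis by blast
  qed
  then show ?thesis
    using N L subspace_translate[of N L a] by (simp add: left_submodule_def)
qed

text \<open>The set is the kernel of \<open>y \<mapsto> y a + L\<close>, a nonzero map of left
  modules into the simple module \<open>A/L\<close>, so the quotient by it is again isomorphic to
  \<open>A/L\<close>. The sets \<open>N a + L\<close> express this without quotients. Maximality of
  \<open>L\<close> gives \<open>A a + L = A\<close>, and writing \<open>a = e a + l\<close> produces
  the new right identity \<open>e\<close>.\<close>

lemma modular_maximal_left_ideal_quotient: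
  assumes L: "modular_maximal_left_ideal scale UNIV L" and ne: "{y. y * a \<in> L} \<noteq> UNIV"
  shows "modular_maximal_left_ideal scale UNIV {y. y * a \<in> L}" (is "modular_maximal_left_ideal _ _ ?M")
proof -
  have left: "left_submodule scale UNIV L UNIV"
    and max: "\<And>L'. left_submodule scale UNIV L' UNIV \<Longrightarrow> L \<subseteq> L' \<Longrightarrow> L' \<noteq> UNIV \<Longrightarrow> L' = L"
    using L by (auto simp: modular_maximal_left_ideal_def)
  have sub: "subspace L" and mult: "\<And>b x. x \<in> L \<Longrightarrow> b * x \<in> L"
    using left by (auto simp: left_submodule_def)
  have M: "left_submodule scale UNIV ?M UNIV"
    unfolding left_submodule_def using subspace_mult_right[OF sub] mult by (auto simp: mult.assoc)
  let ?T = "\<lambda>N. {y * a + l | y l. y \<in> N \<and> l \<in> L}"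
  have T_left: "left_submodule scale UNIV (?T N) UNIV" if "left_submodule scale UNIV N UNIV" for N
    using that left by (rule left_submodule_translate)
  have L_T: "L \<subseteq> ?T N" if "left_submodule scale UNIV N UNIV" for N
  proof
    fix l assume "l \<in> L"
    moreover have "0 \<in> N" using that by (auto simp: left_submodule_def subspace_0)
    moreover have "l = 0 * a + l" by simp
    ultimately show "l \<in> ?T N" by blast
  qed
  have mem_T: "y * a \<in> ?T N" if "y \<in> N" for y N
  proof -
    have "y * a = y * a + 0" "0 \<in> L" using sub by (auto simp: subspace_0)
    then show ?thesis using that by blast
  qed
  have U: "left_submodule scale UNIV UNIV UNIV" by (simp add: left_submodule_def)
  obtain y where "y * a \<notin> L" using ne by blast
  with mem_T[of y UNIV] have "?T UNIV \<noteq> L" by blast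
  with max[OF T_left[OF U] L_T[OF U]] have "?T UNIV = UNIV" by blast
  then have "a \<in> ?T UNIV" by blast
  then obtain e l where e: "a = e * a + l" "l \<in> L" by blast
  have "b - b * e \<in> ?M" for b
  proof -
    have "(b - b * e) * a = b * (a - e * a)" by (simp add: algebra_simps mult.assoc)
    also have "a - e * a = l" using e by (metis add_diff_cancel_left')
    finally show ?thesis using mult e by simp
  qed
  moreover have "L' = ?M"
    if L': "left_submodule scale UNIV L' UNIV" "?M \<subseteq> L'" "L' \<noteq> UNIV" for L'
  proof -
    \<comment> \<open>If \<open>L' a + L\<close> were everything, each \<open>y\<close> would differ
      from an element of \<open>L'\<close> by an element of \<open>?M\<close>, which lies in
      \<open>L'\<close>.\<close>
    have "?T L' \<noteq> UNIV"
    proof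
      assume T: "?T L' = UNIV"
      have "y \<in> L'" for y
      proof -
        have "y * a \<in> ?T L'" using T by simp
        then obtain y' l where y': "y * a = y' * a + l" "y' \<in> L'" "l \<in> L" by blast
        then have "y - y' \<in> ?M" by (simp add: left_diff_distrib)
        then have "y - y' + y' \<in> L'" using L' y' by (metis left_submodule_def subsetD subspace_add)
        then show ?thesis by simp
      qed
      with L'(3) show False by blast
    qed
    with max[OF T_left[OF L'(1)] L_T[OF L'(1)]] have "?T L' = L" by blast
    with mem_T L'(2) show ?thesis by blast
  qed
  ultimately show ?thesis
    using M ne unfolding modular_maximal_left_ideal_def by blast
qed

text \<open>An intersection of left ideals is a left ideal. For right multiplication by
  \<open>a\<close>, the preimage of a modular maximal left ideal under it is either everything or
  again modular maximal, so it contains every element of the radical.\<close>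

lemma two_sided_ideal_jacobson_rad: "two_sided_ideal scale (jacobson_rad scale UNIV)"
proof -
  have left: "subspace L" "\<And>b x. x \<in> L \<Longrightarrow> b * x \<in> L"
    if "modular_maximal_left_ideal scale UNIV L" for L
    using that by (auto simp: modular_maximal_left_ideal_def left_submodule_def)
  have "x * a \<in> L" if x: "x \<in> jacobson_rad scale UNIV"
    and L: "modular_maximal_left_ideal scale UNIV L" for x a L
  proof (cases "{y. y * a \<in> L} = UNIV")
    case False
    from x modular_maximal_left_ideal_quotient[OF L False] have "x \<in> {y. y * a \<in> L}"
      unfolding jacobson_rad_def by blast
    then show ?thesis by simp
  qed blast
  moreover have "subspace (jacobson_rad scale UNIV)"
    using left by (intro subspaceI)
      (auto simp: jacobson_rad_def subspace_0 subspace_add subspace_scale)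
  ultimately show ?thesis
    using left by (auto simp: two_sided_ideal_def jacobson_rad_def)
qed

end

locale finite_dim_algebra =
  assoc_algebra scale + finite_dimensional_vector_space scale Basis
  for scale :: "'f::field \<Rightarrow> 'a::ring \<Rightarrow> 'a" and Basis
begin

text \<open>A proper left ideal of largest dimension above \<open>N\<close> is maximal, and the
  right identity \<open>e\<close> modulo \<open>N\<close> serves modulo every larger left
  ideal.\<close>

lemma ex_modular_maximal_left_ideal:
  assumes "left_submodule scale UNIV N UNIV" "N \<noteq> UNIV" "\<And>b. b - b * e \<in> N"
  shows "\<exists>L. modular_maximal_left_ideal scale UNIV L"
proof -
  let ?Q = "\<lambda>L. left_submodule scale UNIV L UNIV \<and> N \<subseteq> L \<and> L \<noteq> UNIV"
  have "?Q N" using assms by blast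
  moreover have "\<forall>L. ?Q L \<longrightarrow> dim L < Suc dimension" using dim_subset_UNIV by (simp add: less_Suc_eq_le)
  ultimately have "\<exists>L. ?Q L \<and> (\<forall>L'. ?Q L' \<longrightarrow> dim L' \<le> dim L)" by (rule ex_has_greatest_nat)
  then obtain L where L: "?Q L" and max: "\<And>L'. ?Q L' \<Longrightarrow> dim L' \<le> dim L" by blast
  have "L' = L" if L': "left_submodule scale UNIV L' UNIV" "L \<subseteq> L'" "L' \<noteq> UNIV" for L'
  proof -
    have "dim L' \<le> dim L" using L L' by (intro max) auto
    with subspace_dim_equal[of L L'] L L' show ?thesis by (auto simp: left_submodule_def)
  qed
  then have "modular_maximal_left_ideal scale UNIV L"
    unfolding modular_maximal_left_ideal_def using L assms(3) by blast
  then show ?thesis ..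
qed

text \<open>
  If there is no modular maximal left ideal, then \<open>1 - a\<close> is left invertible for every \<open>a\<close>, and
  the argument of Nakayama's lemma removes the elements of a finite generating set one by one.
\<close>

lemma jacobson_rad_neq_UNIV:
  assumes idem: "span {x * y | x y. True} = UNIV" and ne: "(z::'a) \<noteq> 0"
  shows "jacobson_rad scale UNIV \<noteq> (UNIV :: 'a set)"
proof
  assume J: "jacobson_rad scale UNIV = (UNIV :: 'a set)"
  \<comment> \<open>The left ideal \<open>A (1 - a)\<close> is modular with right identity
    \<open>a\<close>. If it were proper, a modular maximal left ideal would exist.\<close>
  have quasi: "\<exists>b. b - b * a = a" for a :: 'a
  proof -
    let ?N = "{b - b * a | b. True}"
    have mult: "b * x \<in> ?N" if x: "x \<in> ?N" for b x
    proof -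
      obtain b' where b': "x = b' - b' * a" using x by blast
      have "b * x = b * b' - (b * b') * a" unfolding b' by (simp add: right_diff_distrib mult.assoc)
      then show ?thesis by blast
    qed
    have "subspace ?N"
    proof (rule subspaceI)
      have "0 = 0 - 0 * a" by simp
      then show "0 \<in> ?N" by blast
    next
      fix x y assume "x \<in> ?N" "y \<in> ?N"
      then obtain b c where "x + y = (b + c) - (b + c) * a" by (fastforce simp: algebra_simps)
      then show "x + y \<in> ?N" by blast
    next
      fix c x assume "x \<in> ?N"
      then obtain b where "scale c x = scale c b - scale c b * a"
        by (fastforce simp: scale_right_diff_distrib scale_mult_left)
      then show "scale c x \<in> ?N" by blast
    qed
    with mult have "left_submodule scale UNIV ?N UNIV" by (simp add: left_submodule_def)
    moreover have "b - b * a \<in> ?N" for b by blast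
    moreover have "\<not> modular_maximal_left_ideal scale UNIV L" for L
    proof
      assume L: "modular_maximal_left_ideal scale UNIV L"
      with J have "L = UNIV" by (auto simp: jacobson_rad_def)
      with L show False by (simp add: modular_maximal_left_ideal_def)
    qed
    ultimately have "?N = UNIV" using ex_modular_maximal_left_ideal[of ?N a] by blast
    then have "a \<in> ?N" by blast
    then obtain b where "a = b - b * a" by blast
    then show ?thesis by metis
  qed
  have gen: "(UNIV :: 'a set) = {0}"
    if "finite X" "span {a * x | a x. x \<in> X} = UNIV" for X :: "'a set"
    using that
  proof (induction X rule: finite_induct)
    case (insert x X)
    let ?T = "span {a * y | a y. y \<in> X}"
    have split: "\<exists>a. w - a * x \<in> ?T" if "w \<in> span {a * y | a y. y \<in> insert x X}" for w
      using that
    proof (induction rule: span_induct_alt)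
      case base
      have "0 - 0 * x \<in> ?T" by (simp add: span_zero)
      then show ?case ..
    next
      case (step c g w)
      then obtain a where a: "w - a * x \<in> ?T" by blast
      from step(1) obtain b y where g: "g = b * y" "y \<in> insert x X" by blast
      show ?case
      proof (cases "y = x")
        case True
        then have eq: "scale c g + w - (scale c b + a) * x = w - a * x"
          using g by (simp add: algebra_simps scale_mult_left)
        have "scale c g + w - (scale c b + a) * x \<in> ?T" using a unfolding eq .
        then show ?thesis ..
      next
        case False
        then have "g \<in> ?T" using g by (intro span_base) auto
        then have "scale c g + (w - a * x) \<in> ?T" using a by (intro span_add span_scale)
        then have "scale c g + w - a * x \<in> ?T" by (simp add: algebra_simps mult.assoc)
        then show ?thesis ..
      qed
    qed
    have T_left: "b * t \<in> ?T" if "t \<in> ?T" for b t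
    proof (rule span_mult_closed_left[OF _ that])
      fix g assume "g \<in> {a * y | a y. y \<in> X}"
      then obtain a y where "b * g = (b * a) * y" "y \<in> X" by (auto simp: mult.assoc)
      then show "b * g \<in> ?T" by (intro span_base) blast
    qed
    obtain a where a: "x - a * x \<in> ?T" using split[of x] insert.prems by blast
    obtain b where b: "b - b * a = a" using quasi by blast
    \<comment> \<open>Formally \<open>1 + b\<close> is a left inverse of \<open>1 - a\<close>; it
      recovers \<open>x\<close> from \<open>x - a x\<close>, which already lies in the span of the
      remaining generators.\<close>
    have "x = (x - a * x) + b * (x - a * x) + (a - (b - b * a)) * x" by (simp add: algebra_simps mult.assoc)
    with b have "x = (x - a * x) + b * (x - a * x)" by simp
    moreover have "(x - a * x) + b * (x - a * x) \<in> ?T" using a T_left by (intro span_add)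
    ultimately have x: "x \<in> ?T" by simp
    have "{a * y | a y. y \<in> X} \<subseteq> ?T" by (rule span_superset)
    then have "{a * y | a y. y \<in> insert x X} \<subseteq> ?T" using T_left[OF x] by blast
    then have "span {a * y | a y. y \<in> insert x X} \<subseteq> ?T" by (rule span_minimal) (rule subspace_span)
    with insert.prems have "?T = UNIV" by blast
    then show ?case by (rule insert.IH)
  qed simp
  \<comment> \<open>The claim \<open>gen\<close> asks that \<open>A X\<close>, and not merely
    \<open>X\<close>, spans the algebra; for a basis \<open>X\<close> this is
    \<open>A\<^sup>2 = A\<close>.\<close>
  have "x * y \<in> span {a * b | a b. b \<in> Basis}" for x y
  proof -
    have "y \<in> span Basis" using span_Basis by simp
    then show ?thesis
    proof (rule span_mult_closed_left[rotated])
      fix g assume "g \<in> Basis"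
      then show "x * g \<in> span {a * b | a b. b \<in> Basis}" by (intro span_base) blast
    qed
  qed
  then have "{x * y | x y. True} \<subseteq> span {a * b | a b. b \<in> Basis}" by blast
  then have "span {x * y | x y. True} \<subseteq> span {a * b | a b. b \<in> Basis}"
    by (rule span_minimal) (rule subspace_span)
  with idem have "span {a * b | a b. b \<in> Basis} = UNIV" by blast
  from gen[OF finite_Basis this] ne show False by blast
qed

end

section \<open>Simple finite dimensional algebras\<close>

text \<open>Once products are nested to the right, a rule for \<open>a * b\<close> no longer matches
  inside \<open>a * (b * x)\<close>; this supplies the missing form for the simplifier.\<close>

lemma mult_assoc_eq: "a * b = c \<Longrightarrow> a * (b * x) = c * x" for a b c x :: "'a::semigroup_mult"
  by (simp add: mult.assoc[symmetric])

context finite_dim_algebra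
begin

context
  fixes B :: "'a set" and u :: 'a
  assumes subalg: "subalg scale B" and unit: "is_identity_of B u" and u_ne: "u \<noteq> 0"
    and simple: "\<And>x. x \<in> B \<Longrightarrow> x \<noteq> 0 \<Longrightarrow> u \<in> span {a * x * b | a b. a \<in> B \<and> b \<in> B}"
begin

lemma B_subspace: "subspace B" and B_mult: "x \<in> B \<Longrightarrow> y \<in> B \<Longrightarrow> x * y \<in> B"
  using subalg by (auto simp: subalg_def)

lemma u_mem: "u \<in> B" and u_left: "x \<in> B \<Longrightarrow> u * x = x" and u_right: "x \<in> B \<Longrightarrow> x * u = x"
  using unit by (auto simp: is_identity_of_def)

text \<open>What annihilates the ideal generated by \<open>x\<close> annihilates \<open>u\<close>,
  and \<open>z = z * u\<close>.\<close>

lemma simple_mult_eq_0_left: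
  assumes "x \<in> B" "x \<noteq> 0" "z \<in> B" "\<And>a b. a \<in> B \<Longrightarrow> b \<in> B \<Longrightarrow> z * (a * x * b) = 0"
  shows "z = 0"
proof -
  have "z * u = 0"
    by (rule span_mult_eq_0_left[OF _ simple[OF assms(1,2)]]) (use assms(4) in auto)
  then show ?thesis using u_right[OF assms(3)] by simp
qed

lemma simple_mult_eq_0_right:
  assumes "x \<in> B" "x \<noteq> 0" "z \<in> B" "\<And>a b. a \<in> B \<Longrightarrow> b \<in> B \<Longrightarrow> a * x * b * z = 0"
  shows "z = 0"
proof -
  have "u * z = 0"
    by (rule span_mult_eq_0_right[OF _ simple[OF assms(1,2)]]) (use assms(4) in auto)
  then show ?thesis using u_left[OF assms(3)] by simp
qed

lemma left_submodule_translates: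
  assumes N: "left_submodule scale B N B" and c: "c \<in> B"
  shows "left_submodule scale B {y * c | y. y \<in> N} B"
proof -
  have "{y * c | y. y \<in> N} = {y * c + l | y l. y \<in> N \<and> l \<in> {0}}" by auto
  moreover have "subspace N" using N by (simp add: left_submodule_def)
  ultimately have "subspace {y * c | y. y \<in> N}"
    using subspace_translate[of N "{0}" c] by simp
  moreover have "b * x \<in> {y * c | y. y \<in> N}" if "b \<in> B" "x \<in> {y * c | y. y \<in> N}" for b x
  proof -
    obtain y where "b * x = (b * y) * c" "y \<in> N" using \<open>x \<in> _\<close> by (auto simp: mult.assoc)
    then show ?thesis using N \<open>b \<in> B\<close> by (auto simp: left_submodule_def)
  qed
  ultimately show ?thesis using N c B_mult by (auto simp: left_submodule_def)
qed

text \<open>The idempotent generates a minimal left ideal \<open>N\<close>: if \<open>N c \<noteq> 0\<close> for some \<open>c\<close> in \<open>N\<close>, then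
  right multiplication by \<open>c\<close> is a bijection of \<open>N\<close>, and \<open>e\<close> is the preimage of \<open>c\<close>.\<close>

lemma ex_division_idempotent:
  obtains e where "e \<in> B" "e \<noteq> 0" "e * e = e"
    "\<And>x. x \<in> B \<Longrightarrow> e * x = x \<Longrightarrow> x * e = x \<Longrightarrow> x \<noteq> 0 \<Longrightarrow>
       \<exists>y\<in>B. e * y = y \<and> y * e = y \<and> y * x = e"
proof -
  let ?Q = "\<lambda>N. left_submodule scale B N B \<and> N \<noteq> {0}"
  have "?Q B" using B_subspace B_mult u_mem u_ne by (auto simp: left_submodule_def)
  then have "\<exists>N. ?Q N \<and> (\<forall>N'. ?Q N' \<longrightarrow> dim N \<le> dim N')" by (rule ex_has_least_nat)
  then obtain N where N: "?Q N" and least: "\<And>N'. ?Q N' \<Longrightarrow> dim N \<le> dim N'" by blast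
  have min: "N' = N" if "?Q N'" "N' \<subseteq> N" for N'
    using subspace_dim_equal[of N' N] least[OF that(1)] that N by (auto simp: left_submodule_def)
  have sub: "subspace N" and NB: "N \<subseteq> B" and BN: "\<And>b x. b \<in> B \<Longrightarrow> x \<in> N \<Longrightarrow> b * x \<in> N"
    using N by (auto simp: left_submodule_def)
  obtain x where x: "x \<in> N" "x \<noteq> 0" using N sub subspace_0 by blast
  \<comment> \<open>Otherwise the ideal generated by \<open>x\<close> would annihilate
    \<open>x\<close>.\<close>
  have "\<exists>b\<in>B. x * b * x \<noteq> 0"
  proof (rule ccontr)
    assume "\<not> ?thesis"
    then have "a * x * b * x = 0" if "a \<in> B" "b \<in> B" for a b
      using that by (metis mult.assoc mult_zero_right)
    with simple_mult_eq_0_right[of x x] x NB show False by blast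
  qed
  then obtain b where b: "b \<in> B" "x * (b * x) \<noteq> 0" by (auto simp: mult.assoc)
  define c where "c = b * x"
  have c: "c \<in> N" "c \<in> B" "x * c \<noteq> 0" using BN b x NB by (auto simp: c_def)
  have "{y * c | y. y \<in> N} = N"
  proof (rule min)
    have "x * c \<in> {y * c | y. y \<in> N}" using x by blast
    with c have "{y * c | y. y \<in> N} \<noteq> {0}" by blast
    then show "?Q {y * c | y. y \<in> N}" using left_submodule_translates N c by blast
    show "{y * c | y. y \<in> N} \<subseteq> N" using BN NB c by blast
  qed
  then have "c \<in> {y * c | y. y \<in> N}" using c by blast
  then obtain e where e: "e \<in> N" "e * c = c" by force
  have eB: "e \<in> B" using e NB by blast
  \<comment> \<open>The elements of \<open>N\<close> killed by right multiplication with
    \<open>c\<close> form a left ideal. It misses \<open>x\<close>, so it is zero by minimality of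
    \<open>N\<close>.\<close>
  have ann: "y = 0" if "y \<in> N" "y * c = 0" for y
  proof (rule ccontr)
    assume "y \<noteq> 0"
    let ?K = "{y \<in> N. y * c = 0}"
    have "?K = N \<inter> {y. y * c \<in> {0}}" by auto
    moreover have "subspace (N \<inter> {y. y * c \<in> {0}})"
      by (intro subspace_inter sub subspace_mult_right) simp
    ultimately have "subspace ?K" by simp
    then have "left_submodule scale B ?K B"
      using BN NB by (auto simp: left_submodule_def mult.assoc)
    moreover have "?K \<noteq> {0}" using that \<open>y \<noteq> 0\<close> by blast
    ultimately have "?K = N" using min[of ?K] by blast
    with x c show False by blast
  qed
  have "e * e - e \<in> N" using e eB BN sub by (intro subspace_diff) auto
  moreover have "(e * e - e) * c = 0" using e by (simp add: left_diff_distrib mult.assoc)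
  ultimately have ee: "e * e = e" using ann by fastforce
  have "c \<noteq> 0" using c by auto
  then have e0: "e \<noteq> 0" using e by auto
  have "\<exists>y\<in>B. e * y = y \<and> y * e = y \<and> y * x = e"
    if x: "x \<in> B" "e * x = x" "x * e = x" "x \<noteq> 0" for x
  proof -
    have xN: "x \<in> N" using BN[OF x(1) e(1)] x(3) by simp
    \<comment> \<open>Minimality again: \<open>B x\<close> is a nonzero left ideal inside
      \<open>N\<close>, so it contains \<open>e\<close>. If \<open>e = b x\<close>, then
      \<open>e b e\<close> is the left inverse inside the corner.\<close>
    have "{y * x | y. y \<in> B} = N"
    proof (rule min)
      have "u * x \<in> {y * x | y. y \<in> B}" using u_mem by blast
      with u_left x have "{y * x | y. y \<in> B} \<noteq> {0}" by force
      then show "?Q {y * x | y. y \<in> B}"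
        using left_submodule_translates[of B x] x B_subspace B_mult by (auto simp: left_submodule_def)
      show "{y * x | y. y \<in> B} \<subseteq> N" using BN xN by blast
    qed
    then have "e \<in> {y * x | y. y \<in> B}" using e by simp
    then obtain b where b: "e = b * x" "b \<in> B" by blast
    have "e * b * e * x = e" using x ee b by (simp add: mult.assoc)
    moreover have "e * b * e \<in> B" using b eB B_mult by blast
    moreover have "e * (e * b * e) = e * b * e" "e * b * e * e = e * b * e"
      by (simp_all add: mult.assoc ee ee[THEN mult_assoc_eq])
    ultimately show ?thesis by blast
  qed
  with that eB e0 ee show ?thesis by blast
qed

section \<open>The division algebra \<open>e B e\<close> and matrix units over it\<close>

context
  fixes e :: 'a and D :: "'a set"
  assumes e_mem: "e \<in> B" and e_ne: "e \<noteq> 0" and e_idem: "e * e = e"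
    and e_div: "\<And>x. x \<in> B \<Longrightarrow> e * x = x \<Longrightarrow> x * e = x \<Longrightarrow> x \<noteq> 0 \<Longrightarrow>
       \<exists>y\<in>B. e * y = y \<and> y * e = y \<and> y * x = e"
    and D_def: "D = {x \<in> B. e * x = x \<and> x * e = x}"
begin

lemma D_iff: "x \<in> D \<longleftrightarrow> x \<in> B \<and> e * x = x \<and> x * e = x"
  by (simp add: D_def)

lemma D_subspace: "subspace D"
  by (rule subspaceI)
    (use B_subspace in \<open>auto simp: D_iff subspace_0 subspace_add subspace_scale distrib_left
      distrib_right scale_mult_left scale_mult_right\<close>)

lemma corner_mem: "x \<in> B \<Longrightarrow> e * x * e \<in> D"
  using e_mem B_mult by (simp add: D_iff mult.assoc e_idem e_idem[THEN mult_assoc_eq])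

text \<open>The hypothesis gives left inverses only. A left inverse \<open>y\<close> of
  \<open>x\<close> has a left inverse \<open>z\<close> of its own, and
  \<open>z = z (y x) = x\<close>, so \<open>y\<close> is two-sided.\<close>

lemma division_subalg_corner: "division_subalg scale D"
proof -
  have eD: "e \<in> D" using e_mem e_idem by (simp add: D_iff)
  have "x * y \<in> D" if "x \<in> D" "y \<in> D" for x y
  proof -
    have "e * (x * y) = x * y" using that by (simp add: D_iff mult.assoc[symmetric])
    moreover have "x * y * e = x * y" using that by (simp add: D_iff mult.assoc)
    ultimately show ?thesis using that B_mult by (simp add: D_iff)
  qed

  then have sub: "subalg scale D" using D_subspace by (simp add: subalg_def)
  have left: "\<exists>y\<in>D. y * x = e" if "x \<in> D" "x \<noteq> 0" for x
    using e_div[of x] that by (auto simp: D_iff)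
  have "\<exists>y\<in>D. x * y = e \<and> y * x = e" if x: "x \<in> D" "x \<noteq> 0" for x
  proof -
    obtain y where y: "y \<in> D" "y * x = e" using left x by blast
    then have "y \<noteq> 0" using e_ne by auto
    then obtain z where z: "z \<in> D" "z * y = e" using left y by blast
    have "z = z * (y * x)" using y z by (simp add: D_iff)
    also have "\<dots> = x" using z x by (simp add: mult.assoc[symmetric] D_iff)
    finally show ?thesis using y z by blast
  qed
  moreover have "is_identity_of D e" using eD by (simp add: is_identity_of_def D_iff)
  ultimately show ?thesis using sub e_ne unfolding division_subalg_def by blast
qed

text \<open>Dual families in \<open>e B\<close> and \<open>B e\<close>: the products
  \<open>b p * a q\<close> multiply like matrix units, and \<open>\<Sum>p. b p * a p\<close> is an
  idempotent measuring how much of \<open>B\<close> is covered.\<close>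

definition frame :: "nat \<Rightarrow> (nat \<Rightarrow> 'a) \<Rightarrow> (nat \<Rightarrow> 'a) \<Rightarrow> bool" where
  "frame k a b \<longleftrightarrow>
     (\<forall>p<k. a p \<in> B \<and> e * a p = a p \<and> b p \<in> B \<and> b p * e = b p) \<and>
     (\<forall>p<k. \<forall>q<k. a p * b q = (if p = q then e else 0))"

lemma frameD:
  assumes "frame k a b"
  shows "p < k \<Longrightarrow> a p \<in> B" "p < k \<Longrightarrow> e * a p = a p" "p < k \<Longrightarrow> b p \<in> B"
    "p < k \<Longrightarrow> b p * e = b p" "p < k \<Longrightarrow> q < k \<Longrightarrow> a p * b q = (if p = q then e else 0)"
  using assms unfolding frame_def by blast+

text \<open>Multiplication by \<open>a p\<close> on the left reads off the \<open>p\<close>-th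
  coefficient of a linear combination of the \<open>b q\<close>. The resulting bound guarantees a
  frame of maximal length.\<close>

lemma frame_length_le:
  assumes fr: "frame k a b"
  shows "k \<le> dimension"
proof -
  have inj: "inj_on b {..<k}"
  proof (rule inj_onI)
    fix p q assume pq: "p \<in> {..<k}" "q \<in> {..<k}" "b p = b q"
    then have "a p * b q = e" using frameD(5)[OF fr, of p p] by simp
    with pq frameD(5)[OF fr, of p q] e_ne show "p = q" by (auto split: if_splits)
  qed
  have "independent (b ` {..<k})"
  proof (rule independent_if_scalars_zero)
    fix g x assume 0: "(\<Sum>x\<in>b ` {..<k}. scale (g x) x) = 0" and x: "x \<in> b ` {..<k}"
    then obtain p where p: "x = b p" "p < k" by blast
    have "0 = a p * (\<Sum>q<k. scale (g (b q)) (b q))"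
      using 0 inj by (simp add: sum.reindex)
    also have "\<dots> = (\<Sum>q<k. if q = p then scale (g (b p)) e else 0)"
      unfolding sum_distrib_left
      by (rule sum.cong) (use frameD(5)[OF fr p(2)] in \<open>auto simp: scale_mult_right\<close>)
    also have "\<dots> = scale (g (b p)) e" using p by simp
    finally show "g x = 0" using e_ne p by simp
  qed simp
  then have "card (b ` {..<k}) \<le> dimension"
    using independent_card_le_dim[of "b ` {..<k}" UNIV] by (simp add: dimension_def)
  then show ?thesis using inj by (simp add: card_image)
qed

text \<open>The defect \<open>r = u - \<Sum>p. b p * a p\<close> is an idempotent annihilated by the
  frame, \<open>a q * r = 0\<close> and \<open>r * b q = 0\<close>. If it is nonzero, a new dual
  pair can be chosen in \<open>e B r\<close> and \<open>r B e\<close>.\<close>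

lemma frame_extend:
  assumes fr: "frame k a b" and ne: "(\<Sum>p<k. b p * a p) \<noteq> u"
  shows "\<exists>a b. frame (Suc k) a b"
proof -
  note B = frameD[OF fr]
  let ?g = "\<Sum>p<k. b p * a p"
  define r where "r = u - ?g"
  have gB: "?g \<in> B" using B B_mult by (intro subspace_sum[OF B_subspace]) auto
  then have rB: "r \<in> B" using u_mem B_subspace by (simp add: r_def subspace_diff)
  have "r \<noteq> 0" using ne by (auto simp: r_def)
  have ag: "a q * ?g = a q" if "q < k" for q
  proof -
    have "a q * ?g = (\<Sum>p<k. if p = q then a q else 0)"
      unfolding sum_distrib_left
      by (rule sum.cong) (use B that in \<open>auto simp: mult.assoc[symmetric]\<close>)
    then show ?thesis using that by simp
  qed
  have gb: "?g * b q = b q" if "q < k" for q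
  proof -
    have "?g * b q = (\<Sum>p<k. if p = q then b q else 0)"
      unfolding sum_distrib_right
      by (rule sum.cong) (use B that in \<open>auto simp: mult.assoc\<close>)
    then show ?thesis using that by simp
  qed
  have ar: "a q * r = 0" and rb: "r * b q = 0" if "q < k" for q
    using that ag gb B u_left u_right by (simp_all add: r_def right_diff_distrib left_diff_distrib)
  have "?g * ?g = (\<Sum>p<k. ?g * b p * a p)" by (simp add: sum_distrib_left mult.assoc)
  also have "\<dots> = ?g" using gb by simp
  finally have "?g * ?g = ?g" .
  then have rr: "r * r = r"
    using gB u_left u_right u_mem by (simp add: r_def right_diff_distrib left_diff_distrib)
  \<comment> \<open>If \<open>r B e\<close> were zero, \<open>r\<close> would annihilate the ideal
    generated by \<open>e\<close>, which contains \<open>u\<close>.\<close>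
  have "\<exists>x\<in>B. r * x * e \<noteq> 0"
  proof (rule ccontr)
    assume "\<not> ?thesis"
    then have "r * (x * e * y) = 0" if "x \<in> B" for x y using that by (simp add: mult.assoc[symmetric])
    with simple_mult_eq_0_left[OF e_mem e_ne rB] \<open>r \<noteq> 0\<close> show False by blast
  qed
  then obtain x where x: "x \<in> B" "r * x * e \<noteq> 0" by blast
  define c where "c = r * x * e"
  have c: "c \<in> B" "c \<noteq> 0" "c * e = c" "r * c = c"
    using x rB e_mem B_mult
    by (auto simp: c_def mult.assoc e_idem rr[THEN mult_assoc_eq])
  have "\<exists>y\<in>B. e * y * c \<noteq> 0"
  proof (rule ccontr)
    assume "\<not> ?thesis"
    then have "x * e * y * c = 0" if "y \<in> B" for x y using that by (simp add: mult.assoc)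
    with simple_mult_eq_0_right[OF e_mem e_ne c(1)] c(2) show False by blast
  qed
  then obtain y where y: "y \<in> B" "e * y * c \<noteq> 0" by blast
  have "e * y * c = e * (y * c) * e" using c(3) by (simp add: mult.assoc)
  then have "e * y * c \<in> D" using corner_mem[of "y * c"] B_mult y c by simp
  then obtain d where d: "d \<in> B" "e * d = d" "d * e = d" "d * (e * y * c) = e"
    using e_div[of "e * y * c"] y(2) by (auto simp: D_iff)
  \<comment> \<open>The product \<open>e y c\<close> is a nonzero element of the division algebra;
    its inverse \<open>d\<close> normalises the pairing, so that
    \<open>d y r * c = e\<close>.\<close>
  define a' b' where "a' = a(k := d * y * r)" and "b' = b(k := c)"
  have "d * y * r * c = e" using c d by (simp add: mult.assoc[symmetric]) (simp add: mult.assoc)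
  moreover have "d * y * r \<in> B" "e * (d * y * r) = d * y * r"
    using d y rB B_mult by (auto simp: mult.assoc[symmetric])
  moreover have "d * y * r * b q = 0" if "q < k" for q using rb[OF that] by (simp add: mult.assoc)
  moreover have "a q * c = 0" if "q < k" for q
    using ar[OF that] by (simp add: c_def mult.assoc[symmetric])
  ultimately have "frame (Suc k) a' b'"
    using B c unfolding frame_def a'_def b'_def by (simp add: less_Suc_eq all_conj_distrib)
  then show ?thesis by blast
qed

lemma ex_complete_frame: "\<exists>k a b. frame k a b \<and> (\<Sum>p<k. b p * a p) = u"
proof -
  let ?Q = "\<lambda>k. \<exists>a b. frame k a b"
  have "?Q 0" by (simp add: frame_def)
  moreover have "\<forall>k. ?Q k \<longrightarrow> k < Suc dimension" using frame_length_le by (auto simp: less_Suc_eq_le)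
  ultimately have "\<exists>k. ?Q k \<and> (\<forall>l. ?Q l \<longrightarrow> l \<le> k)" by (rule ex_has_greatest_nat)
  then obtain k a b where k: "frame k a b" "\<And>l. ?Q l \<Longrightarrow> l \<le> k" by blast
  then show ?thesis using frame_extend[OF k(1)] by (metis Suc_n_not_le_n)
qed

context
  fixes k :: nat and a b :: "nat \<Rightarrow> 'a"
  assumes fr: "frame k a b" and complete: "(\<Sum>p<k. b p * a p) = u"
begin

lemma matrix_entry_mem:
  assumes "x \<in> B" "p < k" "q < k"
  shows "a p * x * b q \<in> D"
proof -
  have "a p * x * b q \<in> B" using assms by (intro B_mult) (auto intro: frameD[OF fr])
  moreover have "e * (a p * x * b q) = a p * x * b q" "a p * x * b q * e = a p * x * b q"
    using assms(2,3) frameD(2,4)[OF fr] by (simp add: mult.assoc[symmetric], simp add: mult.assoc)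
  ultimately show ?thesis by (simp add: D_iff)
qed

text \<open>The sum is \<open>u x u\<close> with both factors \<open>u\<close> written as
  \<open>\<Sum>p. b p * a p\<close>.\<close>

lemma matrix_expansion:
  assumes "x \<in> B"
  shows "(\<Sum>(p,q)\<in>{..<k} \<times> {..<k}. b p * (a p * x * b q) * a q) = x"
proof -
  have "(\<Sum>(p,q)\<in>{..<k} \<times> {..<k}. b p * (a p * x * b q) * a q) = (\<Sum>p<k. b p * a p) * x * (\<Sum>q<k. b q * a q)"
    unfolding sum_distrib_right[of "\<lambda>p. b p * a p" "{..<k}" x] sum_product sum.cartesian_product
    by (simp add: mult.assoc)
  then show ?thesis using assms complete u_left u_right by simp
qed

lemma matrix_entry_expansion:
  assumes g: "\<And>p q. p < k \<Longrightarrow> q < k \<Longrightarrow> g p q \<in> D" and pq: "p < k" "q < k"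
  shows "a p * (\<Sum>(p,q)\<in>{..<k} \<times> {..<k}. b p * g p q * a q) * b q = g p q"
proof -
  have "a p * (b p' * g p' q' * a q') * b q = (if (p', q') = (p, q) then g p q else 0)"
    if "p' < k" "q' < k" for p' q'
  proof -
    have "a p * (b p' * g p' q' * a q') * b q = (a p * b p') * g p' q' * (a q' * b q)"
      by (simp add: mult.assoc)
    also have "\<dots> = (if (p', q') = (p, q) then g p q else 0)"
      using frameD(5)[OF fr] that pq g[of p' q'] by (auto simp: D_iff)
    finally show ?thesis .
  qed
  then have "a p * (\<Sum>(p,q)\<in>{..<k} \<times> {..<k}. b p * g p q * a q) * b q =
      (\<Sum>z\<in>{..<k} \<times> {..<k}. if z = (p, q) then g p q else 0)"
    unfolding sum_distrib_left sum_distrib_right by (intro sum.cong) (auto split: if_splits)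
  also have "\<dots> = g p q" using pq by simp
  finally show ?thesis .
qed

lemma matrix_sum_mem:
  assumes "\<And>p q. p < k \<Longrightarrow> q < k \<Longrightarrow> g p q \<in> D"
  shows "(\<Sum>(p,q)\<in>{..<k} \<times> {..<k}. b p * g p q * a q) \<in> B"
  using assms frameD[OF fr] B_mult by (intro subspace_sum[OF B_subspace]) (auto simp: D_iff)

text \<open>The isomorphism sends \<open>x\<close> to the matrix of the entries
  \<open>a p * x * b q\<close>; \<open>matrix_expansion\<close> is its inverse. It is multiplicative
  because \<open>\<Sum>r. b r * a r = u\<close> can be inserted between two elements of
  \<open>B\<close>.\<close>

lemma iso_to_matrices_frame: "iso_to_matrices scale B k D"
proof -
  define \<psi> where "\<psi> x = mat k k (\<lambda>(p,q). a p * x * b q)" for x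
  have \<psi>: "\<psi> x $$ (p, q) = a p * x * b q" if "p < k" "q < k" for x p q
    using that by (simp add: \<psi>_def)
  have carrier: "\<psi> x \<in> carrier_mat k k" for x by (simp add: \<psi>_def)
  have "inj_on \<psi> B"
  proof (rule inj_onI)
    fix x y assume xy: "x \<in> B" "y \<in> B" "\<psi> x = \<psi> y"
    then have "a p * x * b q = a p * y * b q" if "p < k" "q < k" for p q using \<psi> that by metis
    then have "(\<Sum>(p,q)\<in>{..<k} \<times> {..<k}. b p * (a p * x * b q) * a q) =
        (\<Sum>(p,q)\<in>{..<k} \<times> {..<k}. b p * (a p * y * b q) * a q)"
      by (intro sum.cong) auto
    then show "x = y" using xy matrix_expansion by simp
  qed
  moreover have "\<psi> ` B = matrices_over k D"
  proof
    show "\<psi> ` B \<subseteq> matrices_over k D"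
      using matrix_entry_mem by (auto simp: matrices_over_def \<psi>_def dest!: elements_matD)
    show "matrices_over k D \<subseteq> \<psi> ` B"
    proof
      fix M assume "M \<in> matrices_over k D"
      then have M: "M \<in> carrier_mat k k" "\<And>p q. p < k \<Longrightarrow> q < k \<Longrightarrow> M $$ (p, q) \<in> D"
        by (auto simp: matrices_over_def)
      let ?x = "\<Sum>(p,q)\<in>{..<k} \<times> {..<k}. b p * M $$ (p, q) * a q"
      have "\<psi> ?x = M"
        using M matrix_entry_expansion[of "\<lambda>p q. M $$ (p, q)"] carrier[of ?x]
        by (intro eq_matI) (auto simp: \<psi>)
      moreover have "?x \<in> B" using M matrix_sum_mem[of "\<lambda>p q. M $$ (p, q)"] by blast
      ultimately show "M \<in> \<psi> ` B" by force
    qed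
  qed
  moreover have "\<psi> (x + y) = \<psi> x + \<psi> y" for x y
    by (rule eq_matI) (auto simp: \<psi>_def algebra_simps)
  moreover have "\<psi> (x * y) = \<psi> x * \<psi> y" if "x \<in> B" "y \<in> B" for x y
  proof (rule eq_matI)
    fix p q assume "p < dim_row (\<psi> x * \<psi> y)" "q < dim_col (\<psi> x * \<psi> y)"
    then have pq: "p < k" "q < k" by (simp_all add: \<psi>_def)
    have "(\<psi> x * \<psi> y) $$ (p, q) = (\<Sum>r = 0..<k. a p * x * b r * (a r * y * b q))"
      using pq by (simp add: \<psi>_def scalar_prod_def)
    also have "\<dots> = a p * x * (\<Sum>r<k. b r * a r) * y * b q"
      by (simp add: sum_distrib_left sum_distrib_right mult.assoc atLeast0LessThan)
    also have "\<dots> = a p * (x * y) * b q" using complete that u_right by (simp add: mult.assoc)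
    finally show "\<psi> (x * y) $$ (p, q) = (\<psi> x * \<psi> y) $$ (p, q)" using \<psi> pq by simp
  qed (simp_all add: \<psi>_def)
  moreover have "\<psi> (scale c x) = map_mat (scale c) (\<psi> x)" for c x
    by (rule eq_matI) (auto simp: \<psi>_def scale_mult_left scale_mult_right)
  ultimately show ?thesis unfolding iso_to_matrices_def bij_betw_def by blast
qed

text \<open>\<open>B\<close> is the direct sum of the spaces \<open>b p D a q\<close>, and
  \<open>x \<mapsto> a p * x * b q\<close> inverts \<open>d \<mapsto> b p * d * a q\<close> on
  \<open>D\<close>.\<close>

lemma dim_frame: "dim B = k\<^sup>2 * dim D"
proof -
  let ?V = "\<lambda>(p, q). (\<lambda>d. b p * d * a q) ` D"
  have lin: "subspace ((\<lambda>d. b p * d * a q) ` D)" for p q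
  proof -
    interpret l: Vector_Spaces.linear scale scale "\<lambda>d. b p * d * a q"
      using vector_space_axioms
      by (simp add: Vector_Spaces.linear_iff distrib_left distrib_right scale_mult_left scale_mult_right)
    show ?thesis using D_subspace by (rule l.subspace_image)
  qed
  have "is_direct_sum scale ({..<k} \<times> {..<k}) ?V B"
  proof (rule is_direct_sum_projections[where p = "\<lambda>(p, q) x. b p * (a p * x * b q) * a q"])
    show "?V i \<subseteq> B" if "i \<in> {..<k} \<times> {..<k}" for i
      using that frameD[OF fr] B_mult by (auto simp: D_iff)
    show "(case i of (p, q) \<Rightarrow> \<lambda>x. b p * (a p * x * b q) * a q) x \<in> ?V i"
      if "i \<in> {..<k} \<times> {..<k}" "x \<in> B" for i x
      using that matrix_entry_mem by (cases i) auto
    show "(case i of (p, q) \<Rightarrow> \<lambda>x. b p * (a p * x * b q) * a q) x = 0"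
      if ij: "i \<in> {..<k} \<times> {..<k}" "j \<in> {..<k} \<times> {..<k}" "i \<noteq> j" "x \<in> ?V j" for i j x
    proof -
      obtain p q p' q' where [simp]: "i = (p, q)" "j = (p', q')" by (cases i, cases j)
      obtain d where d: "x = b p' * d * a q'" using ij by auto
      have "a p * x * b q = (a p * b p') * d * (a q' * b q)" by (simp add: d mult.assoc)
      also have "\<dots> = 0" using ij frameD(5)[OF fr] by auto
      finally show ?thesis by simp
    qed
  qed (use matrix_expansion B_subspace lin in \<open>auto simp: distrib_left distrib_right case_prod_beta'\<close>)
  then have "dim B = (\<Sum>i\<in>{..<k} \<times> {..<k}. dim (?V i))" by (rule dim_direct_sum)
  also have "\<dots> = (\<Sum>i\<in>{..<k} \<times> {..<k}. dim D)"
  proof (rule sum.cong)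
    fix i assume "i \<in> {..<k} \<times> {..<k}"
    then obtain p q where [simp]: "i = (p, q)" and pq: "p < k" "q < k" by blast
    have "d = 0" if "d \<in> D" "b p * d * a q = 0" for d
    proof -
      have "d = a p * b p * d * (a q * b q)" using that pq frameD(5)[OF fr] by (simp add: D_iff)
      also have "\<dots> = a p * (b p * d * a q) * b q" by (simp add: mult.assoc)
      finally show ?thesis using that by simp
    qed
    then have "dim ((\<lambda>d. b p * d * a q) ` D) = dim D"
      by (intro dim_inj_image D_subspace)
        (auto simp: distrib_left distrib_right scale_mult_left scale_mult_right)
    then show "dim (?V i) = dim D" by simp
  qed simp
  also have "\<dots> = k\<^sup>2 * dim D" by (simp add: power2_eq_square)
  finally show ?thesis .
qed

end

end

theorem simple_algebra_matrices:
  "\<exists>k D. 0 < k \<and> division_subalg scale D \<and> iso_to_matrices scale B k D \<and> dim B = k\<^sup>2 * dim D"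
proof -
  obtain e where e: "e \<in> B" "e \<noteq> 0" "e * e = e"
    "\<And>x. x \<in> B \<Longrightarrow> e * x = x \<Longrightarrow> x * e = x \<Longrightarrow> x \<noteq> 0 \<Longrightarrow>
       \<exists>y\<in>B. e * y = y \<and> y * e = y \<and> y * x = e"
    using ex_division_idempotent by blast
  let ?D = "{x \<in> B. e * x = x \<and> x * e = x}"
  obtain k a b where k: "frame e k a b" "(\<Sum>p<k. b p * a p) = u"
    using ex_complete_frame[OF e refl] by blast
  \<comment> \<open>The empty frame has sum \<open>0\<close>.\<close>
  have "k \<noteq> 0" using k(2) u_ne by (intro notI) simp
  then show ?thesis
    using division_subalg_corner[OF e refl] iso_to_matrices_frame[OF e refl k] dim_frame[OF e refl k]
    by blast
qed

end

end

section \<open>Corners of a decomposition into left ideals\<close>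

text \<open>
  The multiplication is a parameter, so that the locale can be interpreted both in a ring and
  in its opposite.
\<close>

locale left_decomposition = vector_space scale
  for scale :: "'f::field \<Rightarrow> 'a::ab_group_add \<Rightarrow> 'a" +
  fixes mult :: "'a \<Rightarrow> 'a \<Rightarrow> 'a" (infixl "\<odot>" 70)
    and K :: "'k set" and L :: "'k \<Rightarrow> 'a set" and f :: "'k \<Rightarrow> 'a"
    and I :: "'i set" and f' :: "'i \<Rightarrow> 'a" and u :: 'a
  assumes add_mult: "(x + y) \<odot> z = x \<odot> z + y \<odot> z"
    and mult_add: "x \<odot> (y + z) = x \<odot> y + x \<odot> z"
    and assoc: "(x \<odot> y) \<odot> z = x \<odot> (y \<odot> z)"
    and scale_mult: "scale c x \<odot> y = scale c (x \<odot> y)"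
    and mult_scale: "x \<odot> scale c y = scale c (x \<odot> y)"
    and direct: "is_direct_sum scale K L UNIV"
    and left_ideal: "j \<in> K \<Longrightarrow> x \<in> L j \<Longrightarrow> a \<odot> x \<in> L j"
    and f_mem: "j \<in> K \<Longrightarrow> f j \<in> L j"
    and f_orth: "j \<in> K \<Longrightarrow> l \<in> K \<Longrightarrow> f j \<odot> f l = (if j = l then f j else 0)"
    and f_sum: "(\<Sum>j\<in>K. f j) = u"
    and finite_I: "finite I"
    and f'_orth: "i \<in> I \<Longrightarrow> k \<in> I \<Longrightarrow> f' i \<odot> f' k = (if i = k then f' i else 0)"
    and f'_sum: "(\<Sum>i\<in>I. f' i) = u"
begin

lemma finite_K: "finite K"
  using direct by (rule is_direct_sum_finite)

lemma L_subspace: "j \<in> K \<Longrightarrow> subspace (L j)"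
  using direct by (rule is_direct_sum_subspace)

lemma zero_mult [simp]: "0 \<odot> x = 0"
  using add_mult[of 0 0 x] by simp

lemma mult_zero [simp]: "x \<odot> 0 = 0"
  using mult_add[of x 0 0] by simp

lemma minus_mult: "(- x) \<odot> y = - (x \<odot> y)"
  using add_mult[of x "- x" y] by (simp add: eq_neg_iff_add_eq_0 add.commute)

lemma mult_minus: "x \<odot> (- y) = - (x \<odot> y)"
  using mult_add[of x y "- y"] by (simp add: eq_neg_iff_add_eq_0 add.commute)

lemma diff_mult: "(x - y) \<odot> z = x \<odot> z - y \<odot> z"
  using add_mult[of x "- y" z] by (simp add: minus_mult)

lemma mult_diff: "x \<odot> (y - z) = x \<odot> y - x \<odot> z"
  using mult_add[of x y "- z"] by (simp add: mult_minus)

lemma sum_mult: "(\<Sum>t\<in>T. g t) \<odot> x = (\<Sum>t\<in>T. g t \<odot> x)"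
  by (induction T rule: infinite_finite_induct) (auto simp: add_mult)

lemma mult_sum: "x \<odot> (\<Sum>t\<in>T. g t) = (\<Sum>t\<in>T. x \<odot> g t)"
  by (induction T rule: infinite_finite_induct) (auto simp: mult_add)

lemmas bilinear = add_mult mult_add minus_mult mult_minus diff_mult mult_diff scale_mult mult_scale

lemma f_u: "j \<in> K \<Longrightarrow> f j \<odot> u = f j" and u_f: "j \<in> K \<Longrightarrow> u \<odot> f j = f j"
  using finite_K by (simp_all add: f_sum[symmetric] mult_sum sum_mult f_orth)

lemma f'_u: "i \<in> I \<Longrightarrow> f' i \<odot> u = f' i" and u_f': "i \<in> I \<Longrightarrow> u \<odot> f' i = f' i"
  using finite_I by (simp_all add: f'_sum[symmetric] mult_sum sum_mult f'_orth)

lemma u_u: "u \<odot> u = u"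
  using f_u by (subst (1 3) f_sum[symmetric]) (simp add: sum_mult)

lemma u_u_assoc: "u \<odot> (u \<odot> x) = u \<odot> x"
  by (simp add: assoc[symmetric] u_u)

lemma f'_f'_assoc: "i \<in> I \<Longrightarrow> l \<in> I \<Longrightarrow> f' i \<odot> (f' l \<odot> x) = (if i = l then f' i \<odot> x else 0)"
  by (simp add: assoc[symmetric] f'_orth)

lemma u_mult_u: "u \<odot> x = x \<Longrightarrow> u \<odot> (x \<odot> u) = x \<odot> u"
  by (simp add: assoc[symmetric])

lemma u_f'_assoc: "i \<in> I \<Longrightarrow> u \<odot> (f' i \<odot> x) = f' i \<odot> x"
  by (simp add: assoc[symmetric] u_f')

lemma f'_u_assoc: "i \<in> I \<Longrightarrow> f' i \<odot> (u \<odot> x) = f' i \<odot> x"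
  by (simp add: assoc[symmetric] f'_u)

section \<open>Coordinates in the left ideals and the corners cut out by \<open>u\<close>\<close>

definition coord :: "'k \<Rightarrow> 'a \<Rightarrow> 'a" where
  "coord j x = component K L j x"

lemmas coord_mem = component_mem[OF direct, folded coord_def]
  and sum_coord = sum_component[OF direct, folded coord_def]
  and coord_unique = component_unique[OF direct, folded coord_def]
  and coord_add = component_add[OF direct, folded coord_def]
  and coord_0 = component_0[OF direct, folded coord_def]
  and coord_diff = component_diff[OF direct, folded coord_def]
  and coord_scale = component_scale[OF direct, folded coord_def]
  and coord_of = component_of[OF direct, folded coord_def]
  and coord_sum = component_sum[OF direct, folded coord_def]

lemma coord_mult: "j \<in> K \<Longrightarrow> coord j (a \<odot> x) = a \<odot> coord j x"
  by (rule coord_unique) (auto simp: mult_sum[symmetric] sum_coord intro: left_ideal coord_mem)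

text \<open>Together with left linearity of the coordinates this gives
  \<open>coord j (x \<odot> u) = x \<odot> f j\<close>, the rule behind every comparison of
  components below.\<close>

lemma coord_u: "j \<in> K \<Longrightarrow> coord j u = f j"
  by (rule coord_unique) (auto simp: f_sum f_mem)

text \<open>This and the next three sets are \<open>f'\<^sub>i L\<^sub>j (1 - u)\<close>,
  \<open>u L\<^sub>j (1 - u)\<close>, \<open>u A (1 - u)\<close> and \<open>u A u\<close>. The last
  two are given by equations, since \<open>1 - u\<close> is not an element and membership then
  reduces to rewriting.\<close>

definition left_part :: "'i \<Rightarrow> 'k \<Rightarrow> 'a set" where
  "left_part i j = {f' i \<odot> x - f' i \<odot> x \<odot> u | x. x \<in> L j}"

definition left_corner :: "'k \<Rightarrow> 'a set" where
  "left_corner j = {u \<odot> x - u \<odot> x \<odot> u | x. x \<in> L j}"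

definition outer_corner :: "'a set" where
  "outer_corner = {v. u \<odot> v = v \<and> v \<odot> u = 0}"

definition inner_corner :: "'a set" where
  "inner_corner = {x. u \<odot> x = x \<and> x \<odot> u = x}"

lemma left_part_iff:
  assumes "i \<in> I" "j \<in> K"
  shows "v \<in> left_part i j \<longleftrightarrow> (\<exists>y\<in>L j. f' i \<odot> y = y \<and> v = y - y \<odot> u)"
proof
  assume "v \<in> left_part i j"
  then obtain x where "x \<in> L j" "v = f' i \<odot> x - f' i \<odot> x \<odot> u" by (auto simp: left_part_def)
  then show "\<exists>y\<in>L j. f' i \<odot> y = y \<and> v = y - y \<odot> u"
    using assms left_ideal by (intro bexI[of _ "f' i \<odot> x"]) (auto simp: f'_f'_assoc)
qed (force simp: left_part_def)

lemma left_corner_iff: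
  assumes "j \<in> K"
  shows "v \<in> left_corner j \<longleftrightarrow> (\<exists>y\<in>L j. u \<odot> y = y \<and> v = y - y \<odot> u)"
proof
  assume "v \<in> left_corner j"
  then obtain x where "x \<in> L j" "v = u \<odot> x - u \<odot> x \<odot> u" by (auto simp: left_corner_def)
  then show "\<exists>y\<in>L j. u \<odot> y = y \<and> v = y - y \<odot> u"
    using assms left_ideal by (intro bexI[of _ "u \<odot> x"]) (auto simp: u_u_assoc)
qed (force simp: left_corner_def)

lemma subspace_left_corner: "j \<in> K \<Longrightarrow> subspace (left_corner j)"
proof (rule subspaceI)
  assume j: "j \<in> K"
  note sub = L_subspace[OF j]
  show "0 \<in> left_corner j"
    using subspace_0[OF sub] by (auto simp: left_corner_iff[OF j] intro!: bexI[of _ 0])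
  show "x + y \<in> left_corner j" if xy: "x \<in> left_corner j" "y \<in> left_corner j" for x y
  proof -
    obtain a b where "a \<in> L j" "u \<odot> a = a" "x = a - a \<odot> u" "b \<in> L j" "u \<odot> b = b" "y = b - b \<odot> u"
      using xy unfolding left_corner_iff[OF j] by blast
    then show ?thesis unfolding left_corner_iff[OF j]
      by (intro bexI[of _ "a + b"] subspace_add[OF sub]) (auto simp: bilinear)
  qed
  show "scale c x \<in> left_corner j" if x: "x \<in> left_corner j" for c x
  proof -
    obtain a where "a \<in> L j" "u \<odot> a = a" "x = a - a \<odot> u"
      using x unfolding left_corner_iff[OF j] by blast
    then show ?thesis unfolding left_corner_iff[OF j]
      by (intro bexI[of _ "scale c a"] subspace_scale[OF sub])
        (auto simp: bilinear scale_right_diff_distrib)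
  qed
qed

lemma left_part_eq:
  assumes "i \<in> I" "j \<in> K"
  shows "left_part i j = {v \<in> left_corner j. f' i \<odot> v = v}"
proof (intro equalityI subsetI)
  fix v assume "v \<in> left_part i j"
  then obtain y where y: "y \<in> L j" "f' i \<odot> y = y" "v = y - y \<odot> u"
    using assms by (auto simp: left_part_iff)
  then have "u \<odot> y = y" using u_f'_assoc[OF assms(1), of y] by simp
  moreover have "f' i \<odot> v = v" using y by (simp add: mult_diff assoc[symmetric])
  ultimately show "v \<in> {v \<in> left_corner j. f' i \<odot> v = v}" using y assms by (auto simp: left_corner_iff)
next
  fix v assume v: "v \<in> {v \<in> left_corner j. f' i \<odot> v = v}"
  then obtain y where y: "y \<in> L j" "v = y - y \<odot> u" using assms by (auto simp: left_corner_iff)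
  then have "v = f' i \<odot> y - f' i \<odot> y \<odot> u" using v by (simp add: mult_diff assoc)
  then show "v \<in> left_part i j" using y by (auto simp: left_part_def)
qed

lemma subspace_left_part: "i \<in> I \<Longrightarrow> j \<in> K \<Longrightarrow> subspace (left_part i j)"
  unfolding left_part_eq
  by (rule subspaceI)
    (auto simp: bilinear subspace_0 subspace_add subspace_scale subspace_left_corner)

lemma left_corner_u: "j \<in> K \<Longrightarrow> v \<in> left_corner j \<Longrightarrow> u \<odot> v = v"
  and left_corner_u_right: "j \<in> K \<Longrightarrow> v \<in> left_corner j \<Longrightarrow> v \<odot> u = 0"
  by (auto simp: left_corner_iff bilinear assoc u_u) (simp add: assoc[symmetric])

lemma left_corner_subset: "j \<in> K \<Longrightarrow> left_corner j \<subseteq> outer_corner"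
  by (auto simp: outer_corner_def left_corner_u left_corner_u_right)

lemma left_corner_mult:
  assumes "j \<in> K" "v \<in> left_corner j" "u \<odot> b = b" "b \<odot> u = b"
  shows "b \<odot> v \<in> left_corner j"
proof -
  obtain y where "y \<in> L j" "u \<odot> y = y" "v = y - y \<odot> u" using assms by (auto simp: left_corner_iff)
  then show ?thesis using assms(1,3) left_ideal unfolding left_corner_iff[OF assms(1)]
    by (intro bexI[of _ "b \<odot> y"]) (auto simp: bilinear assoc[symmetric])
qed

text \<open>The projections are the left multiplications by the orthogonal idempotents
  \<open>f' i\<close>, whose sum \<open>u\<close> acts as the identity on the corner.\<close>

lemma direct_left_parts:
  assumes j: "j \<in> K"
  shows "is_direct_sum scale I (\<lambda>i. left_part i j) (left_corner j)"
proof (rule is_direct_sum_projections[where p = "\<lambda>i v. f' i \<odot> v"])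
  show "f' i \<odot> v \<in> left_part i j" if "i \<in> I" "v \<in> left_corner j" for i v
    using that j left_corner_mult by (simp add: left_part_eq f'_f'_assoc u_f' f'_u)
  show "v = (\<Sum>i\<in>I. f' i \<odot> v)" if "v \<in> left_corner j" for v
    using left_corner_u[OF j that] by (simp add: sum_mult[symmetric] f'_sum)
  show "f' i \<odot> v = 0" if "i \<in> I" "l \<in> I" "i \<noteq> l" "v \<in> left_part l j" for i l v
  proof -
    have "f' i \<odot> v = f' i \<odot> (f' l \<odot> v)" using that j by (simp add: left_part_eq)
    then show ?thesis using that by (simp add: f'_f'_assoc)
  qed
qed (use j finite_I subspace_left_part subspace_left_corner in
    \<open>auto simp: left_part_eq bilinear\<close>)

lemma subspace_outer_corner: "subspace outer_corner"
  by (rule subspaceI) (auto simp: outer_corner_def bilinear)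

lemma subspace_inner_corner: "subspace inner_corner"
  by (rule subspaceI) (auto simp: inner_corner_def bilinear)

text \<open>A coordinate of \<open>v\<close> need not be killed by \<open>u\<close> on the right, so
  the projection subtracts \<open>coord j v \<odot> u\<close>; these corrections sum to
  \<open>v \<odot> u = 0\<close>. For \<open>v = y - y u\<close> with \<open>y \<in> L l\<close>, a
  coordinate \<open>j \<noteq> l\<close> is \<open>- y f\<^sub>j\<close>, which the correction
  cancels.\<close>

lemma direct_left_corners: "is_direct_sum scale K left_corner outer_corner"
proof (rule is_direct_sum_projections[where p = "\<lambda>j v. coord j v - coord j v \<odot> u"])
  show "coord j v - coord j v \<odot> u \<in> left_corner j" if "j \<in> K" "v \<in> outer_corner" for j v
  proof -
    have "u \<odot> coord j v = coord j v" using that coord_mult[of j u v] by (simp add: outer_corner_def)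
    then show ?thesis using that coord_mem[of j v] by (auto simp: left_corner_iff)
  qed
  show "v = (\<Sum>j\<in>K. coord j v - coord j v \<odot> u)" if "v \<in> outer_corner" for v
    using that by (simp add: sum_subtractf sum_mult[symmetric] sum_coord outer_corner_def)
  show "coord j v - coord j v \<odot> u = 0" if "j \<in> K" "l \<in> K" "j \<noteq> l" "v \<in> left_corner l" for j l v
    using that by (auto simp: left_corner_iff coord_diff coord_of coord_mult coord_u bilinear assoc f_u)
qed (use finite_K subspace_left_corner left_corner_subset subspace_outer_corner in
    \<open>auto simp: coord_add bilinear\<close>)

text \<open>
  On the element \<open>v = y - y u\<close> of the corner with \<open>y \<in> u L\<^sub>j\<close> the value is \<open>y u - y f\<^sub>j\<close>; the formula
  in terms of coordinates shows that this is well defined.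
\<close>

definition corner_map :: "'a \<Rightarrow> 'a" where
  "corner_map x = - (\<Sum>j\<in>K. coord j x \<odot> f j)"

lemma corner_map_add: "corner_map (x + y) = corner_map x + corner_map y"
  by (simp add: corner_map_def coord_add bilinear sum.distrib)

lemma corner_map_scale: "corner_map (scale c x) = scale c (corner_map x)"
  by (simp add: corner_map_def coord_scale bilinear scale_sum_right)

lemma corner_map_mult: "corner_map (a \<odot> x) = a \<odot> corner_map x"
  by (simp add: corner_map_def coord_mult bilinear mult_sum assoc)

lemma corner_map_u: "corner_map x \<odot> u = corner_map x"
  by (simp add: corner_map_def minus_mult sum_mult assoc f_u)

lemma corner_map_0 [simp]: "corner_map 0 = 0"
  using corner_map_add[of 0 0] by simp

lemma corner_map_of:
  assumes "j \<in> K" "y \<in> L j"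
  shows "corner_map (y - y \<odot> u) = y \<odot> u - y \<odot> f j"
proof -
  have "(\<Sum>l\<in>K. coord l (y - y \<odot> u) \<odot> f l) = (\<Sum>l\<in>K. (if l = j then y \<odot> f j else 0) - y \<odot> f l)"
    using assms by (intro sum.cong) (auto simp: coord_diff coord_of coord_mult coord_u bilinear assoc f_orth)
  also have "\<dots> = y \<odot> f j - y \<odot> u"
    using assms(1) finite_K by (simp add: sum_subtractf mult_sum[symmetric] f_sum)
  finally show ?thesis by (simp add: corner_map_def)
qed

text \<open>For \<open>v = y - y u\<close> the sum \<open>corner_map v + v\<close> collapses to
  \<open>y - y f\<^sub>j\<close>, which lies in \<open>L j\<close> and is annihilated by
  \<open>f j\<close> on the right.\<close>

lemma
  assumes "j \<in> K" "v \<in> left_corner j"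
  shows corner_map_add_mem: "corner_map v + v \<in> L j"
    and corner_map_f: "corner_map v \<odot> f j = 0"
proof -
  obtain y where y: "y \<in> L j" "v = y - y \<odot> u" using assms by (auto simp: left_corner_iff)
  then have eq: "corner_map v = y \<odot> u - y \<odot> f j" using corner_map_of assms(1) by simp
  have "corner_map v + v = y - y \<odot> f j" using eq y by simp
  moreover have "y - y \<odot> f j \<in> L j"
    using y assms(1) left_ideal f_mem L_subspace by (intro subspace_diff) auto
  ultimately show "corner_map v + v \<in> L j" by simp
  show "corner_map v \<odot> f j = 0" using assms(1) by (simp add: eq bilinear assoc u_f f_orth)
qed

lemma corner_map_inner: "v \<in> outer_corner \<Longrightarrow> corner_map v \<in> inner_corner"
  using corner_map_mult[of u v] corner_map_u by (auto simp: outer_corner_def inner_corner_def)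

text \<open>The space \<open>u A\<close> is the direct sum of the \<open>u L\<^sub>j\<close>, each
  embedded in \<open>u A u\<close> by \<open>x \<mapsto> x u\<close>. It is also
  \<open>u A u \<oplus> u A (1 - u)\<close>, and removing the summand \<open>u A u\<close> accounts
  for the \<open>- 1\<close>.\<close>

lemma dim_outer_corner:
  assumes basis: "finite_dimensional_vector_space scale E"
    and inj: "\<And>j x. j \<in> K \<Longrightarrow> x \<in> L j \<Longrightarrow> u \<odot> x = x \<Longrightarrow> x \<odot> u = 0 \<Longrightarrow> x = 0"
  shows "dim outer_corner \<le> (card K - 1) * dim inner_corner"
proof -
  interpret finite_dimensional_vector_space scale E by (rule basis)
  define U where "U = {x. u \<odot> x = x}"
  have U: "subspace U" by (rule subspaceI) (auto simp: U_def bilinear)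
  have LU: "subspace (L j \<inter> U)" if "j \<in> K" for j
    using L_subspace[OF that] U by (rule subspace_inter)
  have "is_direct_sum scale K (\<lambda>j. L j \<inter> U) U"
    by (rule is_direct_sum_projections[where p = coord])
      (use finite_K LU U in \<open>auto simp: coord_add coord_mem sum_coord coord_of U_def
        coord_mult[symmetric]\<close>)
  then have "dim U = (\<Sum>j\<in>K. dim (L j \<inter> U))" by (rule dim_direct_sum)
  also have "\<dots> \<le> (\<Sum>j\<in>K. dim inner_corner)"
    by (intro sum_mono dim_le_inj[where g = "\<lambda>x. x \<odot> u"])
      (auto simp: LU[unfolded U_def] bilinear inner_corner_def U_def assoc u_mult_u u_u inj)
  finally have "dim U \<le> card K * dim inner_corner" by simp
  moreover have "dim U = dim inner_corner + dim outer_corner"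
  proof -
    have "U = inner_corner + outer_corner"
    proof (intro equalityI subsetI)
      fix x assume "x \<in> U"
      then have "x \<odot> u \<in> inner_corner" "x - x \<odot> u \<in> outer_corner"
        by (auto simp: U_def inner_corner_def outer_corner_def bilinear assoc u_u u_mult_u)
      then have "x \<odot> u + (x - x \<odot> u) \<in> inner_corner + outer_corner" by (rule set_plus_intro)
      then show "x \<in> inner_corner + outer_corner" by simp
    qed (auto simp: set_plus_def U_def inner_corner_def outer_corner_def bilinear)
    moreover have "inner_corner \<inter> outer_corner \<subseteq> {0}"
      by (auto simp: inner_corner_def outer_corner_def)
    ultimately show ?thesis using dim_set_plus subspace_inner_corner subspace_outer_corner by simp
  qed
  ultimately show ?thesis by (simp add: diff_mult_distrib)
qed

end

section \<open>Graded algebras with a Wedderburn decomposition\<close>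

text \<open>\<open>C i j\<close> stands for the component \<open>A\<^sub>i\<^sub>j\<close>. Graded
  simplicity enters in the form of \<open>J_homogeneous\<close> and \<open>idem\<close>.\<close>

locale graded_wedderburn =
  finite_dim_algebra scale Basis
  for scale :: "'f::field \<Rightarrow> 'a::ring \<Rightarrow> 'a" and Basis +
  fixes I :: "'i set" and K :: "'k set" and C :: "'i \<Rightarrow> 'k \<Rightarrow> 'a set"
    and f' :: "'i \<Rightarrow> 'a" and f :: "'k \<Rightarrow> 'a" and u :: 'a and L :: "'k \<Rightarrow> 'a set"
    and R :: "'i \<Rightarrow> 'a set" and B J :: "'a set"
  assumes finite_I: "finite I" and finite_K: "finite K"
    and L_def: "L j = (\<Sum>i\<in>I. C i j)"
    and R_def: "R i = (\<Sum>j\<in>K. C i j)"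
    and C_direct: "is_direct_sum scale (I \<times> K) (\<lambda>(i, j). C i j) UNIV"
    and C_mult: "i \<in> I \<Longrightarrow> j \<in> K \<Longrightarrow> k \<in> I \<Longrightarrow> l \<in> K \<Longrightarrow> x \<in> C i j \<Longrightarrow> y \<in> C k l \<Longrightarrow> x * y \<in> C i l"
    and f_mem: "j \<in> K \<Longrightarrow> f j \<in> L j"
    and f'_mem: "i \<in> I \<Longrightarrow> f' i \<in> R i"
    and f_orth: "orthogonal_idempotents K f"
    and f'_orth: "orthogonal_idempotents I f'"
    and f_sum: "(\<Sum>j\<in>K. f j) = u"
    and f'_sum: "(\<Sum>i\<in>I. f' i) = u"
    and J_ideal: "two_sided_ideal scale J"
    and J_homogeneous: "i \<in> I \<Longrightarrow> j \<in> K \<Longrightarrow> x \<in> C i j \<Longrightarrow> x \<in> J \<Longrightarrow> x = 0"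
    and idem: "span {x * y | x y. True} = UNIV"
    and B_unit: "is_identity_of B u"
    and B_J: "is_direct_sum_list scale [B, J] UNIV"
begin

lemma C_subspace: "i \<in> I \<Longrightarrow> j \<in> K \<Longrightarrow> subspace (C i j)"
  using is_direct_sum_subspace[OF C_direct, of "(i, j)"] by simp

lemma L_direct: "is_direct_sum scale K L UNIV" and R_direct: "is_direct_sum scale I R UNIV"
  using is_direct_sum_Times[OF C_direct finite_I finite_K] by (simp_all add: L_def[abs_def] R_def[abs_def])

lemmas L_subspace = is_direct_sum_subspace[OF L_direct]
  and R_subspace = is_direct_sum_subspace[OF R_direct]

lemma C_in_L: "i \<in> I \<Longrightarrow> j \<in> K \<Longrightarrow> x \<in> C i j \<Longrightarrow> x \<in> L j"
  unfolding L_def by (rule set_sum_mem) (auto intro: finite_I C_subspace)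

lemma C_in_R: "i \<in> I \<Longrightarrow> j \<in> K \<Longrightarrow> x \<in> C i j \<Longrightarrow> x \<in> R i"
  unfolding R_def by (rule set_sum_mem) (auto intro: finite_K C_subspace)

text \<open>The coordinate in \<open>L j\<close> of an element of \<open>R i\<close> is its
  component in \<open>C i j\<close>. Hence a product of an element of \<open>R i\<close> with one of
  \<open>L j\<close> is homogeneous, which is how homogeneous elements are recognised later.\<close>

lemma R_inter_L:
  assumes "i \<in> I" "j \<in> K" "x \<in> R i" "x \<in> L j"
  shows "x \<in> C i j"
proof -
  obtain c where c: "\<forall>l\<in>K. c l \<in> C i l" "x = sum c K"
    using assms(3) by (auto simp: R_def set_sum_alt finite_K)
  have "component K L j x = c j"
    using c assms C_in_L by (intro component_unique[OF L_direct]) auto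
  moreover have "component K L j x = x" using component_of[OF L_direct] assms by simp
  ultimately have "x = c j" by (rule trans[OF sym, rotated])
  then show ?thesis using c(1) assms by blast
qed

lemma L_left:
  assumes "j \<in> K" "x \<in> L j"
  shows "a * x \<in> L j"
proof -
  obtain d where d: "\<forall>i\<in>I. d i \<in> C i j" "x = sum d I"
    using assms(2) by (auto simp: L_def set_sum_alt finite_I)
  obtain c where c: "\<forall>t\<in>I \<times> K. c t \<in> C (fst t) (snd t)" "a = sum c (I \<times> K)"
    using is_direct_sum_mem_iff[OF C_direct, of a] by (auto simp: case_prod_beta')
  have "c t * d i \<in> L j" if "t \<in> I \<times> K" "i \<in> I" for t i
  proof -
    have "c t * d i \<in> C (fst t) j" using c d that assms by (intro C_mult[of _ "snd t" i]) auto
    then show ?thesis using that assms by (intro C_in_L) auto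
  qed
  then have "(\<Sum>t\<in>I \<times> K. \<Sum>i\<in>I. c t * d i) \<in> L j"
    by (intro subspace_sum[OF L_subspace[OF assms(1)]])
  then show ?thesis by (simp add: c d sum_product)
qed

lemma R_right:
  assumes "i \<in> I" "x \<in> R i"
  shows "x * a \<in> R i"
proof -
  obtain d where d: "\<forall>j\<in>K. d j \<in> C i j" "x = sum d K"
    using assms(2) by (auto simp: R_def set_sum_alt finite_K)
  obtain c where c: "\<forall>t\<in>I \<times> K. c t \<in> C (fst t) (snd t)" "a = sum c (I \<times> K)"
    using is_direct_sum_mem_iff[OF C_direct, of a] by (auto simp: case_prod_beta')
  have "d j * c t \<in> R i" if "t \<in> I \<times> K" "j \<in> K" for t j
  proof -
    have "d j * c t \<in> C i (snd t)" using c d that assms by (intro C_mult[of _ j "fst t"]) auto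
    then show ?thesis using that assms by (intro C_in_R) auto
  qed
  then have "(\<Sum>j\<in>K. \<Sum>t\<in>I \<times> K. d j * c t) \<in> R i"
    by (intro subspace_sum[OF R_subspace[OF assms(1)]])
  then show ?thesis by (simp add: c d sum_product)
qed

lemma R_L_mult: "i \<in> I \<Longrightarrow> j \<in> K \<Longrightarrow> x \<in> R i \<Longrightarrow> y \<in> L j \<Longrightarrow> x * y \<in> C i j"
  by (intro R_inter_L L_left R_right)

sublocale left: left_decomposition scale "(*)" K L f I f' u
  by unfold_locales
    (use L_direct L_left f_mem f_orth f_sum finite_I f'_orth f'_sum in
      \<open>auto simp: distrib_left distrib_right mult.assoc scale_mult_left scale_mult_right
        orthogonal_idempotents_def\<close>)

text \<open>In the opposite ring rows and columns change places: \<open>right.coord i\<close>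
  projects to \<open>R i\<close>, and in \<open>right.left_part j i\<close> the index
  \<open>j\<close> belongs to the idempotent \<open>f j\<close> and \<open>i\<close> to the right
  ideal \<open>R i\<close>.\<close>

sublocale right: left_decomposition scale "\<lambda>x y. y * x" I R f' K f u
  by unfold_locales
    (use R_direct R_right f'_mem f_orth f_sum finite_K f'_orth f'_sum in
      \<open>auto simp: distrib_left distrib_right mult.assoc scale_mult_left scale_mult_right
        orthogonal_idempotents_def\<close>)

lemma J_subspace: "subspace J" and J_left: "x \<in> J \<Longrightarrow> a * x \<in> J" and J_right: "x \<in> J \<Longrightarrow> x * a \<in> J"
  using J_ideal by (auto simp: two_sided_ideal_def)

lemma B_subspace: "subspace B" and B_J_sum: "\<exists>b\<in>B. x - b \<in> J"
  and B_J_inter: "x \<in> B \<Longrightarrow> x \<in> J \<Longrightarrow> x = 0"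
proof -
  have B: "subspace B" "UNIV = B + J" "\<And>x y. x \<in> B \<Longrightarrow> y \<in> J \<Longrightarrow> x + y = 0 \<Longrightarrow> x = 0"
    using B_J unfolding is_direct_sum_list2_iff by blast+
  show "subspace B" by (rule B)
  have "x \<in> B + J" using B(2) by blast
  then obtain b y where "b \<in> B" "y \<in> J" "x = b + y" by (rule set_plus_elim)
  then show "\<exists>b\<in>B. x - b \<in> J" by (intro bexI[of _ b]) simp_all
  show "x = 0" if "x \<in> B" "x \<in> J"
    using B(3)[OF that(1), of "- x"] that subspace_neg[OF J_subspace] by simp
qed

lemma u_left: "x \<in> B \<Longrightarrow> u * x = x" and u_right: "x \<in> B \<Longrightarrow> x * u = x"
  using B_unit by (auto simp: is_identity_of_def)

text \<open>The product lies in \<open>J\<close> and is a sum of homogeneous elements of \<open>J\<close>, which vanish.\<close>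

lemma mult_J_mult: "y \<in> J \<Longrightarrow> a * y * b = 0"
proof -
  assume y: "y \<in> J"
  have "right.coord i a * y * left.coord j b = 0" if "i \<in> I" "j \<in> K" for i j
  proof (rule J_homogeneous[OF that])
    show "right.coord i a * y * left.coord j b \<in> C i j"
      using that right.coord_mem left.coord_mem R_right by (intro R_L_mult) auto
    show "right.coord i a * y * left.coord j b \<in> J" using y J_left J_right by blast
  qed
  then have "(\<Sum>i\<in>I. \<Sum>j\<in>K. right.coord i a * y * left.coord j b) = 0" by simp
  then have "(\<Sum>i\<in>I. right.coord i a) * y * (\<Sum>j\<in>K. left.coord j b) = 0"
    unfolding sum_distrib_right[of _ I y] sum_product .
  then show ?thesis by (simp add: left.sum_coord right.sum_coord)
qed

text \<open>Modulo \<open>J\<close> every \<open>x\<close> equals some \<open>b \<in> B\<close>, for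
  which both differences vanish.\<close>

lemma diff_mult_u_J: "x - x * u \<in> J" and diff_u_mult_J: "x - u * x \<in> J"
proof -
  obtain b where b: "b \<in> B" "x - b \<in> J" using B_J_sum by blast
  have eq: "x - x * u = (x - b) - (x - b) * u" "x - u * x = (x - b) - u * (x - b)"
    using b u_left u_right by (simp_all add: left_diff_distrib right_diff_distrib)
  show "x - x * u \<in> J" "x - u * x \<in> J"
    unfolding eq using b(2) J_left J_right by (auto intro!: subspace_diff[OF J_subspace])
qed

text \<open>The equation \<open>A\<^sup>2 = A\<close> as an induction rule for linear
  properties.\<close>

lemma products_induct:
  assumes "subspace (Collect P)" "\<And>a b. P (a * b)"
  shows "P x"
proof -
  have "x \<in> span {x * y | x y. True}" using idem by simp
  then show ?thesis by (rule span_induct) (use assms in auto)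
qed

text \<open>Writing \<open>x\<close> as a product \<open>a b\<close> moves the defect to
  \<open>b - b u\<close>, an element of \<open>J\<close> enclosed by \<open>a\<close> and
  \<open>y\<close>.\<close>

lemma mult_u_mult: "x * u * y = x * y"
proof -
  have "x * (y - u * y) \<in> {0}"
  proof (rule products_induct[where P = "\<lambda>x. x * (y - u * y) \<in> {0}"])
    show "subspace {x. x * (y - u * y) \<in> {0}}" by (intro subspace_mult_right) simp
    fix a b
    have "a * b * (y - u * y) = a * (b - b * u) * y"
      by (simp add: left_diff_distrib right_diff_distrib mult.assoc)
    then show "a * b * (y - u * y) \<in> {0}" using mult_J_mult[OF diff_mult_u_J] by simp
  qed
  then show ?thesis by (simp add: right_diff_distrib mult.assoc)
qed

lemma B_eq: "B = left.inner_corner"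
proof (intro equalityI subsetI)
  fix x assume x: "x \<in> left.inner_corner"
  obtain b where b: "b \<in> B" "x - b \<in> J" using B_J_sum by blast
  have "x = u * x * u" using x by (simp add: left.inner_corner_def)
  also have "\<dots> = u * (x - b) * u + u * b * u" by (simp add: left_diff_distrib right_diff_distrib)
  also have "\<dots> = b" using mult_J_mult[OF b(2)] b u_left u_right by simp
  finally show "x \<in> B" using b by simp
qed (simp add: left.inner_corner_def u_left u_right)

lemma B_eq': "B = right.inner_corner"
  by (auto simp: B_eq left.inner_corner_def right.inner_corner_def)

lemma u_mult_u_B: "u * x * u \<in> B"
  by (simp add: B_eq left.inner_corner_def mult.assoc left.u_u left.u_u_assoc)

lemma B_mult: "x \<in> B \<Longrightarrow> y \<in> B \<Longrightarrow> x * y \<in> B"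
  by (simp add: B_eq left.inner_corner_def mult.assoc) (simp add: mult.assoc[symmetric])

lemma f_B: "j \<in> K \<Longrightarrow> f j \<in> B" and f'_B: "i \<in> I \<Longrightarrow> f' i \<in> B"
  by (simp_all add: B_eq left.inner_corner_def left.u_f left.f_u left.u_f' left.f'_u)

abbreviation "X10 \<equiv> left.outer_corner"
abbreviation "X01 \<equiv> right.outer_corner"
abbreviation "J10 \<equiv> left.left_corner"
abbreviation "J01 \<equiv> right.left_corner"

lemma X10_iff: "v \<in> X10 \<longleftrightarrow> u * v = v \<and> v * u = 0" and X01_iff: "v \<in> X01 \<longleftrightarrow> v * u = v \<and> u * v = 0"
  by (simp_all add: left.outer_corner_def right.outer_corner_def)

lemma J10_D: "j \<in> K \<Longrightarrow> v \<in> J10 j \<Longrightarrow> u * v = v \<and> v * u = 0"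
  using left.left_corner_u left.left_corner_u_right by simp

lemma J01_D: "i \<in> I \<Longrightarrow> v \<in> J01 i \<Longrightarrow> v * u = v \<and> u * v = 0"
  using right.left_corner_u right.left_corner_u_right by simp

lemma X10_subset_J: "X10 \<subseteq> J"
proof
  show "v \<in> J" if "v \<in> X10" for v using that diff_mult_u_J[of v] by (simp add: X10_iff)
qed

lemma X01_subset_J: "X01 \<subseteq> J"
proof
  show "v \<in> J" if "v \<in> X01" for v using that diff_u_mult_J[of v] by (simp add: X01_iff)
qed

text \<open>Each \<open>f' i * x\<close> lies in \<open>R i L j\<close> and in \<open>J\<close>, so
  it is a homogeneous element of \<open>J\<close> and vanishes; their sum is \<open>u x = x\<close>.
  Injectivity of \<open>\<phi>\<close> on a corner and a dimension bound depend on this.\<close>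

lemma L_corner_J:
  assumes "j \<in> K" "x \<in> L j" "x \<in> J" "u * x = x"
  shows "x = 0"
proof -
  have "f' i * x = 0" if "i \<in> I" for i
    using assms that J_left by (intro J_homogeneous[of i j]) (auto intro: R_L_mult f'_mem)
  then have "(\<Sum>i\<in>I. f' i) * x = 0" by (simp add: sum_distrib_right)
  then show ?thesis using assms by (simp add: f'_sum)
qed

lemma R_corner_J:
  assumes "i \<in> I" "x \<in> R i" "x \<in> J" "x * u = x"
  shows "x = 0"
proof -
  have "x * f j = 0" if "j \<in> K" for j
    using assms that J_right by (intro J_homogeneous[of i j]) (auto intro: R_L_mult f_mem)
  then have "x * (\<Sum>j\<in>K. f j) = 0" by (simp add: sum_distrib_left)
  then show ?thesis using assms by (simp add: f_sum)
qed

subsection \<open>The square of the radical\<close>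

abbreviation "JJ \<equiv> subspace_prod scale J J"

lemma JJ_def: "JJ = span {x * y | x y. x \<in> J \<and> y \<in> J}"
  by (simp add: subspace_prod_def)

lemma JJ_u: "z \<in> JJ \<Longrightarrow> u * z = 0" and JJ_u_right: "z \<in> JJ \<Longrightarrow> z * u = 0"
  unfolding JJ_def
  by (auto elim!: span_mult_eq_0_left[rotated] span_mult_eq_0_right[rotated]
      simp: mult.assoc[symmetric] mult_J_mult)

lemma JJ_subset: "JJ \<subseteq> J"
  unfolding JJ_def using J_left by (intro span_minimal J_subspace) auto

text \<open>The Peirce projection \<open>z \<mapsto> (1 - u) z (1 - u)\<close>, expanded.\<close>

definition outer :: "'a \<Rightarrow> 'a" where
  "outer z = z - u * z - z * u + u * z * u"

lemma outer_add: "outer (x + y) = outer x + outer y"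
  and outer_diff: "outer (x - y) = outer x - outer y"
  and outer_scale: "outer (scale c x) = scale c (outer x)"
  by (simp_all add: outer_def algebra_simps scale_mult_left scale_mult_right
      scale_right_diff_distrib)

lemma outer_0 [simp]: "outer 0 = 0"
  by (simp add: outer_def)

lemma outer_sum: "outer (sum g T) = (\<Sum>t\<in>T. outer (g t))"
  by (induction T rule: infinite_finite_induct) (auto simp: outer_add)

lemma outer_mult: "outer (a * b) = (a - u * a) * (b - b * u)"
  by (simp add: outer_def left_diff_distrib right_diff_distrib mult.assoc)

text \<open>On a product \<open>a b\<close> the value is \<open>(a - u a) (b - b u)\<close>, with
  both factors in \<open>J\<close>.\<close>

lemma outer_in_JJ: "outer z \<in> JJ"
proof -
  have sub: "subspace JJ" by (simp add: JJ_def)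
  show ?thesis
  proof (rule products_induct[where P = "\<lambda>z. outer z \<in> JJ"])
    show "subspace {z. outer z \<in> JJ}"
      by (rule subspaceI)
        (auto simp: outer_add outer_scale subspace_add[OF sub] subspace_scale[OF sub] subspace_0[OF sub])
    show "outer (a * b) \<in> JJ" for a b
      unfolding JJ_def outer_mult using diff_mult_u_J diff_u_mult_J by (auto intro!: span_base)
  qed
qed

text \<open>Since \<open>u J u = 0\<close>, an element \<open>y\<close> of \<open>J\<close> is
  \<open>y u + u y + outer y\<close>. Multiplication by \<open>u\<close> on the left and on the
  right separates the three summands, as it kills \<open>J\<^sup>2\<close>.\<close>

lemma J_direct: "is_direct_sum_list scale [X01, X10, JJ] J"
proof -
  have "y \<in> X01 + X10 + JJ" if y: "y \<in> J" for y
  proof -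
    have 0: "u * y * u = 0" by (rule mult_J_mult[OF y])
    have "y * u \<in> X01" "u * y \<in> X10"
      using 0 by (simp_all add: X10_iff X01_iff mult.assoc left.u_u left.u_u_assoc)
    then have "y * u + u * y + outer y \<in> X01 + X10 + JJ" using outer_in_JJ by (intro set_plus_intro)
    then show ?thesis using 0 by (simp add: outer_def)
  qed
  moreover have "x + y + z \<in> J" if "x \<in> X01" "y \<in> X10" "z \<in> JJ" for x y z
    using that X10_subset_J X01_subset_J JJ_subset by (intro subspace_add[OF J_subspace]) auto
  ultimately have "J = X01 + X10 + JJ" by (fastforce simp: set_plus_def)
  moreover have "x = 0 \<and> y = 0 \<and> z = 0"
    if "x \<in> X01" "y \<in> X10" "z \<in> JJ" "x + y + z = 0" for x y z
  proof -
    have "y = 0" using arg_cong[OF that(4), of "\<lambda>t. u * t"] that(1-3) JJ_u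
      by (simp add: X10_iff X01_iff distrib_left)
    moreover have "x = 0" using arg_cong[OF that(4), of "\<lambda>t. t * u"] that(1-3) JJ_u_right
      by (simp add: X10_iff X01_iff distrib_right)
    ultimately show ?thesis using that(4) by simp
  qed
  ultimately show ?thesis
    unfolding is_direct_sum_list3_iff
    using left.subspace_outer_corner right.subspace_outer_corner by (auto simp: JJ_def)
qed

subsection \<open>The map \<open>\<phi>\<close>\<close>

text \<open>Multiplying by \<open>u\<close> on the left retains the \<open>X10\<close> part and on
  the right the \<open>X01\<close> part, so one formula on the whole algebra induces both halves of
  the map.\<close>

definition phi :: "'a \<Rightarrow> 'a" where
  "phi v = left.corner_map (u * v) + right.corner_map (v * u)"

lemma phi_X10: "v \<in> X10 \<Longrightarrow> phi v = left.corner_map v"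
  and phi_X01: "v \<in> X01 \<Longrightarrow> phi v = right.corner_map v"
  by (simp_all add: phi_def X10_iff X01_iff)

lemma phi_add: "phi (x + y) = phi x + phi y"
  by (simp add: phi_def distrib_left distrib_right left.corner_map_add right.corner_map_add)

lemma phi_scale: "phi (scale c x) = scale c (phi x)"
  by (simp add: phi_def scale_mult_left scale_mult_right left.corner_map_scale
      right.corner_map_scale scale_right_distrib)

lemma phi_0 [simp]: "phi 0 = 0"
  by (simp add: phi_def)

lemma phi_X10_B: "v \<in> X10 \<Longrightarrow> phi v \<in> B"
  by (simp add: phi_X10 B_eq left.corner_map_inner)

lemma phi_X01_B: "v \<in> X01 \<Longrightarrow> phi v \<in> B"
  by (simp add: phi_X01 B_eq' right.corner_map_inner)

lemma X10_mult: "b \<in> B \<Longrightarrow> v \<in> X10 \<Longrightarrow> b * v \<in> X10"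
  by (simp add: X10_iff mult.assoc) (simp add: mult.assoc[symmetric] u_left)

lemma X01_mult: "b \<in> B \<Longrightarrow> v \<in> X01 \<Longrightarrow> v * b \<in> X01"
  by (simp add: X01_iff mult.assoc[symmetric]) (simp add: mult.assoc u_right)

lemma phi_left: "b \<in> B \<Longrightarrow> v \<in> X10 \<Longrightarrow> phi (b * v) = b * phi v"
  by (simp add: phi_X10 X10_mult left.corner_map_mult)

lemma phi_right: "b \<in> B \<Longrightarrow> v \<in> X01 \<Longrightarrow> phi (v * b) = phi v * b"
  by (simp add: phi_X01 X01_mult right.corner_map_mult)

lemma J10_X10: "j \<in> K \<Longrightarrow> v \<in> J10 j \<Longrightarrow> v \<in> X10"
  using left.left_corner_subset by blast

lemma J01_X01: "i \<in> I \<Longrightarrow> v \<in> J01 i \<Longrightarrow> v \<in> X01"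
  using right.left_corner_subset by blast

lemma phi_J10_add: "j \<in> K \<Longrightarrow> v \<in> J10 j \<Longrightarrow> phi v + v \<in> L j"
  by (simp add: phi_X10 J10_X10 left.corner_map_add_mem)

lemma phi_J01_add: "i \<in> I \<Longrightarrow> v \<in> J01 i \<Longrightarrow> phi v + v \<in> R i"
  by (simp add: phi_X01 J01_X01 right.corner_map_add_mem)

lemma phi_J10_f: "j \<in> K \<Longrightarrow> v \<in> J10 j \<Longrightarrow> phi v * f j = 0"
  by (simp add: phi_X10 J10_X10 left.corner_map_f)

lemma phi_J01_f': "i \<in> I \<Longrightarrow> v \<in> J01 i \<Longrightarrow> f' i * phi v = 0"
  by (simp add: phi_X01 J01_X01 right.corner_map_f)

text \<open>If \<open>phi v = 0\<close>, then \<open>v = phi v + v\<close> lies in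
  \<open>L j\<close>, and \<open>L_corner_J\<close> applies.\<close>

lemma phi_J10_inj: "j \<in> K \<Longrightarrow> v \<in> J10 j \<Longrightarrow> phi v = 0 \<Longrightarrow> v = 0"
  using phi_J10_add[of j v] J10_X10[of j v] X10_subset_J by (auto intro: L_corner_J simp: X10_iff)

lemma phi_J01_inj: "i \<in> I \<Longrightarrow> v \<in> J01 i \<Longrightarrow> phi v = 0 \<Longrightarrow> v = 0"
  using phi_J01_add[of i v] J01_X01[of i v] X01_subset_J by (auto intro: R_corner_J simp: X01_iff)

lemma phi_left_generator:
  assumes "i \<in> I" "j \<in> K" "x \<in> C i j"
  shows "f' i * x - f' i * x * u \<in> left.left_part i j"
    "phi (f' i * x - f' i * x * u) = f' i * x * u - f' i * x * f j"
proof -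
  have xL: "x \<in> L j" using assms by (rule C_in_L)
  then show part: "f' i * x - f' i * x * u \<in> left.left_part i j" by (auto simp: left.left_part_def)
  then have "f' i * x - f' i * x * u \<in> X10"
    using assms left.left_part_eq J10_X10 by blast
  then show "phi (f' i * x - f' i * x * u) = f' i * x * u - f' i * x * f j"
    using left.corner_map_of[OF assms(2) L_left[OF assms(2) xL]] by (simp add: phi_X10)
qed

lemma phi_right_generator:
  assumes "i \<in> I" "j \<in> K" "x \<in> C i j"
  shows "x * f j - u * (x * f j) \<in> right.left_part j i"
    "phi (x * f j - u * (x * f j)) = u * (x * f j) - f' i * (x * f j)"
proof -
  have xR: "x \<in> R i" using assms by (rule C_in_R)
  then show part: "x * f j - u * (x * f j) \<in> right.left_part j i" by (auto simp: right.left_part_def)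
  then have "x * f j - u * (x * f j) \<in> X01"
    using assms right.left_part_eq J01_X01 by blast
  then show "phi (x * f j - u * (x * f j)) = u * (x * f j) - f' i * (x * f j)"
    using right.corner_map_of[OF assms(1) R_right[OF assms(1) xR]] by (simp add: phi_X01)
qed

text \<open>The generator can be chosen homogeneous because \<open>y = f' i * y\<close> lies in
  \<open>R i L j\<close>.\<close>

lemma left_part_generator:
  assumes "i \<in> I" "j \<in> K" "v \<in> left.left_part i j"
  obtains x where "x \<in> C i j" "f' i * x = x" "v = x - x * u"
proof -
  obtain y where y: "y \<in> L j" "f' i * y = y" "v = y - y * u"
    using assms left.left_part_iff by blast
  then have "y \<in> C i j" using R_L_mult[OF assms(1,2) f'_mem[OF assms(1)] y(1)] by simp
  with y that show ?thesis by blast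
qed

lemma right_part_generator:
  assumes "i \<in> I" "j \<in> K" "v \<in> right.left_part j i"
  obtains x where "x \<in> C i j" "x * f j = x" "v = x - u * x"
proof -
  obtain y where y: "y \<in> R i" "y * f j = y" "v = y - u * y"
    using assms right.left_part_iff by blast
  then have "y \<in> C i j" using R_L_mult[OF assms(1,2) y(1) f_mem[OF assms(2)]] by simp
  with y that show ?thesis by blast
qed

subsection \<open>Homogeneous components\<close>

text \<open>The part of \<open>A\<^sub>i\<^sub>j\<close> on which the corner idempotents act as
  zero; it receives the third summand of (c) and turns out to be exhausted by it.\<close>

definition cell :: "'i \<Rightarrow> 'k \<Rightarrow> 'a set" where
  "cell i j = {z \<in> C i j. f' i * z = 0 \<and> z * f j = 0}"

lemma cell_subspace: "i \<in> I \<Longrightarrow> j \<in> K \<Longrightarrow> subspace (cell i j)"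
  by (rule subspaceI)
    (auto simp: cell_def distrib_left distrib_right scale_mult_left scale_mult_right
      C_subspace subspace_0 subspace_add subspace_scale)

text \<open>
  Comparing the components in \<open>L\<^sub>j\<close> and then in \<open>R\<^sub>i\<close> on both sides of \<open>z = u z + z u - u z u\<close>.
\<close>

lemma cell_eq_0:
  assumes "i \<in> I" "j \<in> K" "z \<in> cell i j" "outer z = 0"
  shows "z = 0"
proof -
  have z: "z \<in> L j" "z \<in> R i" "f' i * z = 0" "z * f j = 0"
    using assms C_in_L C_in_R by (auto simp: cell_def)
  \<comment> \<open>The terms \<open>z * u\<close> and \<open>u * z * u\<close> contribute
    \<open>z * f j\<close> and \<open>u * z * f j\<close>, both zero.\<close>
  have "left.coord j (outer z) = z - u * z"
    using z assms(1,2) L_left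
    by (simp add: outer_def left.coord_diff left.coord_add left.coord_u left.coord_of mult.assoc
        left.coord_mult)
  then have uz: "z = u * z" using assms by (simp add: left.coord_0)
  have "z = right.coord i z" using z assms by (simp add: right.coord_of)
  also have "\<dots> = right.coord i (u * z)" using uz by simp
  also have "\<dots> = 0" using z assms by (simp add: right.coord_mult right.coord_u)
  finally show ?thesis .
qed

abbreviation "gen v w \<equiv> phi v * phi w + v * phi w + phi v * w + v * w"

definition gen_space :: "'i \<Rightarrow> 'k \<Rightarrow> 'a set" where
  "gen_space i j = span {gen v w | v w. v \<in> J01 i \<and> w \<in> J10 j}"

lemma gen_eq: "gen v w = (phi v + v) * (phi w + w)"
  by (simp add: distrib_left distrib_right ac_simps)

text \<open>By \<open>gen_eq\<close> the generator is a product of an element of \<open>R i\<close>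
  killed by \<open>f' i\<close> and one of \<open>L j\<close> killed by \<open>f j\<close>. Its
  outer part is \<open>v w\<close> and its inner part \<open>phi v * phi w\<close>, so a single
  element carries both sides of (d).\<close>

lemma gen_cell:
  assumes "i \<in> I" "j \<in> K" "v \<in> J01 i" "w \<in> J10 j"
  shows "gen v w \<in> cell i j" "outer (gen v w) = v * w" "u * gen v w * u = phi v * phi w"
proof -
  have v: "v * u = v" "u * v = 0" and w: "u * w = w" "w * u = 0"
    using J01_D J10_D assms by auto
  have pv: "u * phi v = phi v" "phi v * u = phi v" and pw: "u * phi w = phi w" "phi w * u = phi w"
    using assms J10_X10 J01_X01 phi_X10_B phi_X01_B u_left u_right by auto
  have "f' i * v = f' i * (u * v)" "w * f j = w * u * f j"
    using assms by (simp_all add: left.f'_u_assoc mult.assoc left.u_f)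
  then have "f' i * (phi v + v) = 0" "(phi w + w) * f j = 0"
    using v w assms by (simp_all add: distrib_left distrib_right phi_J01_f' phi_J10_f)
  then show "gen v w \<in> cell i j"
    using assms phi_J01_add phi_J10_add R_L_mult unfolding gen_eq cell_def
    by (simp add: mult.assoc) (simp add: mult.assoc[symmetric])
  show "outer (gen v w) = v * w"
    unfolding gen_eq outer_mult using v w pv pw by (simp add: distrib_left distrib_right)
  have "u * gen v w * u = (u * (phi v + v)) * ((phi w + w) * u)" by (simp only: gen_eq mult.assoc)
  then show "u * gen v w * u = phi v * phi w" using v w pv pw by (simp add: distrib_left distrib_right)
qed

lemma gen_space_subset_cell: "i \<in> I \<Longrightarrow> j \<in> K \<Longrightarrow> gen_space i j \<subseteq> cell i j"
  unfolding gen_space_def using gen_cell by (intro span_minimal cell_subspace) auto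

abbreviation "JJ_part i j \<equiv> subspace_prod scale (J01 i) (J10 j)"

lemma outer_gen_space:
  assumes "i \<in> I" "j \<in> K" "p \<in> JJ_part i j"
  shows "\<exists>z\<in>gen_space i j. outer z = p"
  using assms(3) unfolding subspace_prod_def
proof (induction rule: span_induct_alt)
  case base
  show ?case by (rule bexI[of _ 0]) (auto simp: outer_def gen_space_def span_zero)
next
  case (step c x y)
  then obtain v w z where vw: "x = v * w" "v \<in> J01 i" "w \<in> J10 j" and z: "z \<in> gen_space i j" "outer z = y"
    by blast
  have "gen v w \<in> gen_space i j" using vw unfolding gen_space_def by (intro span_base) blast
  then have "scale c (gen v w) + z \<in> gen_space i j"
    using z(1) unfolding gen_space_def by (rule span_add[OF span_scale])
  moreover have "outer (scale c (gen v w) + z) = scale c x + y"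
    using assms vw z gen_cell(2)[of i j v w] by (simp add: outer_add outer_scale)
  ultimately show ?case by blast
qed

text \<open>This is \<open>A = A\<^sup>2\<close> projected to \<open>A\<^sub>i\<^sub>j\<close>: the
  projection of \<open>a b\<close> is the product of the \<open>R i\<close> coordinate of
  \<open>a\<close> and the \<open>L j\<close> coordinate of \<open>b\<close>.\<close>

lemma C_span:
  assumes "i \<in> I" "j \<in> K" "x \<in> C i j"
  shows "x \<in> span {p * q | p q. p \<in> R i \<and> q \<in> L j}" (is "_ \<in> span ?G")
proof -
  have "left.coord j (right.coord i x) \<in> span ?G"
  proof (rule products_induct[where P = "\<lambda>x. left.coord j (right.coord i x) \<in> span ?G"])
    show "subspace {x. left.coord j (right.coord i x) \<in> span ?G}"
      by (rule subspaceI)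
        (use assms in \<open>auto simp: left.coord_add right.coord_add left.coord_scale right.coord_scale
          left.coord_0 right.coord_0 span_zero intro: span_add span_scale\<close>)
    show "left.coord j (right.coord i (a * b)) \<in> span ?G" for a b
      using assms left.coord_mem right.coord_mem
      by (simp add: left.coord_mult right.coord_mult) (rule span_base, blast)
  qed
  then show ?thesis using assms C_in_L C_in_R by (simp add: left.coord_of right.coord_of)
qed

lemma outer_C:
  assumes "i \<in> I" "j \<in> K" "x \<in> C i j"
  shows "outer x \<in> JJ_part i j"
proof -
  have sub: "subspace (JJ_part i j)" by (simp add: subspace_prod_def)
  have "x \<in> {x. outer x \<in> JJ_part i j}"
  proof (rule span_subspace_induct[OF C_span[OF assms]])
    show "subspace {x. outer x \<in> JJ_part i j}"
      by (rule subspaceI)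
        (auto simp: outer_add outer_scale outer_def[of 0] subspace_0[OF sub]
          intro: subspace_add[OF sub] subspace_scale[OF sub])
    fix x assume "x \<in> {p * q | p q. p \<in> R i \<and> q \<in> L j}"
    then obtain p q where pq: "x = p * q" "p \<in> R i" "q \<in> L j" by blast
    \<comment> \<open>Inserting \<open>u\<close> between the factors turns them into elements of the
      two corners.\<close>
    have "outer x = (p - u * p) * u * (q - q * u)" by (simp add: pq outer_mult mult_u_mult)
    also have "\<dots> = (p * u - u * (p * u)) * (u * q - u * q * u)"
      using left.u_u by (simp add: left_diff_distrib right_diff_distrib mult.assoc left.u_u_assoc)
    finally show "x \<in> {x. outer x \<in> JJ_part i j}"
      using pq by (auto simp: subspace_prod_def left.left_corner_def right.left_corner_def intro!: span_base)
  qed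
  then show ?thesis by simp
qed

text \<open>Left multiplication by \<open>f' i\<close> fixes \<open>phi v + v\<close> and kills
  \<open>phi w + w\<close>; right multiplication by \<open>f j\<close> does the opposite. This
  separates the summands in (c).\<close>

lemma corner_part_decomposition:
  assumes "i \<in> I" "j \<in> K" "v \<in> left.left_part i j" "w \<in> right.left_part j i"
  shows "phi (v + w) + (v + w) \<in> C i j"
    "f' i * (phi (v + w) + (v + w)) = phi v + v" "(phi (v + w) + (v + w)) * f j = phi w + w"
    "f' i * (phi w + w) = 0" "(phi v + v) * f j = 0"
proof -
  have v: "v \<in> J10 j" "f' i * v = v" and w: "w \<in> J01 i" "w * f j = w"
    using assms left.left_part_eq right.left_part_eq by auto
  have "f' i * phi v = phi v" using phi_left[OF f'_B[OF assms(1)] J10_X10[OF assms(2) v(1)]] assms v by simp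
  moreover have "phi w * f j = phi w" using phi_right[OF f_B[OF assms(2)] J01_X01[OF assms(1) w(1)]] assms w by simp
  moreover have "f' i * w = f' i * (u * w)" "v * f j = v * u * f j"
    using assms by (simp_all add: left.f'_u_assoc mult.assoc left.u_f)
  then have "f' i * w = 0" "v * f j = 0" using J10_D J01_D v w assms by simp_all
  moreover have "f' i * phi w = 0" "phi v * f j = 0" using phi_J01_f' phi_J10_f v w assms by auto
  ultimately show f: "f' i * (phi (v + w) + (v + w)) = phi v + v"
    "(phi (v + w) + (v + w)) * f j = phi w + w"
    "f' i * (phi w + w) = 0" "(phi v + v) * f j = 0"
    using v w by (simp_all add: phi_add distrib_left distrib_right)
  have "f' i * (phi v + v) = phi v + v" "(phi w + w) * f j = phi w + w"
    using v w \<open>f' i * phi v = phi v\<close> \<open>phi w * f j = phi w\<close> by (simp_all add: distrib_left distrib_right)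
  then have "phi v + v \<in> C i j" "phi w + w \<in> C i j"
    using R_L_mult[OF assms(1,2) f'_mem[OF assms(1)] phi_J10_add[OF assms(2) v(1)]]
      R_L_mult[OF assms(1,2) phi_J01_add[OF assms(1) w(1)] f_mem[OF assms(2)]] by simp_all
  moreover have "phi (v + w) + (v + w) = (phi v + v) + (phi w + w)" by (simp add: phi_add)
  ultimately show "phi (v + w) + (v + w) \<in> C i j" using subspace_add C_subspace assms by metis
qed

lemma component_direct:
  assumes i: "i \<in> I" and j: "j \<in> K"
  shows "is_direct_sum_list scale
    [{f' i * b * f j | b. b \<in> B}, {phi v + v | v. v \<in> left.left_part i j + right.left_part j i},
     gen_space i j] (C i j)" (is "is_direct_sum_list scale [?E, ?F, ?G] _")
proof -
  note parts = left.subspace_left_part[OF i j] right.subspace_left_part[OF j i]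
  have E: "subspace ?E"
  proof (rule subspaceI)
    show "0 \<in> ?E" using subspace_0[OF B_subspace] by force
    fix x y assume "x \<in> ?E" "y \<in> ?E"
    then obtain b c where "x + y = f' i * (b + c) * f j" "b + c \<in> B"
      using subspace_add[OF B_subspace] by (fastforce simp: distrib_left distrib_right)
    then show "x + y \<in> ?E" by blast
  next
    fix c x assume "x \<in> ?E"
    then obtain b where "scale c x = f' i * scale c b * f j" "scale c b \<in> B"
      using subspace_scale[OF B_subspace] by (fastforce simp: scale_mult_left scale_mult_right)
    then show "scale c x \<in> ?E" by blast
  qed
  have "subspace (left.left_part i j + right.left_part j i)"
    using parts by (rule subspace_set_plus)
  then have F: "subspace ?F"
  proof (intro subspaceI)
    assume sub: "subspace (left.left_part i j + right.left_part j i)" (is "subspace ?V")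
    have "phi 0 + 0 \<in> ?F" using subspace_0[OF sub] by blast
    then show "0 \<in> ?F" by simp
    show "x + y \<in> ?F" if xy: "x \<in> ?F" "y \<in> ?F" for x y
    proof -
      obtain v w where "v \<in> ?V" "w \<in> ?V" "x = phi v + v" "y = phi w + w" using xy by blast
      then have "x + y = phi (v + w) + (v + w)" "v + w \<in> ?V"
        using subspace_add[OF sub] by (auto simp: phi_add)
      then show ?thesis by blast
    qed
    show "scale c x \<in> ?F" if x: "x \<in> ?F" for c x
    proof -
      obtain v where "v \<in> ?V" "x = phi v + v" using x by blast
      then have "scale c x = phi (scale c v) + scale c v" "scale c v \<in> ?V"
        using subspace_scale[OF sub] by (auto simp: phi_scale scale_right_distrib)
      then show ?thesis by blast
    qed
  qed
  have G: "subspace ?G" by (simp add: gen_space_def)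
  have E_C: "?E \<subseteq> C i j" using f'_mem f_mem i j R_right R_L_mult by auto
  have F_C: "?F \<subseteq> C i j" using corner_part_decomposition(1)[OF i j] by (auto simp: set_plus_def)
  have G_C: "?G \<subseteq> C i j" using gen_space_subset_cell[OF i j] by (auto simp: cell_def)
  have sub: "x \<in> ?E + ?F + ?G" if x: "x \<in> C i j" for x
  proof -
    \<comment> \<open>With these choices \<open>phi v + v = a - a f\<^sub>j\<close> and
      \<open>phi w + w = c - f'\<^sub>i c\<close>. Taking these and
      \<open>f'\<^sub>i x f\<^sub>j\<close> away from \<open>x\<close> leaves \<open>z\<close>,
      formally \<open>(1 - f'\<^sub>i) x (1 - f\<^sub>j)\<close>.\<close>
    define a c where "a = f' i * x" and "c = x * f j"
    define v w where "v = a - a * u" and "w = c - u * c"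
    define z where "z = x - a - c + f' i * x * f j"
    have v: "v \<in> left.left_part i j" "phi v = a * u - a * f j"
      using phi_left_generator[OF i j x] by (simp_all add: v_def a_def)
    have w: "w \<in> right.left_part j i" "phi w = u * c - f' i * c"
      using phi_right_generator[OF i j x] by (simp_all add: w_def c_def)
    have "z \<in> C i j"
      unfolding z_def a_def c_def using x f'_mem f_mem i j C_subspace[OF i j] C_in_L[OF i j x] C_in_R[OF i j x]
      by (intro subspace_add subspace_diff) (auto intro: R_L_mult R_right)
    then have z: "z \<in> cell i j"
      using i j by (simp add: cell_def z_def a_def c_def distrib_left distrib_right left_diff_distrib
          right_diff_distrib mult.assoc left.f_orth left.f'_f'_assoc)
    obtain z' where z': "z' \<in> gen_space i j" "outer z' = outer z"
      using outer_gen_space[OF i j outer_C[OF i j \<open>z \<in> C i j\<close>]] by blast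
    \<comment> \<open>Both lie in the cell and have the same outer part, which determines an element
      of the cell.\<close>
    have "z - z' = 0"
    proof (rule cell_eq_0[OF i j])
      show "z - z' \<in> cell i j"
        using z z'(1) gen_space_subset_cell[OF i j] by (intro subspace_diff cell_subspace i j) auto
    qed (simp add: outer_diff z')
    then have zG: "z \<in> ?G" using z' by simp
    have "f' i * x * f j = f' i * (u * x * u) * f j"
      using i j by (simp add: mult.assoc left.u_f left.f'_u_assoc)
    then have "f' i * x * f j \<in> ?E" using u_mult_u_B by blast
    moreover have "phi (v + w) + (v + w) \<in> ?F" using v w by (auto intro: set_plus_intro)
    ultimately have "f' i * x * f j + (phi (v + w) + (v + w)) + z \<in> ?E + ?F + ?G"
      using zG by (intro set_plus_intro)
    also have "f' i * x * f j + (phi (v + w) + (v + w)) + z = x"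
      unfolding phi_add v(2) w(2) by (simp add: z_def v_def w_def a_def c_def mult.assoc)
    finally show ?thesis .
  qed
  have "?E + ?F + ?G \<subseteq> C i j"
    by (intro set_plus_subset C_subspace i j E_C F_C G_C)
  from equalityI[OF subsetI this] sub have C: "C i j = ?E + ?F + ?G" by simp
  have "x = 0 \<and> y = 0 \<and> z = 0" if xyz: "x \<in> ?E" "y \<in> ?F" "z \<in> ?G" "x + y + z = 0" for x y z
  proof -
    obtain v w where vw: "v \<in> left.left_part i j" "w \<in> right.left_part j i" "y = phi (v + w) + (v + w)"
      using xyz(2) by (auto simp: set_plus_def)
    note y = corner_part_decomposition[OF i j vw(1,2), folded vw(3)]
    have x: "f' i * x = x" "x * f j = x"
      using xyz(1) i j by (auto simp: mult.assoc left.f_orth left.f'_f'_assoc)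
    have z: "f' i * z = 0" "z * f j = 0"
      using xyz(3) gen_space_subset_cell[OF i j] by (auto simp: cell_def)
    \<comment> \<open>Multiplying the relation by \<open>f' i\<close> or by \<open>f j\<close>
      removes all but two terms; multiplying by both leaves \<open>x\<close> alone.\<close>
    have l: "x + (phi v + v) = 0"
      using arg_cong[OF xyz(4), of "\<lambda>t. f' i * t"] x y z by (simp add: distrib_left)
    have r: "x + (phi w + w) = 0"
      using arg_cong[OF xyz(4), of "\<lambda>t. t * f j"] x y z by (simp add: distrib_right)
    have x0: "x = 0"
      using arg_cong[OF l, of "\<lambda>t. t * f j"] x y(5) by (simp add: distrib_right)
    have "y = (phi v + v) + (phi w + w)" by (simp add: vw phi_add)
    with l r x0 have "y = 0" by simp
    with x0 xyz(4) show ?thesis by simp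
  qed
  with E F G C show ?thesis unfolding is_direct_sum_list3_iff by blast
qed

lemma parts_direct:
  assumes "i \<in> I" "j \<in> K"
  shows "is_direct_sum_list scale [left.left_part i j, right.left_part j i]
    (left.left_part i j + right.left_part j i)"
proof -
  have "v = 0 \<and> w = 0" if "v \<in> left.left_part i j" "w \<in> right.left_part j i" "v + w = 0" for v w
  proof -
    have "u * v = v" "u * w = 0"
      using that assms left.left_part_eq right.left_part_eq J10_D[of j v] J01_D[of i w] by auto
    then have "v = 0" using arg_cong[OF that(3), of "\<lambda>t. u * t"] by (simp add: distrib_left)
    with that show ?thesis by simp
  qed
  then show ?thesis
    unfolding is_direct_sum_list2_iff using left.subspace_left_part right.subspace_left_part assms by blast
qed

text \<open>Both sums are images of the single element \<open>z\<close> of the cell, under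
  \<open>outer\<close> and under \<open>z \<mapsto> u z u\<close>, and each of these maps is
  injective on the cell.\<close>

lemma sum_mult_eq_0_iff:
  assumes "i \<in> I" "j \<in> K" "\<forall>l\<in>T. v l \<in> J01 i \<and> w l \<in> J10 j"
  shows "(\<Sum>l\<in>T. v l * w l) = 0 \<longleftrightarrow> (\<Sum>l\<in>T. phi (v l) * phi (w l)) = 0"
proof -
  define z where "z = (\<Sum>l\<in>T. gen (v l) (w l))"
  have z: "z \<in> cell i j"
    unfolding z_def using assms gen_cell by (intro subspace_sum cell_subspace) auto
  have outer: "outer z = (\<Sum>l\<in>T. v l * w l)"
    unfolding z_def outer_sum using assms gen_cell(2) by (intro sum.cong) auto
  have "u * z * u = (\<Sum>l\<in>T. u * gen (v l) (w l) * u)"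
    by (simp only: z_def sum_distrib_left sum_distrib_right)
  also have "\<dots> = (\<Sum>l\<in>T. phi (v l) * phi (w l))" using assms gen_cell(3) by (intro sum.cong) auto
  finally have inner: "u * z * u = (\<Sum>l\<in>T. phi (v l) * phi (w l))" .
  have "z = 0" if "outer z = 0" using cell_eq_0 assms z that by blast
  moreover have "z = 0" if "u * z * u = 0"
  proof (rule J_homogeneous[OF assms(1,2)])
    have "z = (z - u * z) + u * (z - z * u)" using that by (simp add: right_diff_distrib mult.assoc)
    also have "\<dots> \<in> J" using diff_mult_u_J diff_u_mult_J J_left by (intro subspace_add[OF J_subspace]) auto
    finally show "z \<in> J" .
  qed (use z in \<open>simp add: cell_def\<close>)
  ultimately show ?thesis using outer inner by (auto simp: outer_def)
qed

text \<open>The summands are not homogeneous, so independence is not inherited from the grading.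
  Each \<open>p i j\<close> is lifted to an element of a cell with that outer part; the lifts are
  homogeneous, and comparing components of the outer part of their sum shows that they
  vanish.\<close>

lemma JJ_parts_direct: "is_direct_sum scale (I \<times> K) (\<lambda>(i, j). JJ_part i j) JJ"
proof -
  have part_JJ: "JJ_part i j \<subseteq> JJ" if "i \<in> I" "j \<in> K" for i j
    unfolding subspace_prod_def
    using that J01_X01 J10_X10 X01_subset_J X10_subset_J by (intro span_mono) blast
  have sub: "subspace (\<Sum>t\<in>I \<times> K. case t of (i, j) \<Rightarrow> JJ_part i j)"
    using finite_I finite_K by (intro subspace_set_sum) (auto simp: subspace_prod_def)
  have "x * y \<in> (\<Sum>t\<in>I \<times> K. case t of (i, j) \<Rightarrow> JJ_part i j)" if "x \<in> J" "y \<in> J" for x y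
  proof -
    have "x * u \<in> X01" "u * y \<in> X10"
      using mult_J_mult[OF that(1), of u u] mult_J_mult[OF that(2), of u u]
      by (simp_all add: X10_iff X01_iff mult.assoc left.u_u left.u_u_assoc)
    then obtain v w where v: "\<forall>i\<in>I. v i \<in> J01 i" "x * u = sum v I"
      and w: "\<forall>j\<in>K. w j \<in> J10 j" "u * y = sum w K"
      using is_direct_sum_mem_iff[OF left.direct_left_corners]
        is_direct_sum_mem_iff[OF right.direct_left_corners] by meson
    have "x * y = (x * u) * (u * y)" using mult_u_mult[of x y] left.u_u_assoc by (simp add: mult.assoc)
    also have "\<dots> = (\<Sum>(i, j)\<in>I \<times> K. v i * w j)" by (simp add: v w sum_product sum.cartesian_product)
    also have "\<dots> \<in> (\<Sum>t\<in>I \<times> K. case t of (i, j) \<Rightarrow> JJ_part i j)"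
    proof (intro subspace_sum[OF sub])
      fix t assume "t \<in> I \<times> K"
      moreover from this have "(case t of (i, j) \<Rightarrow> v i * w j) \<in> (case t of (i, j) \<Rightarrow> JJ_part i j)"
        using v w by (auto simp: subspace_prod_def intro!: span_base)
      ultimately show "(case t of (i, j) \<Rightarrow> v i * w j) \<in> (\<Sum>t\<in>I \<times> K. case t of (i, j) \<Rightarrow> JJ_part i j)"
        using finite_I finite_K by (intro set_sum_mem[of _ t]) (auto simp: subspace_prod_def)
    qed
    finally show ?thesis .
  qed
  then have "JJ \<subseteq> (\<Sum>t\<in>I \<times> K. case t of (i, j) \<Rightarrow> JJ_part i j)"
    unfolding JJ_def by (intro span_minimal sub) blast
  moreover have "(\<Sum>t\<in>I \<times> K. case t of (i, j) \<Rightarrow> JJ_part i j) \<subseteq> JJ"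
    using finite_I finite_K part_JJ by (intro set_sum_subset) (auto simp: JJ_def)
  ultimately have JJ: "JJ = (\<Sum>t\<in>I \<times> K. case t of (i, j) \<Rightarrow> JJ_part i j)" by blast
  have "p i j = 0"
    if p: "\<And>i j. i \<in> I \<Longrightarrow> j \<in> K \<Longrightarrow> p i j \<in> JJ_part i j" and 0: "(\<Sum>i\<in>I. \<Sum>j\<in>K. p i j) = 0"
      and i: "i \<in> I" and j: "j \<in> K" for p i j
  proof -
    have "\<exists>z\<in>gen_space i j. outer z = p i j" if "i \<in> I" "j \<in> K" for i j
      using outer_gen_space p that by blast
    then have "\<forall>i j. \<exists>z. i \<in> I \<longrightarrow> j \<in> K \<longrightarrow> z \<in> cell i j \<and> outer z = p i j"
      using gen_space_subset_cell by blast
    then obtain z where z: "\<And>i j. i \<in> I \<Longrightarrow> j \<in> K \<Longrightarrow> z i j \<in> cell i j"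
      and pz: "\<And>i j. i \<in> I \<Longrightarrow> j \<in> K \<Longrightarrow> outer (z i j) = p i j" by metis
    have zC: "z i j \<in> C i j" "f' i * z i j = 0" "z i j * f j = 0" if "i \<in> I" "j \<in> K" for i j
      using z that by (auto simp: cell_def)
    define Z where "Z = (\<Sum>i\<in>I. \<Sum>j\<in>K. z i j)"
    define a c where "a = (\<Sum>k\<in>I. z k j)" and "c = (\<Sum>l\<in>K. z i l)"
    have outer: "outer Z = 0" using 0 pz by (simp add: Z_def outer_sum)
    have a: "left.coord j Z = a"
    proof -
      have "left.coord j Z = (\<Sum>k\<in>I. \<Sum>l\<in>K. if j = l then z k l else 0)"
        unfolding Z_def left.coord_sum[OF j] using zC C_in_L j
        by (intro sum.cong) (auto simp: left.coord_sum left.coord_of[of j])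
      then show ?thesis using finite_K j by (simp add: a_def)
    qed
    have c: "right.coord i Z = c"
    proof -
      have "right.coord i Z = (\<Sum>k\<in>I. \<Sum>l\<in>K. if i = k then z k l else 0)"
        unfolding Z_def right.coord_sum[OF i] using zC C_in_R i
        by (intro sum.cong) (auto simp: right.coord_sum right.coord_of[of i])
      also have "\<dots> = (\<Sum>k\<in>I. if i = k then c else 0)" by (intro sum.cong) (auto simp: c_def)
      finally show ?thesis using finite_I i by simp
    qed
    have a_i: "right.coord i a = z i j"
    proof -
      have "right.coord i a = (\<Sum>k\<in>I. if i = k then z k j else 0)"
        unfolding a_def right.coord_sum[OF i] using zC C_in_R i j
        by (intro sum.cong) (auto simp: right.coord_of[of i])
      then show ?thesis using finite_I i by simp
    qed
    \<comment> \<open>Taking the \<open>(i, j)\<close> component replaces a factor \<open>u\<close>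
      on the left by \<open>f' i\<close> and one on the right by \<open>f j\<close>.\<close>
    have "right.coord i (left.coord j (outer Z)) = z i j - f' i * a - c * f j + f' i * Z * f j"
      using i j a c a_i by (simp add: outer_def left.coord_add left.coord_diff left.coord_mult left.coord_u
          right.coord_add right.coord_diff right.coord_mult right.coord_u mult.assoc)
    moreover have "right.coord i (left.coord j 0) = 0"
      using i j by (simp add: left.coord_0 right.coord_0)
    ultimately have eq: "z i j = f' i * a + c * f j - f' i * Z * f j" using outer by (simp add: algebra_simps)
    have af: "a * f j = 0" and fc: "f' i * c = 0"
      using zC i j by (simp_all add: a_def c_def sum_distrib_left sum_distrib_right)
    \<comment> \<open>Multiplying \<open>eq\<close> by \<open>f' i\<close>, and below by
      \<open>f j\<close>, shows that all terms on its right hand side agree up to sign. Hence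
      \<open>z i j\<close> equals \<open>f' i * Z * f j\<close>, is fixed by \<open>f j\<close> on
      the right, and is also killed by it.\<close>
    have "f' i * a = f' i * Z * f j"
      using arg_cong[OF eq, of "\<lambda>t. f' i * t"] zC(2) i j fc
      by (simp add: distrib_left right_diff_distrib left.f'_f'_assoc mult.assoc)
        (simp add: mult.assoc[symmetric] fc)
    moreover have "c * f j = f' i * Z * f j"
      using arg_cong[OF eq, of "\<lambda>t. t * f j"] zC(3) i j af
      by (simp add: distrib_right left_diff_distrib mult.assoc left.f_orth)
    ultimately have "z i j = f' i * a" using eq by simp
    moreover have "z i j * f j = 0" using zC i j by simp
    moreover have "f' i * a = f' i * a * f j"
      using \<open>f' i * a = f' i * Z * f j\<close> j by (simp add: mult.assoc left.f_orth)
    ultimately have "z i j = 0" by simp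
    then show ?thesis using pz[OF i j] by (simp add: outer_def)
  qed
  note indep = this
  have "\<forall>t\<in>I \<times> K. p t = 0"
    if "\<forall>t\<in>I \<times> K. p t \<in> (case t of (i, j) \<Rightarrow> JJ_part i j)" "sum p (I \<times> K) = 0" for p
    using indep[of "\<lambda>i j. p (i, j)"] that by (auto simp: sum.cartesian_product)
  then show ?thesis
    unfolding is_direct_sum_def using JJ finite_I finite_K by (auto simp: subspace_prod_def)
qed

subsection \<open>Dimensions\<close>

lemma dim_X10: "dim X10 \<le> (card K - 1) * dim B"
  unfolding B_eq
  by (rule left.dim_outer_corner[OF finite_dimensional_vector_space_axioms])
    (use L_corner_J X10_subset_J in \<open>auto simp: X10_iff\<close>)

lemma dim_X01: "dim X01 \<le> (card I - 1) * dim B"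
  unfolding B_eq'
  by (rule right.dim_outer_corner[OF finite_dimensional_vector_space_axioms])
    (use R_corner_J X01_subset_J in \<open>auto simp: X01_iff\<close>)

text \<open>If \<open>u x u = 0\<close>, then \<open>x = (x - u x) + u (x - x u)\<close> lies in
  \<open>J\<close>, so each \<open>A\<^sub>i\<^sub>j\<close> embeds in \<open>B\<close>. The
  \<open>- 1\<close> is the summand \<open>B\<close> of \<open>A = B \<oplus> J\<close>.\<close>

lemma dim_J: "dim J \<le> (card I * card K - 1) * dim B"
proof -
  have "dim (C i j) \<le> dim B" if "i \<in> I" "j \<in> K" for i j
  proof (rule dim_le_inj[where g = "\<lambda>x. u * x * u"])
    fix x assume x: "x \<in> C i j" "u * x * u = 0"
    have "x = (x - u * x) + u * (x - x * u)" using x by (simp add: right_diff_distrib mult.assoc)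
    also have "\<dots> \<in> J" using diff_mult_u_J diff_u_mult_J J_left by (intro subspace_add[OF J_subspace]) auto
    finally show "x = 0" using J_homogeneous[OF that x(1)] by blast
  qed (auto simp: that C_subspace u_mult_u_B distrib_left distrib_right scale_mult_left scale_mult_right)
  then have "(\<Sum>t\<in>I \<times> K. dim (case t of (i, j) \<Rightarrow> C i j)) \<le> (\<Sum>t\<in>I \<times> K. dim B)"
    by (intro sum_mono) auto
  then have "dim UNIV \<le> card I * card K * dim B"
    using dim_direct_sum[OF C_direct] by (simp add: card_cartesian_product)
  moreover have "dim UNIV = dim B + dim J"
    using dim_set_plus[OF B_subspace J_subspace] B_J B_J_inter
    unfolding is_direct_sum_list2_iff by (metis IntE singletonI subsetI)
  ultimately show ?thesis by (simp add: diff_mult_distrib)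
qed

end

context graded_wedderburn
begin

subsection \<open>The universal property of \<open>\<phi>\<close> and simplicity of \<open>B\<close>\<close>

lemma left_submodule_J10: "j \<in> K \<Longrightarrow> left_submodule scale B (J10 j) J"
  unfolding left_submodule_def
  using left.subspace_left_corner J10_X10 X10_subset_J left.left_corner_mult u_left u_right by blast

lemma right_submodule_J01: "i \<in> I \<Longrightarrow> right_submodule scale B (J01 i) J"
  unfolding right_submodule_def
  using right.subspace_left_corner J01_X01 X01_subset_J right.left_corner_mult u_left u_right by blast

lemma X_subspace: "subspace (X01 + X10)"
  by (intro subspace_set_plus left.subspace_outer_corner right.subspace_outer_corner)

lemma phi_linear: "linear_map_on scale (X01 + X10) B phi"
proof -
  have "phi v \<in> B" if "v \<in> X01 + X10" for v
    using that phi_X01_B phi_X10_B subspace_add[OF B_subspace]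
    by (elim set_plus_elim) (simp add: phi_add)
  then show ?thesis by (simp add: linear_map_on_def phi_add phi_scale)
qed

lemma phi_generator:
  assumes ij: "i \<in> I" "j \<in> K" and a: "a \<in> {f' i * x | x. x \<in> C i j} + {x * f j | x. x \<in> C i j}"
  shows "a - u * a * u \<in> X01 + X10" "phi (a - u * a * u) = u * a * u - f' i * a * f j"
proof -
  obtain x y where xy: "x \<in> C i j" "y \<in> C i j" "a = f' i * x + y * f j"
    using a by (elim set_plus_elim) blast
  note x = phi_left_generator[OF ij xy(1)] and y = phi_right_generator[OF ij xy(2)]
  have eq: "a - u * a * u = (y * f j - u * (y * f j)) + (f' i * x - f' i * x * u)"
    using ij by (simp add: xy distrib_left distrib_right mult.assoc left.u_f'_assoc left.f_u)
  have "y * f j - u * (y * f j) \<in> X01" "f' i * x - f' i * x * u \<in> X10"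
    using x(1) y(1) ij left.left_part_eq right.left_part_eq J10_X10 J01_X01 by auto
  then show "a - u * a * u \<in> X01 + X10" unfolding eq by (rule set_plus_intro)
  show "phi (a - u * a * u) = u * a * u - f' i * a * f j"
    unfolding eq phi_add x(2) y(2) using ij
    by (simp add: xy distrib_left distrib_right mult.assoc left.u_f'_assoc left.f_u
        left.f_orth left.f'_f'_assoc)
qed

text \<open>The arguments \<open>a - u a u\<close> of the formula span the domain, because each left
  and right part consists of such elements with \<open>a = f' i * x = x\<close> or
  \<open>a = x * f j = x\<close>.\<close>

lemma phi_unique:
  assumes lin: "linear_map_on scale (X01 + X10) B \<phi>'"
    and gen: "\<And>i j a. i \<in> I \<Longrightarrow> j \<in> K \<Longrightarrow> a \<in> {f' i * x | x. x \<in> C i j} + {x * f j | x. x \<in> C i j} \<Longrightarrow>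
      \<phi>' (a - u * a * u) = u * a * u - f' i * a * f j"
    and v: "v \<in> X01 + X10"
  shows "\<phi>' v = phi v"
proof -
  let ?U = "{v \<in> X01 + X10. \<phi>' v = phi v}"
  have add: "\<phi>' (x + y) = \<phi>' x + \<phi>' y" and sc: "\<phi>' (scale c x) = scale c (\<phi>' x)"
    if "x \<in> X01 + X10" "y \<in> X01 + X10" for x y c
    using lin that by (auto simp: linear_map_on_def)
  have U: "subspace ?U"
  proof (rule subspaceI)
    have "0 \<in> X01 + X10" by (rule subspace_0[OF X_subspace])
    moreover from add[OF this this] have "\<phi>' 0 = 0" by simp
    ultimately show "0 \<in> ?U" by simp
  qed (use add sc X_subspace in \<open>auto simp: phi_add phi_scale intro: subspace_add subspace_scale\<close>)
  have agree: "a - u * a * u \<in> ?U"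
    if ij: "i \<in> I" "j \<in> K" and a: "a \<in> {f' i * x | x. x \<in> C i j} + {x * f j | x. x \<in> C i j}" for i j a
    using phi_generator[OF ij a] gen[OF ij a] by simp
  have "left.left_part i j \<subseteq> ?U" if ij: "i \<in> I" "j \<in> K" for i j
  proof
    fix v assume "v \<in> left.left_part i j"
    then obtain x where x: "x \<in> C i j" "f' i * x = x" "v = x - x * u"
      using left_part_generator[OF ij] by blast
    have "f' i * x + 0 * f j \<in> {f' i * x | x. x \<in> C i j} + {x * f j | x. x \<in> C i j}"
      using x subspace_0[OF C_subspace[OF ij]] by (intro set_plus_intro) blast+
    then have "x - u * x * u \<in> ?U" using agree[OF ij] x by simp
    moreover have "u * x = x" using x left.u_f'_assoc[OF ij(1), of x] by simp
    ultimately show "v \<in> ?U" using x by simp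
  qed
  then have "(\<Sum>i\<in>I. left.left_part i j) \<subseteq> ?U" if "j \<in> K" for j
    using that by (intro set_sum_subset finite_I U)
  then have "J10 j \<subseteq> ?U" if "j \<in> K" for j
    using left.direct_left_parts[OF that] that by (simp add: is_direct_sum_def)
  then have "(\<Sum>j\<in>K. J10 j) \<subseteq> ?U" by (intro set_sum_subset finite_K U)
  then have X10: "X10 \<subseteq> ?U" using left.direct_left_corners by (simp add: is_direct_sum_def)
  have "right.left_part j i \<subseteq> ?U" if ij: "i \<in> I" "j \<in> K" for i j
  proof
    fix v assume "v \<in> right.left_part j i"
    then obtain x where x: "x \<in> C i j" "x * f j = x" "v = x - u * x"
      using right_part_generator[OF ij] by blast
    have "f' i * 0 + x * f j \<in> {f' i * x | x. x \<in> C i j} + {x * f j | x. x \<in> C i j}"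
      using x subspace_0[OF C_subspace[OF ij]] by (intro set_plus_intro) blast+
    then have "x - u * x * u \<in> ?U" using agree[OF ij] x by simp
    moreover have "x * u = x" using x right.u_f'_assoc[OF ij(2), of x] by simp
    ultimately show "v \<in> ?U" using x by (simp add: mult.assoc)
  qed
  then have "(\<Sum>j\<in>K. right.left_part j i) \<subseteq> ?U" if "i \<in> I" for i
    using that by (intro set_sum_subset finite_K U)
  then have "J01 i \<subseteq> ?U" if "i \<in> I" for i
    using right.direct_left_parts[OF that] that by (simp add: is_direct_sum_def)
  then have "(\<Sum>i\<in>I. J01 i) \<subseteq> ?U" by (intro set_sum_subset finite_I U)
  then have X01: "X01 \<subseteq> ?U" using right.direct_left_corners by (simp add: is_direct_sum_def)
  have "X01 + X10 \<subseteq> ?U" using U X01 X10 by (rule set_plus_subset)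
  with v show ?thesis by blast
qed

lemma phi_J10_kernel:
  assumes j: "j \<in> K"
  shows "J10 j \<inter> {v \<in> X01 + X10. phi v = 0} = {0}" "phi ` J10 j \<inter> {b * f j | b. b \<in> B} = {0}"
    "{x * f j | x. x \<in> phi ` J10 j} = {0}"
proof -
  have 0: "0 \<in> J10 j" "0 \<in> X01 + X10"
    using subspace_0 left.subspace_left_corner[OF j] X_subspace by blast+
  show "J10 j \<inter> {v \<in> X01 + X10. phi v = 0} = {0}" using 0 phi_J10_inj[OF j] by auto
  have "0 = phi 0" "0 = 0 * f j" by simp_all
  then have img: "0 \<in> phi ` J10 j" "0 \<in> {b * f j | b. b \<in> B}"
    using 0 subspace_0[OF B_subspace] by blast+
  have "x = 0" if "x \<in> phi ` J10 j" "x \<in> {b * f j | b. b \<in> B}" for x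
  proof -
    have "x * f j = x" using that(2) j by (auto simp: mult.assoc left.f_orth)
    moreover have "x * f j = 0" using that(1) phi_J10_f[OF j] by auto
    ultimately show ?thesis by simp
  qed
  with img show "phi ` J10 j \<inter> {b * f j | b. b \<in> B} = {0}" by blast
  show "{x * f j | x. x \<in> phi ` J10 j} = {0}"
    using img(1) phi_J10_f[OF j] by force
qed

lemma phi_J01_kernel:
  assumes i: "i \<in> I"
  shows "J01 i \<inter> {v \<in> X01 + X10. phi v = 0} = {0}" "phi ` J01 i \<inter> {f' i * b | b. b \<in> B} = {0}"
    "{f' i * x | x. x \<in> phi ` J01 i} = {0}"
proof -
  have 0: "0 \<in> J01 i" "0 \<in> X01 + X10"
    using subspace_0 right.subspace_left_corner[OF i] X_subspace by blast+
  show "J01 i \<inter> {v \<in> X01 + X10. phi v = 0} = {0}" using 0 phi_J01_inj[OF i] by auto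
  have "0 = phi 0" "0 = f' i * 0" by simp_all
  then have img: "0 \<in> phi ` J01 i" "0 \<in> {f' i * b | b. b \<in> B}"
    using 0 subspace_0[OF B_subspace] by blast+
  have "x = 0" if "x \<in> phi ` J01 i" "x \<in> {f' i * b | b. b \<in> B}" for x
  proof -
    have "f' i * x = x" using that(2) i by (auto simp: left.f'_f'_assoc)
    moreover have "f' i * x = 0" using that(1) phi_J01_f'[OF i] by auto
    ultimately show ?thesis by simp
  qed
  with img show "phi ` J01 i \<inter> {f' i * b | b. b \<in> B} = {0}" by blast
  show "{f' i * x | x. x \<in> phi ` J01 i} = {0}"
    using img(1) phi_J01_f'[OF i] by force
qed

text \<open>Some \<open>h = f'\<^sub>i x f\<^sub>j\<close> is nonzero, and it is homogeneous, so
  \<open>u \<in> A h A\<close>. Multiplying by \<open>u\<close> on both sides turns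
  \<open>a h b\<close> into \<open>(u a u f'\<^sub>i) x (f\<^sub>j u b u)\<close>, with coefficients
  in \<open>B\<close>.\<close>

lemma B_simple:
  assumes gen: "\<And>i j h. i \<in> I \<Longrightarrow> j \<in> K \<Longrightarrow> h \<in> C i j \<Longrightarrow> h \<noteq> 0 \<Longrightarrow> span {a * h * b | a b. True} = UNIV"
    and x: "x \<in> B" "x \<noteq> 0"
  shows "u \<in> span {a * x * b | a b. a \<in> B \<and> b \<in> B}" (is "_ \<in> span ?G")
proof -
  have "(\<Sum>i\<in>I. f' i) * x * (\<Sum>j\<in>K. f j) = (\<Sum>i\<in>I. \<Sum>j\<in>K. f' i * x * f j)"
    unfolding sum_distrib_right[of _ I x] sum_product ..
  then have "(\<Sum>i\<in>I. \<Sum>j\<in>K. f' i * x * f j) = u * x * u" by (simp add: f_sum f'_sum)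
  then have "(\<Sum>i\<in>I. \<Sum>j\<in>K. f' i * x * f j) \<noteq> 0" using x u_left u_right by simp
  then obtain i where i: "i \<in> I" "(\<Sum>j\<in>K. f' i * x * f j) \<noteq> 0" by (rule sum.not_neutral_contains_not_neutral)
  from i(2) obtain j where j: "j \<in> K" "f' i * x * f j \<noteq> 0" by (rule sum.not_neutral_contains_not_neutral)
  define h where "h = f' i * x * f j"
  have "h \<in> C i j" using i j f'_mem f_mem R_right R_L_mult by (simp add: h_def)
  then have "u \<in> span {a * h * b | a b. True}" using gen[OF i(1) j(1)] j(2) by (simp add: h_def)
  then have "u * u \<in> span ?G"
  proof (rule span_induct[where P = "\<lambda>y. u * y * u \<in> span ?G", THEN rev_mp])
    show "subspace {y. u * y * u \<in> span ?G}"
      using subspace_mult_left[OF subspace_mult_right[OF subspace_span[of ?G], of u], of u] by simp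
    show "u * y * u \<in> span ?G" if "y \<in> {a * h * b | a b. True}" for y
    proof -
      from that obtain a b where y: "y = a * h * b" by blast
      have "u * y * u = (u * a * u * f' i) * x * (f j * (u * b * u))"
        using i j by (simp add: y h_def mult.assoc left.u_f'_assoc left.u_f left.f_u mult_assoc_eq[OF left.f_u[OF j(1)]])
      moreover have "u * a * u * f' i \<in> B" "f j * (u * b * u) \<in> B"
        using u_mult_u_B B_mult f_B f'_B i j by blast+
      ultimately show ?thesis by (intro span_base) blast
    qed
  qed (simp add: left.u_u)
  then show ?thesis by (simp add: left.u_u)
qed

lemma B_subalg: "subalg scale B"
  by (simp add: subalg_def B_subspace B_mult)

end

section \<open>Graded-simple algebras\<close>

text \<open>Taking a component sends each generator to itself or to \<open>0\<close>, so the span is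
  stable under all component maps.\<close>

lemma (in assoc_algebra) homogeneous_subspace_span:
  assumes direct: "is_direct_sum scale S A UNIV" and G: "G \<subseteq> (\<Union>s\<in>S. A s)"
  shows "homogeneous_subspace scale S A (span G)"
proof -
  have comp: "component S A s x \<in> span G" if s: "s \<in> S" and x: "x \<in> span G" for s x
    using x
  proof (rule span_induct[where P = "\<lambda>x. component S A s x \<in> span G"])
    show "subspace {x. component S A s x \<in> span G}"
      by (rule subspaceI)
        (auto simp: component_0[OF direct s] component_add[OF direct s] component_scale[OF direct s]
          span_zero intro: span_add span_scale)
    show "component S A s g \<in> span G" if "g \<in> G" for g
    proof -
      obtain t where "t \<in> S" "g \<in> A t" using G \<open>g \<in> G\<close> by blast
      then have "component S A s g = (if s = t then g else 0)" using component_of[OF direct s] by simp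
      then show ?thesis using \<open>g \<in> G\<close> by (simp add: span_base span_zero)
    qed
  qed
  have "is_direct_sum scale S (\<lambda>s. span G \<inter> A s) (span G)"
  proof (rule is_direct_sumI)
    show "finite S" using direct by (rule is_direct_sum_finite)
    show "subspace (span G \<inter> A s)" if "s \<in> S" for s
      using is_direct_sum_subspace[OF direct that] by (intro subspace_inter) simp_all
    show "\<exists>c. (\<forall>s\<in>S. c s \<in> span G \<inter> A s) \<and> x = sum c S" if "x \<in> span G" for x
      using comp that component_mem[OF direct] sum_component[OF direct, of x]
      by (intro exI[of _ "\<lambda>s. component S A s x"]) simp
    show "sum c S \<in> span G" if "\<forall>s\<in>S. c s \<in> span G \<inter> A s" for c
      using that by (intro span_sum) blast
    show "c s = 0" if "\<forall>s\<in>S. c s \<in> span G \<inter> A s" "sum c S = 0" "s \<in> S" for c s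
      using is_direct_sum_eq_0[OF direct, of c] that by blast
  qed
  then show ?thesis by (simp add: homogeneous_subspace_def)
qed

locale graded_simple_algebra = assoc_algebra scale
  for scale :: "'f::field \<Rightarrow> 'a::ring \<Rightarrow> 'a" +
  fixes S :: "'s set" and mul :: "'s \<Rightarrow> 's \<Rightarrow> 's" and A :: "'s \<Rightarrow> 'a set"
  assumes mul_closed: "s \<in> S \<Longrightarrow> t \<in> S \<Longrightarrow> mul s t \<in> S"
    and grading: "semigroup_grading scale S mul A"
    and simple: "graded_simple scale S A"
begin

abbreviation "homog \<equiv> \<Union>s\<in>S. A s"

lemma direct: "is_direct_sum scale S A UNIV"
  using grading by (simp add: semigroup_grading_def)

lemma hom_mult: "x \<in> homog \<Longrightarrow> y \<in> homog \<Longrightarrow> x * y \<in> homog"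
  using grading mul_closed by (fastforce simp: semigroup_grading_def)

lemma hom_span: "x \<in> span homog"
proof -
  have "(\<Sum>s\<in>S. component S A s x) \<in> span homog"
    using component_mem[OF direct] by (intro span_sum span_base) blast
  then show ?thesis by (simp add: sum_component[OF direct])
qed

lemma hom_induct:
  assumes "subspace (Collect P)" "\<And>x. x \<in> homog \<Longrightarrow> P x"
  shows "P x"
  using hom_span by (rule span_induct) (use assms in auto)

text \<open>The form in which graded simplicity is used: by bilinearity the ideal property needs
  checking only for homogeneous multipliers and generators.\<close>

lemma span_hom_ideal:
  assumes homog: "G \<subseteq> homog"
    and left: "\<And>a g. a \<in> homog \<Longrightarrow> g \<in> G \<Longrightarrow> a * g \<in> span G"
    and right: "\<And>a g. a \<in> homog \<Longrightarrow> g \<in> G \<Longrightarrow> g * a \<in> span G"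
  shows "span G = {0} \<or> span G = UNIV"
proof -
  have "a * x \<in> span G" if "x \<in> span G" for a x
  proof (rule span_mult_closed_left[OF _ that])
    fix g assume "g \<in> G"
    show "a * g \<in> span G"
    proof (rule hom_induct[where P = "\<lambda>a. a * g \<in> span G"])
      show "subspace {a. a * g \<in> span G}" by (intro subspace_mult_right) simp
    qed (rule left[OF _ \<open>g \<in> G\<close>])
  qed
  moreover have "x * a \<in> span G" if "x \<in> span G" for a x
  proof (rule span_mult_closed_right[OF _ that])
    fix g assume "g \<in> G"
    show "g * a \<in> span G"
    proof (rule hom_induct[where P = "\<lambda>a. g * a \<in> span G"])
      show "subspace {a. g * a \<in> span G}" by (intro subspace_mult_left) simp
    qed (rule right[OF _ \<open>g \<in> G\<close>])
  qed
  ultimately have "two_sided_ideal scale (span G)" by (simp add: two_sided_ideal_def)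
  moreover have "homogeneous_subspace scale S A (span G)"
    using direct homog by (rule homogeneous_subspace_span)
  ultimately show ?thesis using simple by (auto simp: graded_simple_def)
qed

lemma ex_product_ne_0: "\<exists>x y :: 'a. x * y \<noteq> 0"
proof (rule ccontr)
  assume "\<not> ?thesis"
  then have "{x * y | x y :: 'a. x \<in> UNIV \<and> y \<in> UNIV} = {0}" by auto
  then have "subspace_prod scale (UNIV :: 'a set) UNIV = {0}" by (simp add: subspace_prod_def)
  with simple show False by (simp add: graded_simple_def)
qed

lemma mult_hom_span:
  fixes x y :: 'a
  shows "x * y \<in> span {x * y | x y. x \<in> homog \<and> y \<in> homog}" (is "_ \<in> span ?G")
proof (rule hom_induct[where P = "\<lambda>x. x * y \<in> span ?G"])
  show "subspace {x. x * y \<in> span ?G}" by (intro subspace_mult_right) simp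
  show "x * y \<in> span ?G" if "x \<in> homog" for x
  proof (rule hom_induct[where P = "\<lambda>y. x * y \<in> span ?G"])
    show "subspace {y. x * y \<in> span ?G}" by (intro subspace_mult_left) simp
    show "x * y \<in> span ?G" if "y \<in> homog" for y
      using \<open>x \<in> homog\<close> that by (intro span_base) blast
  qed
qed

text \<open>The square of the algebra is a graded ideal, nonzero by the definition of graded
  simplicity.\<close>

lemma products_span: "span {x * y | x y :: 'a. True} = UNIV"
proof -
  let ?G = "{x * y | x y. x \<in> homog \<and> y \<in> homog}"
  have "span ?G = {0} \<or> span ?G = UNIV"
  proof (rule span_hom_ideal)
    show "?G \<subseteq> homog" using hom_mult by blast
    show "a * g \<in> span ?G" "g * a \<in> span ?G" for a g by (rule mult_hom_span)+
  qed
  moreover have "span ?G \<noteq> {0}" using ex_product_ne_0 mult_hom_span by fastforce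
  ultimately have "span ?G = UNIV" by blast
  moreover have "span ?G \<subseteq> span {x * y | x y :: 'a. True}" by (intro span_mono) blast
  ultimately show ?thesis by blast
qed

text \<open>
  The homogeneous elements \<open>h\<close> with \<open>A h A = 0\<close> span a graded ideal, which is not \<open>A\<close> because
  \<open>A\<^sup>3 = A\<close>.
\<close>

lemma ex_hom_product_ne_0:
  assumes "h \<in> homog" "h \<noteq> 0"
  shows "\<exists>a b. a * h * b \<noteq> 0"
proof (rule ccontr)
  assume no: "\<not> ?thesis"
  let ?H = "{h \<in> homog. \<forall>a b. a * h * b = 0}"
  have "span ?H = {0} \<or> span ?H = UNIV"
  proof (rule span_hom_ideal)
    fix a g assume a: "a \<in> homog" and g: "g \<in> ?H"
    have "c * (a * g) * d = 0" "c * (g * a) * d = 0" for c d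
    proof -
      have "(c * a) * g * d = 0" "c * g * (a * d) = 0" using g by simp_all
      then show "c * (a * g) * d = 0" "c * (g * a) * d = 0" by (simp_all add: mult.assoc)
    qed
    then show "a * g \<in> span ?H" "g * a \<in> span ?H"
      using a g hom_mult[of a g] hom_mult[of g a] by (auto intro!: span_base)
  qed blast
  moreover have "h \<in> span ?H" using assms no by (intro span_base) blast
  ultimately have H: "span ?H = UNIV" using assms(2) by blast
  have zero: "a * x * b = 0" for a x b :: 'a
  proof (rule span_mult_eq_0_right[of "{x * y | x y. True}"])
    show "a * x \<in> span {x * y | x y :: 'a. True}" using products_span by simp
    fix g :: 'a assume "g \<in> {x * y | x y :: 'a. True}"
    then obtain c d where g: "g = c * d" by blast
    have "d \<in> {d. c * d * b \<in> {0}}"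
    proof (rule span_subspace_induct)
      show "d \<in> span ?H" using H by simp
      show "subspace {d. c * d * b \<in> {0}}"
        using subspace_mult_left[OF subspace_mult_right[of "{0}" b], of c] by simp
    qed auto
    then show "g * b = 0" using g by simp
  qed
  \<comment> \<open>Here \<open>A\<^sup>2 = A\<close> turns \<open>A\<^sup>3 = 0\<close> into
    \<open>A\<^sup>2 = 0\<close>.\<close>
  have "x * y = 0" for x y :: 'a
    by (rule span_mult_eq_0_right[of "{x * y | x y :: 'a. True}"]) (use zero products_span in auto)
  with ex_product_ne_0 show False by blast
qed

text \<open>The ideal \<open>A h A\<close> is graded because \<open>h\<close> is homogeneous, and
  nonzero by \<open>ex_hom_product_ne_0\<close>.\<close>

lemma hom_ideal_UNIV:
  assumes h: "h \<in> homog" "h \<noteq> 0"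
  shows "span {a * h * b | a b. True} = UNIV"
proof -
  let ?G = "{a * h * b | a b. a \<in> homog \<and> b \<in> homog}"
  have mem: "a * h * b \<in> span ?G" for a b
  proof (rule hom_induct[where P = "\<lambda>a. a * h * b \<in> span ?G"])
    show "subspace {a. a * h * b \<in> span ?G}"
      using subspace_mult_right[OF subspace_span[of ?G], of "h * b"] by (simp add: mult.assoc)
    show "a * h * b \<in> span ?G" if "a \<in> homog" for a
    proof (rule hom_induct[where P = "\<lambda>b. a * h * b \<in> span ?G"])
      show "subspace {b. a * h * b \<in> span ?G}" by (intro subspace_mult_left) simp
      show "a * h * b \<in> span ?G" if "b \<in> homog" for b
        using \<open>a \<in> homog\<close> that by (intro span_base) blast
    qed
  qed
  have "span ?G = {0} \<or> span ?G = UNIV"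
  proof (rule span_hom_ideal)
    show "?G \<subseteq> homog"
    proof
      fix g assume "g \<in> ?G"
      then obtain a b where "g = a * h * b" "a \<in> homog" "b \<in> homog" by blast
      then show "g \<in> homog" using hom_mult[OF hom_mult[OF _ h(1)]] by simp
    qed
    fix c g assume "g \<in> ?G"
    then obtain a b where "g = a * h * b" by blast
    then have "c * g = (c * a) * h * b" "g * c = a * h * (b * c)" by (simp_all add: mult.assoc)
    then show "c * g \<in> span ?G" "g * c \<in> span ?G" using mem by simp_all
  qed
  moreover have "span ?G \<noteq> {0}" using ex_hom_product_ne_0[OF h] mem by fastforce
  ultimately have "span ?G = UNIV" by blast
  moreover have "span ?G \<subseteq> span {a * h * b | a b. True}" by (intro span_mono) blast
  ultimately show ?thesis by blast
qed

text \<open>The homogeneous elements of \<open>J\<close> span a graded ideal inside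
  \<open>J\<close>; as \<open>J\<close> is proper, this ideal is zero.\<close>

lemma proper_ideal_hom:
  assumes J: "two_sided_ideal scale J" "J \<noteq> UNIV" and x: "x \<in> homog" "x \<in> J"
  shows "x = 0"
proof -
  have sub: "subspace J" using J by (simp add: two_sided_ideal_def)
  have "span (homog \<inter> J) = {0} \<or> span (homog \<inter> J) = UNIV"
  proof (rule span_hom_ideal)
    fix a g assume "a \<in> homog" "g \<in> homog \<inter> J"
    then have "a * g \<in> homog" "g * a \<in> homog" "a * g \<in> J" "g * a \<in> J"
      using J(1) by (simp_all only: hom_mult Int_iff two_sided_ideal_def)
    then show "a * g \<in> span (homog \<inter> J)" "g * a \<in> span (homog \<inter> J)"
      by (simp_all only: span_base Int_iff)
  qed blast
  moreover have "span (homog \<inter> J) \<subseteq> J" using sub by (intro span_minimal) auto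
  moreover have "x \<in> span (homog \<inter> J)" using x by (intro span_base) blast
  ultimately show ?thesis using J(2) by blast
qed

end

section \<open>From gradings by the Rees semigroup to decompositions indexed by pairs\<close>

lemma (in vector_space) rees_direct_sum:
  assumes direct: "is_direct_sum scale (rees_carrier n m) A UNIV" and Theta: "A Theta = {0}"
  shows "is_direct_sum scale ({1..n} \<times> {1..m}) (\<lambda>(i, j). A (Elt i j)) UNIV"
proof -
  let ?E = "\<lambda>(i, j). Elt i j"
  have S: "rees_carrier n m = insert Theta (?E ` ({1..n} \<times> {1..m}))"
    by (auto simp: rees_carrier_def)
  have sum: "(\<Sum>s\<in>rees_carrier n m. c s) = c Theta + (\<Sum>(i, j)\<in>{1..n} \<times> {1..m}. c (Elt i j))" for c :: "rees \<Rightarrow> 'b"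
    unfolding S by (subst sum.insert) (auto simp: sum.reindex inj_on_def case_prod_beta')
  show ?thesis
  proof (rule is_direct_sumI)
    show "subspace (case t of (i, j) \<Rightarrow> A (Elt i j))" if "t \<in> {1..n} \<times> {1..m}" for t
      using that is_direct_sum_subspace[OF direct] by (auto simp: S)
    show "\<exists>c. (\<forall>t\<in>{1..n} \<times> {1..m}. c t \<in> (case t of (i, j) \<Rightarrow> A (Elt i j))) \<and>
      x = sum c ({1..n} \<times> {1..m})" for x
    proof -
      obtain c where c: "\<forall>s\<in>rees_carrier n m. c s \<in> A s" "x = sum c (rees_carrier n m)"
        using is_direct_sum_mem_iff[OF direct, of x] by auto
      then have "c Theta = 0" using Theta by (simp add: S)
      then have "x = (\<Sum>(i, j)\<in>{1..n} \<times> {1..m}. c (Elt i j))" using c(2) by (simp add: sum)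
      with c(1) show ?thesis by (intro exI[of _ "\<lambda>(i, j). c (Elt i j)"]) (auto simp: S)
    qed
    show "c t = 0" if c: "\<forall>t\<in>{1..n} \<times> {1..m}. c t \<in> (case t of (i, j) \<Rightarrow> A (Elt i j))"
      "sum c ({1..n} \<times> {1..m}) = 0" "t \<in> {1..n} \<times> {1..m}" for c t
    proof -
      \<comment> \<open>A family on pairs extends to the semigroup by \<open>0\<close> in degree
        \<open>Theta\<close>.\<close>
      let ?d = "\<lambda>s. case s of Theta \<Rightarrow> 0 | Elt i j \<Rightarrow> c (i, j)"
      have "\<forall>s\<in>rees_carrier n m. ?d s \<in> A s" using c(1) Theta by (auto simp: S)
      moreover have "sum ?d (rees_carrier n m) = 0" using c(2) by (simp add: sum)
      moreover obtain i j where t: "t = (i, j)" by (cases t)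
      moreover have "Elt i j \<in> rees_carrier n m" using c(3) t by (auto simp: S)
      ultimately have "?d (Elt i j) = 0" using is_direct_sum_eq_0[OF direct, of ?d] by blast
      then show ?thesis using t by simp
    qed
  qed auto
qed

theorem theorem4p7:
  fixes scale :: "'f::field \<Rightarrow> 'a::ring \<Rightarrow> 'a"
    and n m :: nat
    and P :: "nat \<Rightarrow> nat \<Rightarrow> bool"
    and S :: "rees set"
    and A :: "rees \<Rightarrow> 'a set"
    and f f' :: "nat \<Rightarrow> 'a"
    and B J :: "'a set" and u :: 'a
    and L R J10s J01s :: "nat \<Rightarrow> 'a set"
    and J10 J01 :: "nat \<Rightarrow> nat \<Rightarrow> 'a set"
    and X10 X01 :: "'a set"
  assumes algebra: "assoc_algebra scale"
    and finite_dim: "\<exists>E. finite_dimensional_vector_space scale E"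
    and pos: "0 < n" "0 < m"
    and S_def: "S = rees_carrier n m"
    and zero_simple: "completely_zero_simple S (rees_mult P) Theta"
    and grading: "semigroup_grading scale S (rees_mult P) A"
    and supp_gen: "S = generated_subsemigroup (rees_mult P) (grading_support S A) \<union> {Theta}"
    and Theta_comp: "A Theta = {0}"
    and simple: "graded_simple scale S A"
    and L_def: "L = (\<lambda>j. \<Sum>k\<in>{1..n}. A (Elt k j))"
    and R_def: "R = (\<lambda>i. \<Sum>k\<in>{1..m}. A (Elt i k))"
    and J_def: "J = jacobson_rad scale UNIV"
    and idem_f: "orthogonal_idempotents {1..m} f"
    and idem_f': "orthogonal_idempotents {1..n} f'"
    and B_sum: "is_direct_sum scale ({1..n} \<times> {1..m}) (\<lambda>(i, j). {f' i * a * f j | a. a \<in> UNIV}) B"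
    and B_graded: "is_direct_sum scale ({1..n} \<times> {1..m}) (\<lambda>(i, j). B \<inter> A (Elt i j)) B"
    and B_max: "maximal_semisimple_subalg scale B"
    and f'_mem: "\<forall>i\<in>{1..n}. f' i \<in> B \<inter> R i"
    and f_mem: "\<forall>j\<in>{1..m}. f j \<in> B \<inter> L j"
    and u_one: "is_identity_of B u"
    and sum_f': "(\<Sum>i\<in>{1..n}. f' i) = u"
    and sum_f: "(\<Sum>j\<in>{1..m}. f j) = u"
    and Wedderburn_Malcev: "is_direct_sum_list scale [B, J] UNIV"
    and J10_def: "J10 = (\<lambda>i j. {f' i * x - f' i * x * u | x. x \<in> L j})"
    and J01_def: "J01 = (\<lambda>i j. {x * f j - u * (x * f j) | x. x \<in> R i})"
    and J10s_def: "J10s = (\<lambda>j. \<Sum>i\<in>{1..n}. J10 i j)"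
    and J01s_def: "J01s = (\<lambda>i. \<Sum>j\<in>{1..m}. J01 i j)"
    and X10_def: "X10 = (\<Sum>j\<in>{1..m}. J10s j)"
    and X01_def: "X01 = (\<Sum>i\<in>{1..n}. J01s i)"
  shows
    "\<comment> \<open>the second descriptions of \<open>J10s\<close> and \<open>J01s\<close>\<close>
     (\<forall>j\<in>{1..m}. J10s j = {u * x - u * x * u | x. x \<in> L j}) \<and>
     (\<forall>i\<in>{1..n}. J01s i = {x * u - u * (x * u) | x. x \<in> R i}) \<and>
     \<comment> \<open>(a)\<close>
     (\<forall>j\<in>{1..m}. left_submodule scale B (J10s j) J \<and>
            is_direct_sum scale {1..n} (\<lambda>i. J10 i j) (J10s j)) \<and>
         (\<forall>i\<in>{1..n}. right_submodule scale B (J01s i) J \<and>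
            is_direct_sum scale {1..m} (\<lambda>j. J01 i j) (J01s i)) \<and>
         is_direct_sum scale {1..n} J01s X01 \<and>
         is_direct_sum scale {1..m} J10s X10 \<and>
         is_direct_sum_list scale [X01, X10, subspace_prod scale J J] J \<and>
         is_direct_sum scale ({1..n} \<times> {1..m}) (\<lambda>(i, j). subspace_prod scale (J01s i) (J10s j))
           (subspace_prod scale J J) \<and>
     \<comment> \<open>(b), (c), (d)\<close>
     (\<exists>\<phi>.
         linear_map_on scale (X01 + X10) B \<phi> \<and>
         (\<forall>i\<in>{1..n}. \<forall>j\<in>{1..m}.
            \<forall>a \<in> {f' i * x | x. x \<in> A (Elt i j)} + {x * f j | x. x \<in> A (Elt i j)}.
              a - u * a * u \<in> X01 + X10 \<and> \<phi> (a - u * a * u) = u * a * u - f' i * a * f j) \<and>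
         (\<forall>\<phi>'. linear_map_on scale (X01 + X10) B \<phi>' \<and>
            (\<forall>i\<in>{1..n}. \<forall>j\<in>{1..m}.
               \<forall>a \<in> {f' i * x | x. x \<in> A (Elt i j)} + {x * f j | x. x \<in> A (Elt i j)}.
                 \<phi>' (a - u * a * u) = u * a * u - f' i * a * f j)
            \<longrightarrow> (\<forall>v \<in> X01 + X10. \<phi>' v = \<phi> v)) \<and>
         (\<forall>b\<in>B. \<forall>v\<in>X10. \<phi> (b * v) = b * \<phi> v) \<and>
         (\<forall>j\<in>{1..m}. J10s j \<inter> {v \<in> X01 + X10. \<phi> v = 0} = {0} \<and>
            \<phi> ` J10s j \<inter> {b * f j | b. b \<in> B} = {0} \<and>
            {x * f j | x. x \<in> \<phi> ` J10s j} = {0}) \<and>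
         (\<forall>b\<in>B. \<forall>v\<in>X01. \<phi> (v * b) = \<phi> v * b) \<and>
         (\<forall>i\<in>{1..n}. J01s i \<inter> {v \<in> X01 + X10. \<phi> v = 0} = {0} \<and>
            \<phi> ` J01s i \<inter> {f' i * b | b. b \<in> B} = {0} \<and>
            {f' i * x | x. x \<in> \<phi> ` J01s i} = {0}) \<and>
         (\<forall>i\<in>{1..n}. \<forall>j\<in>{1..m}.
            is_direct_sum_list scale [J10 i j, J01 i j] (J10 i j + J01 i j) \<and>
            is_direct_sum_list scale
              [{f' i * b * f j | b. b \<in> B},
               {\<phi> v + v | v. v \<in> J10 i j + J01 i j},
               module.span scale
                 {\<phi> v * \<phi> w + v * \<phi> w + \<phi> v * w + v * w | v w. v \<in> J01s i \<and> w \<in> J10s j}]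
              (A (Elt i j))) \<and>
         (\<forall>i\<in>{1..n}. \<forall>j\<in>{1..m}. \<forall>s::nat. \<forall>v w :: nat \<Rightarrow> 'a.
            (\<forall>l\<in>{1..s}. v l \<in> J01s i \<and> w l \<in> J10s j) \<longrightarrow>
            ((\<Sum>l\<in>{1..s}. v l * w l) = 0 \<longleftrightarrow> (\<Sum>l\<in>{1..s}. \<phi> (v l) * \<phi> (w l)) = 0))) \<and>
     \<comment> \<open>(e)\<close>
     (\<exists>k D. 0 < k \<and> division_subalg scale D \<and> iso_to_matrices scale B k D \<and>
         vector_space.dim scale X01 \<le> (n - 1) * vector_space.dim scale B \<and>
         (n - 1) * vector_space.dim scale B = (n - 1) * k^2 * vector_space.dim scale D \<and>
         vector_space.dim scale X10 \<le> (m - 1) * vector_space.dim scale B \<and>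
         (m - 1) * vector_space.dim scale B = (m - 1) * k^2 * vector_space.dim scale D \<and>
         vector_space.dim scale J \<le> (n * m - 1) * vector_space.dim scale B \<and>
         (n * m - 1) * vector_space.dim scale B = (n * m - 1) * k^2 * vector_space.dim scale D)"
proof -
  interpret assoc_algebra scale by (rule algebra)
  obtain E where E: "finite_dimensional_vector_space scale E" using finite_dim by blast
  interpret finite_dim_algebra scale E
    using algebra E by (rule finite_dim_algebra.intro)
  interpret G: graded_simple_algebra scale S "rees_mult P" A
  proof unfold_locales
    fix s t assume "s \<in> S" "t \<in> S"
    then show "rees_mult P s t \<in> S" by (cases s; cases t) (auto simp: S_def rees_carrier_def)
  qed (fact grading simple)+
  obtain x0 y0 :: 'a where "x0 * y0 \<noteq> 0" using G.ex_product_ne_0 by blast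
  \<comment> \<open>The radical of a nilpotent algebra is everything;
    \<open>A\<^sup>2 = A \<noteq> 0\<close> excludes this.\<close>
  then have J_ne: "J \<noteq> UNIV" unfolding J_def by (rule jacobson_rad_neq_UNIV[OF G.products_span])
  have J_ideal: "two_sided_ideal scale J" unfolding J_def by (rule two_sided_ideal_jacobson_rad)
  have homog: "x \<in> \<Union> (A ` S)" if "i \<in> {1..n}" "j \<in> {1..m}" "x \<in> A (Elt i j)" for i j x
    using that by (auto simp: S_def rees_carrier_def)
  have mult: "x * y \<in> A (Elt i l)"
    if ij: "i \<in> {1..n}" "j \<in> {1..m}" "k \<in> {1..n}" "l \<in> {1..m}"
      and xy: "x \<in> A (Elt i j)" "y \<in> A (Elt k l)" for i j k l x y
  proof -
    have S: "Elt i j \<in> S" "Elt k l \<in> S" "Elt i l \<in> S"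
      using ij by (simp_all add: S_def rees_carrier_def)
    then have "x * y \<in> A (rees_mult P (Elt i j) (Elt k l))"
      using grading xy by (simp only: semigroup_grading_def)
    \<comment> \<open>If \<open>P j k\<close> fails, the product has degree \<open>Theta\<close> and
      is therefore \<open>0\<close>, which every component contains.\<close>
    moreover have "0 \<in> A (Elt i l)" using is_direct_sum_subspace[OF G.direct S(3)] by (rule subspace_0)
    ultimately show ?thesis using Theta_comp by (cases "P j k") simp_all
  qed
  interpret W: graded_wedderburn scale E "{1..n}" "{1..m}" "\<lambda>i j. A (Elt i j)" f' f u L R B J
  proof unfold_locales
    show "is_direct_sum scale ({1..n} \<times> {1..m}) (\<lambda>(i, j). A (Elt i j)) UNIV"
      using G.direct Theta_comp unfolding S_def by (rule rees_direct_sum)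
    show "x = 0" if "i \<in> {1..n}" "j \<in> {1..m}" "x \<in> A (Elt i j)" "x \<in> J" for i j x
      using G.proper_ideal_hom[OF J_ideal J_ne homog[OF that(1-3)] that(4)] .
    show "x * y \<in> A (Elt i l)"
      if "i \<in> {1..n}" "j \<in> {1..m}" "k \<in> {1..n}" "l \<in> {1..m}" "x \<in> A (Elt i j)" "y \<in> A (Elt k l)"
      for i j k l x y using that by (rule mult)
    show "f j \<in> L j" if "j \<in> {1..m}" for j using f_mem that by blast
    show "f' i \<in> R i" if "i \<in> {1..n}" for i using f'_mem that by blast
  qed (simp_all only: L_def R_def finite_atLeastAtMost idem_f idem_f' sum_f sum_f' J_ideal
      G.products_span u_one Wedderburn_Malcev)
  have J10: "J10 i j = W.left.left_part i j" and J01: "J01 i j = W.right.left_part j i" for i j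
    by (simp_all add: J10_def J01_def W.left.left_part_def W.right.left_part_def)
  have J10s: "J10s j = W.J10 j" if "j \<in> {1..m}" for j
    using W.left.direct_left_parts[OF that] by (simp add: J10s_def J10 is_direct_sum_def)
  have J01s: "J01s i = W.J01 i" if "i \<in> {1..n}" for i
    using W.right.direct_left_parts[OF that] by (simp add: J01s_def J01 is_direct_sum_def)
  have X10: "X10 = W.X10"
    using W.left.direct_left_corners by (simp add: X10_def J10s is_direct_sum_def)
  have X01: "X01 = W.X01"
    using W.right.direct_left_corners by (simp add: X01_def J01s is_direct_sum_def)
  have second: "(\<forall>j\<in>{1..m}. J10s j = {u * x - u * x * u | x. x \<in> L j}) \<and>
     (\<forall>i\<in>{1..n}. J01s i = {x * u - u * (x * u) | x. x \<in> R i})"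
    by (simp add: J10s J01s W.left.left_corner_def W.right.left_corner_def)
  have a1: "\<forall>j\<in>{1..m}. left_submodule scale B (J10s j) J \<and>
            is_direct_sum scale {1..n} (\<lambda>i. J10 i j) (J10s j)"
    using W.left_submodule_J10 W.left.direct_left_parts by (simp add: J10s J10)
  have a2: "\<forall>i\<in>{1..n}. right_submodule scale B (J01s i) J \<and>
            is_direct_sum scale {1..m} (\<lambda>j. J01 i j) (J01s i)"
    using W.right_submodule_J01 W.right.direct_left_parts by (simp add: J01s J01)
  have a3: "is_direct_sum scale {1..n} J01s X01"
    using W.right.direct_left_corners is_direct_sum_cong[of "{1..n}" J01s W.J01] J01s X01 by simp
  have a4: "is_direct_sum scale {1..m} J10s X10"
    using W.left.direct_left_corners is_direct_sum_cong[of "{1..m}" J10s W.J10] J10s X10 by simp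
  have a5: "is_direct_sum_list scale [X01, X10, subspace_prod scale J J] J"
    unfolding X01 X10 by (rule W.J_direct)
  have a6: "is_direct_sum scale ({1..n} \<times> {1..m}) (\<lambda>(i, j). subspace_prod scale (J01s i) (J10s j))
           (subspace_prod scale J J)"
  proof (subst is_direct_sum_cong)
    show "(case t of (i, j) \<Rightarrow> subspace_prod scale (J01s i) (J10s j)) =
      (case t of (i, j) \<Rightarrow> W.JJ_part i j)" if "t \<in> {1..n} \<times> {1..m}" for t
      using that J01s J10s by auto
  qed (rule W.JJ_parts_direct)
  have b1: "linear_map_on scale (X01 + X10) B W.phi"
    unfolding X01 X10 by (rule W.phi_linear)
  have b2: "\<forall>i\<in>{1..n}. \<forall>j\<in>{1..m}.
            \<forall>a \<in> {f' i * x | x. x \<in> A (Elt i j)} + {x * f j | x. x \<in> A (Elt i j)}.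
              a - u * a * u \<in> X01 + X10 \<and> W.phi (a - u * a * u) = u * a * u - f' i * a * f j"
    unfolding X01 X10 by (intro ballI conjI W.phi_generator)
  have b3: "\<forall>\<phi>'. linear_map_on scale (X01 + X10) B \<phi>' \<and>
            (\<forall>i\<in>{1..n}. \<forall>j\<in>{1..m}.
               \<forall>a \<in> {f' i * x | x. x \<in> A (Elt i j)} + {x * f j | x. x \<in> A (Elt i j)}.
                 \<phi>' (a - u * a * u) = u * a * u - f' i * a * f j)
            \<longrightarrow> (\<forall>v \<in> X01 + X10. \<phi>' v = W.phi v)"
    unfolding X01 X10
  proof (intro allI impI ballI)
    fix \<phi>' v
    assume *: "linear_map_on scale (W.X01 + W.X10) B \<phi>' \<and>
            (\<forall>i\<in>{1..n}. \<forall>j\<in>{1..m}.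
               \<forall>a \<in> {f' i * x | x. x \<in> A (Elt i j)} + {x * f j | x. x \<in> A (Elt i j)}.
                 \<phi>' (a - u * a * u) = u * a * u - f' i * a * f j)" and v: "v \<in> W.X01 + W.X10"
    show "\<phi>' v = W.phi v"
      by (rule W.phi_unique[OF conjunct1[OF *] _ v]) (rule conjunct2[OF *, rule_format])
  qed
  have b4: "\<forall>b\<in>B. \<forall>v\<in>X10. W.phi (b * v) = b * W.phi v"
    unfolding X10 by (intro ballI W.phi_left)
  have b5: "\<forall>j\<in>{1..m}. J10s j \<inter> {v \<in> X01 + X10. W.phi v = 0} = {0} \<and>
            W.phi ` J10s j \<inter> {b * f j | b. b \<in> B} = {0} \<and>
            {x * f j | x. x \<in> W.phi ` J10s j} = {0}"
    unfolding X01 X10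
  proof
    fix j assume j: "j \<in> {1..m}"
    show "J10s j \<inter> {v \<in> W.X01 + W.X10. W.phi v = 0} = {0} \<and>
      W.phi ` J10s j \<inter> {b * f j | b. b \<in> B} = {0} \<and> {x * f j | x. x \<in> W.phi ` J10s j} = {0}"
      unfolding J10s[OF j] by (intro conjI W.phi_J10_kernel[OF j])
  qed
  have b6: "\<forall>b\<in>B. \<forall>v\<in>X01. W.phi (v * b) = W.phi v * b"
    unfolding X01 by (intro ballI W.phi_right)
  have b7: "\<forall>i\<in>{1..n}. J01s i \<inter> {v \<in> X01 + X10. W.phi v = 0} = {0} \<and>
            W.phi ` J01s i \<inter> {f' i * b | b. b \<in> B} = {0} \<and>
            {f' i * x | x. x \<in> W.phi ` J01s i} = {0}"
    unfolding X01 X10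
  proof
    fix i assume i: "i \<in> {1..n}"
    show "J01s i \<inter> {v \<in> W.X01 + W.X10. W.phi v = 0} = {0} \<and>
      W.phi ` J01s i \<inter> {f' i * b | b. b \<in> B} = {0} \<and> {f' i * x | x. x \<in> W.phi ` J01s i} = {0}"
      unfolding J01s[OF i] by (intro conjI W.phi_J01_kernel[OF i])
  qed
  have c: "\<forall>i\<in>{1..n}. \<forall>j\<in>{1..m}.
            is_direct_sum_list scale [J10 i j, J01 i j] (J10 i j + J01 i j) \<and>
            is_direct_sum_list scale
              [{f' i * b * f j | b. b \<in> B},
               {W.phi v + v | v. v \<in> J10 i j + J01 i j},
               module.span scale
                 {W.phi v * W.phi w + v * W.phi w + W.phi v * w + v * w | v w. v \<in> J01s i \<and> w \<in> J10s j}]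
              (A (Elt i j))"
  proof (intro ballI)
    fix i j assume i: "i \<in> {1..n}" and j: "j \<in> {1..m}"
    show "is_direct_sum_list scale [J10 i j, J01 i j] (J10 i j + J01 i j) \<and>
            is_direct_sum_list scale
              [{f' i * b * f j | b. b \<in> B},
               {W.phi v + v | v. v \<in> J10 i j + J01 i j},
               module.span scale
                 {W.phi v * W.phi w + v * W.phi w + W.phi v * w + v * w | v w. v \<in> J01s i \<and> w \<in> J10s j}]
              (A (Elt i j))"
      unfolding J10 J01 J10s[OF j] J01s[OF i]
      using W.parts_direct[OF i j] W.component_direct[OF i j] unfolding W.gen_space_def by blast
  qed
  have d: "\<forall>i\<in>{1..n}. \<forall>j\<in>{1..m}. \<forall>s::nat. \<forall>v w :: nat \<Rightarrow> 'a.
            (\<forall>l\<in>{1..s}. v l \<in> J01s i \<and> w l \<in> J10s j) \<longrightarrow>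
            ((\<Sum>l\<in>{1..s}. v l * w l) = 0 \<longleftrightarrow> (\<Sum>l\<in>{1..s}. W.phi (v l) * W.phi (w l)) = 0)"
  proof (intro ballI allI impI)
    fix i j and s :: nat and v w :: "nat \<Rightarrow> 'a"
    assume i: "i \<in> {1..n}" and j: "j \<in> {1..m}" and vw: "\<forall>l\<in>{1..s}. v l \<in> J01s i \<and> w l \<in> J10s j"
    show "(\<Sum>l\<in>{1..s}. v l * w l) = 0 \<longleftrightarrow> (\<Sum>l\<in>{1..s}. W.phi (v l) * W.phi (w l)) = 0"
      using vw unfolding J01s[OF i] J10s[OF j] by (rule W.sum_mult_eq_0_iff[OF i j])
  qed
  \<comment> \<open>With \<open>u = 0\<close> also \<open>B = 0\<close>, and the radical would be
    the whole algebra.\<close>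
  have u_ne: "u \<noteq> 0"
  proof
    assume "u = 0"
    then have "b = 0" if "b \<in> B" for b using W.u_left[OF that] by simp
    then have "x \<in> J" for x using W.B_J_sum[of x] by force
    with J_ne show False by blast
  qed
  have "x \<in> B \<Longrightarrow> x \<noteq> 0 \<Longrightarrow> u \<in> span {a * x * b | a b. a \<in> B \<and> b \<in> B}" for x
    by (rule W.B_simple[OF G.hom_ideal_UNIV[OF homog]])
  from simple_algebra_matrices[OF W.B_subalg u_one u_ne this]
  obtain k D where kD: "0 < k" "division_subalg scale D" "iso_to_matrices scale B k D"
    "dim B = k\<^sup>2 * dim D" by blast
  have dims: "dim X01 \<le> (n - 1) * dim B" "dim X10 \<le> (m - 1) * dim B" "dim J \<le> (n * m - 1) * dim B"
    using W.dim_X01 W.dim_X10 W.dim_J unfolding X01 X10 by simp_all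
  have e: "\<exists>k D. 0 < k \<and> division_subalg scale D \<and> iso_to_matrices scale B k D \<and>
         dim X01 \<le> (n - 1) * dim B \<and>
         (n - 1) * dim B = (n - 1) * k^2 * dim D \<and>
         dim X10 \<le> (m - 1) * dim B \<and>
         (m - 1) * dim B = (m - 1) * k^2 * dim D \<and>
         dim J \<le> (n * m - 1) * dim B \<and>
         (n * m - 1) * dim B = (n * m - 1) * k^2 * dim D"
    by (intro exI[of _ k] exI[of _ D] conjI kD dims) (simp_all add: kD(4) mult.assoc)
  show ?thesis
    by (intro conjI second[THEN conjunct1] second[THEN conjunct2] a1 a2 a3 a4 a5 a6
        exI[of _ W.phi] b1 b2 b3 b4 b5 b6 b7 c d e)
qed

end
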